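(* Let $f,g_1,\dots,g_m\in\mathbb{R}[x]$, $g=(g_1,\dots,g_m)$ and $f^\star:=\inf_{x\in S(g)}f(x)$. Assume that the problem $\inf_{x\in S(g)}f(x)$ has at least one global minimizer, that each $g_j$ is concave (as a function on $\mathbb{R}^n$), and that $S(g)$ has a non-empty interior. Then $S(g)$ is convex and there exists $k\in\mathbb{N}$ such that $\rho_k(f,\Pi g,h_{\mathrm{FJ}}^+)=f^\star$. Moreover, if $S(g)$ satisfies the Archimedean condition, there exists $k\in\mathbb{N}$ such that $\rho_k(f,g,h_{\mathrm{FJ}}^+)=f^\star$.
   Context: Let $n,m\ge 1$, $x=(x_1,\dots,x_n)$, $\bar\lambda:=(\lambda_0,\dots,\lambda_m)$; polynomials in $x$ are also regarded as polynomials in $z:=(x,\bar\lambda)$. $\nabla p$ is the (column) gradient with respect to $x$. $S(g):=\{x\in\mathbb{R}^n : g_j(x)\ge 0,\ j=1,\dots,m\}$. $S(g)$ satisfies the Archimedean condition if there is $R>0$ with $R-x_1^2-\dots-x_n^2\in\Sigma^2[x]+\sum_{j=1}^m g_j\Sigma^2[x]$, where $\Sigma^2[\cdot]$ denotes the cone of sums of squares of polynomials. $\Pi g:=(g^\alpha)_{\alpha\in\{0,1\}^m\setminus\{0\}}$ with $g^\alpha:=g_1^{\alpha_1}\cdots g_m^{\alpha_m}$. The tuple $h_{\mathrm{FJ}}^+$ of $n+m+1$ polynomials in $\mathbb{R}[z]$ is $$h_{\mathrm{FJ}}^+:=\Big(\lambda_0^2\nabla f-\sum_{j=1}^m\lambda_j^2\nabla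 g_j,\ \lambda_1^2g_1,\dots,\lambda_m^2g_m,\ 1-\sum_{j=0}^m\lambda_j^2\Big).$$ For tuples $G=(G_1,\dots,G_s)$ and $h=(h_1,\dots,h_l)$ in $\mathbb{R}[z]$ and $k\in\mathbb{N}$, $$Q_k(G)[z]:=\Big\{\sigma_0+\sum_{j=1}^s\sigma_jG_j : \sigma_j\in\Sigma^2[z],\ \deg\sigma_0\le 2k,\ \deg(\sigma_jG_j)\le 2k\Big\},$$ $$I_k(h)[z]:=\Big\{\sum_{t=1}^l\psi_th_t : \psi_t\in\mathbb{R}[z],\ \deg(\psi_th_t)\le 2k\Big\},$$ $$\rho_k(f,G,h):=\sup\{\xi\in\mathbb{R} : f-\xi\in Q_k(G)[z]+I_k(h)[z]\}.$$
   Formalization: The formal theorem additionally assumes that no g_j is the zero polynomial; without this the claim fails, e.g. n=2, m=1, g_1=0 and f the Motzkin polynomial, where ρ_k = −∞ for all k but f* = 0. *)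

theory Defs
  imports "HOL-Analysis.Analysis" "HOL-Library.Poly_Mapping"
begin

text \<open>
  Real polynomials in variables indexed by a type \<open>'v\<close>: finitely supported maps from monomials
  (finitely supported exponent vectors) to coefficients. Multiplication is the convolution
  product of \<^theory>\<open>HOL-Library.Poly_Mapping\<close>.
\<close>

type_synonym 'v mpoly = "('v \<Rightarrow>\<^sub>0 nat) \<Rightarrow>\<^sub>0 real"

definition mconst :: "real \<Rightarrow> 'v mpoly" where
  "mconst c = Poly_Mapping.single 0 c"

definition mvar :: "'v \<Rightarrow> 'v mpoly" where
  "mvar i = Poly_Mapping.single (Poly_Mapping.single i 1) 1"

text \<open>The total degree; the zero polynomial gets degree 0.\<close>

definition mdeg :: "'v mpoly \<Rightarrow> nat" where
  "mdeg p = Max (insert 0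
     ((\<lambda>a. \<Sum>i\<in>Poly_Mapping.keys a. Poly_Mapping.lookup a i) ` Poly_Mapping.keys p))"

definition msubst :: "(real \<Rightarrow> 'a) \<Rightarrow> ('v \<Rightarrow> 'a) \<Rightarrow> 'v mpoly \<Rightarrow> 'a::comm_semiring_1" where
  "msubst c \<phi> p = (\<Sum>a\<in>Poly_Mapping.keys p.
     c (Poly_Mapping.lookup p a) * (\<Prod>i\<in>Poly_Mapping.keys a. \<phi> i ^ Poly_Mapping.lookup a i))"

definition peval :: "'n::finite mpoly \<Rightarrow> real ^ 'n \<Rightarrow> real" where
  "peval p x = msubst (\<lambda>c. c) (\<lambda>i. x $ i) p"

text \<open>
  The formal partial derivative. If \<open>i\<close> does not occur in the monomial \<open>a\<close>, the subtraction of
  exponents is truncated, but the factor \<open>lookup a i\<close> is then 0.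
\<close>

definition mderiv :: "'v \<Rightarrow> 'v mpoly \<Rightarrow> 'v mpoly" where
  "mderiv i p = (\<Sum>a\<in>Poly_Mapping.keys p.
     Poly_Mapping.single (a - Poly_Mapping.single i 1)
       (Poly_Mapping.lookup p a * of_nat (Poly_Mapping.lookup a i)))"

definition SOS :: "'v mpoly set" where
  "SOS = {p. \<exists>qs. p = (\<Sum>q\<leftarrow>qs. q ^ 2)}"

definition feasible :: "('m \<Rightarrow> 'n::finite mpoly) \<Rightarrow> (real ^ 'n) set" where
  "feasible g = {x. \<forall>j. peval (g j) x \<ge> 0}"

definition has_global_minimizer :: "'n::finite mpoly \<Rightarrow> ('m \<Rightarrow> 'n mpoly) \<Rightarrow> bool" where
  "has_global_minimizer f g \<longleftrightarrow> (\<exists>x\<in>feasible g. \<forall>y\<in>feasible g. peval f x \<le> peval f y)"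

definition opt_val :: "'n::finite mpoly \<Rightarrow> ('m \<Rightarrow> 'n mpoly) \<Rightarrow> ereal" where
  "opt_val f g = (INF x\<in>feasible g. ereal (peval f x))"

definition archimedean :: "('m::finite \<Rightarrow> 'n::finite mpoly) \<Rightarrow> bool" where
  "archimedean g \<longleftrightarrow> (\<exists>R>0. \<exists>\<sigma>0\<in>SOS. \<exists>\<sigma>. (\<forall>j. \<sigma> j \<in> SOS) \<and>
     mconst R - (\<Sum>i\<in>UNIV. mvar i ^ 2) = \<sigma>0 + (\<Sum>j\<in>UNIV. g j * \<sigma> j))"

text \<open>
  The variables \<open>z = (x, \<lambda>\<^sub>0, \<dots>, \<lambda>\<^sub>m)\<close>: \<open>Inl i\<close> is \<open>x\<^sub>i\<close>, \<open>Inr None\<close> is \<open>\<lambda>\<^sub>0\<close>, and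
  \<open>Inr (Some j)\<close> is \<open>\<lambda>\<^sub>j\<close> for \<open>j\<close> in the index type \<open>'m\<close> of the constraints.
\<close>

type_synonym ('n, 'm) zvar = "'n + 'm option"

definition lam :: "'m option \<Rightarrow> ('n, 'm) zvar mpoly" where
  "lam j = mvar (Inr j)"

text \<open>A polynomial in \<open>x\<close> regarded as a polynomial in \<open>z\<close>.\<close>

definition in_z :: "'n mpoly \<Rightarrow> ('n, 'm) zvar mpoly" where
  "in_z p = msubst mconst (\<lambda>i. mvar (Inl i)) p"

text \<open>
  Tuples of polynomials are families over a finite index set. The products \<open>g\<^sup>\<alpha>\<close> are indexed by
  the nonzero \<open>\<alpha> \<in> {0,1}\<^sup>m\<close>, the Fritz John system by the sum type \<open>'n + 'm option\<close>, giving
  \<open>n + m + 1\<close> polynomials: \<open>Inl i\<close> is the \<open>i\<close>-th component of the gradient equation,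
  \<open>Inr (Some j)\<close> the \<open>j\<close>-th complementarity and \<open>Inr None\<close> the normalization.
\<close>

definition prod_index :: "('m \<Rightarrow> nat) set" where
  "prod_index = {\<alpha>. (\<forall>j. \<alpha> j \<in> {0, 1})} - {\<lambda>_. 0}"

definition prod_tuple :: "('m::finite \<Rightarrow> 'v mpoly) \<Rightarrow> ('m \<Rightarrow> nat) \<Rightarrow> 'v mpoly" where
  "prod_tuple g \<alpha> = (\<Prod>j\<in>UNIV. g j ^ \<alpha> j)"

fun h_FJ_plus ::
  "'n mpoly \<Rightarrow> ('m::finite \<Rightarrow> 'n mpoly) \<Rightarrow> 'n + 'm option \<Rightarrow> ('n, 'm) zvar mpoly" where
  "h_FJ_plus f g (Inl i) =
     lam None ^ 2 * in_z (mderiv i f) - (\<Sum>j\<in>UNIV. lam (Some j) ^ 2 * in_z (mderiv i (g j)))"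
| "h_FJ_plus f g (Inr (Some j)) = lam (Some j) ^ 2 * in_z (g j)"
| "h_FJ_plus f g (Inr None) = 1 - (\<Sum>j\<in>UNIV. lam j ^ 2)"

definition Q_trunc :: "nat \<Rightarrow> 's set \<Rightarrow> ('s \<Rightarrow> 'v mpoly) \<Rightarrow> 'v mpoly set" where
  "Q_trunc k J G = {\<sigma>0 + (\<Sum>j\<in>J. \<sigma> j * G j) | \<sigma>0 \<sigma>.
     \<sigma>0 \<in> SOS \<and> mdeg \<sigma>0 \<le> 2 * k \<and> (\<forall>j\<in>J. \<sigma> j \<in> SOS \<and> mdeg (\<sigma> j * G j) \<le> 2 * k)}"

definition I_trunc :: "nat \<Rightarrow> 'l set \<Rightarrow> ('l \<Rightarrow> 'v mpoly) \<Rightarrow> 'v mpoly set" where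
  "I_trunc k T h = {(\<Sum>t\<in>T. \<psi> t * h t) | \<psi>. \<forall>t\<in>T. mdeg (\<psi> t * h t) \<le> 2 * k}"

text \<open>The supremum is taken in the extended reals, so it is \<open>-\<infinity>\<close> if no \<open>\<xi>\<close> is admissible.\<close>

definition rho ::
  "nat \<Rightarrow> 'v mpoly \<Rightarrow> 's set \<Rightarrow> ('s \<Rightarrow> 'v mpoly) \<Rightarrow> 'l set \<Rightarrow> ('l \<Rightarrow> 'v mpoly) \<Rightarrow> ereal" where
  "rho k f J G T h = (SUP \<xi>\<in>{\<xi>. \<exists>q\<in>Q_trunc k J G. \<exists>r\<in>I_trunc k T h. f - mconst \<xi> = q + r}. ereal \<xi>)"

end

theory Submission
  imports Defs "HOL-Algebra.Algebraic_Closure_Type" "HOL-Library.Multiset_Order"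
begin

hide_const (open) Polynomials.degree Polynomials.lead_coeff up_ring.coeff up_ring.monom Coset.order Congruence.set_eq module.smult

text \<open>Suppose that the full cone \<open>M\<close> (all degrees) does not contain \<open>- w\<^sup>2\<close> for any product \<open>w\<close> of polynomials
  \<open>f - c\<close> with \<open>c \<ge> f\<^sup>\<star>\<close>. By Zorn's lemma \<open>M\<close> then extends to a module \<open>Q\<close> with \<open>Q \<union> - Q\<close> everything and
  whose support \<open>I = Q \<inter> - Q\<close> is a real prime ideal avoiding all these \<open>w\<close>. It contains the Fritz John
  system but not \<open>\<lambda>\<^sub>0\<close>: real points of \<open>I\<close> are provided by the Artin-Lang principle, respectively by
  Archimedeanity, and concavity together with a Slater point excludes \<open>\<lambda>\<^sub>0 = 0\<close> there. If \<open>f\<close> were transcendental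
  modulo \<open>I\<close>, the derivation \<open>d/df\<close> would extend to the residue field and, applied to the
  Fritz John system, give \<open>\<lambda>\<^sub>0\<^sup>2 = 0\<close> modulo \<open>I\<close>. So \<open>f\<close> is algebraic, hence a real constant \<open>c\<close>
  modulo the real ideal \<open>I\<close>, and \<open>c \<ge> f\<^sup>\<star>\<close> by evaluation at a feasible real point: a contradiction.

  From some \<open>- w\<^sup>2 \<in> M\<close> one obtains \<open>f - f\<^sup>\<star> + \<epsilon> \<in> Q\<^sub>k + I\<^sub>k\<close> for all \<open>\<epsilon> > 0\<close> and one \<open>k\<close>, so
  \<open>\<rho>\<^sub>k \<ge> f\<^sup>\<star>\<close>. For the converse inequality a minimizer is completed to a real zero of the system by
  the Fritz John multipliers.\<close>

subsection \<open>Real closed fields\<close>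

text \<open>Exactness at a finite order is a uniformity statement: one degree bound has to serve all
  \<epsilon>. The classical reason is that f takes finitely many values on the real variety of the
  system; a semialgebraic decomposition of that variety is avoided here. Each real prime support
  contributes one critical value, and the multiplicative set of the products \<open>w\<close>
  compresses all of them into a single certificate \<open>- w^2\<close>. A single certificate has a
  single degree, and the critical values above the optimum do no harm, because the square roots of
  their excess can be interpolated.

  The main obstacle is that an ordering of the residue field need not be Archimedean, so it does not
  by itself yield a real point. With all products of the g_j at hand, signs are carried from a real
  closure to the reals by quantifier elimination. With the g_j alone, multiplication by g_j need not
  preserve the cone, so that route gives no feasible point; there the Archimedean condition yields a
  real point at which the whole of \<open>Q\<close> is nonnegative.

  Multipliers occur squared in the system, so every real zero has nonnegative multipliers.\<close>

class rcf = linordered_field +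
  assumes sum_root_between: "a < b \<Longrightarrow> (\<Sum>k\<le>n. f k * a ^ k) < 0 \<Longrightarrow> 0 < (\<Sum>k\<le>n. f k * b ^ k)
    \<Longrightarrow> \<exists>c>a. c < b \<and> (\<Sum>k\<le>n. f k * c ^ k) = 0"

instance real :: rcf
proof
  fix a b :: real and n :: nat and f :: "nat \<Rightarrow> real"
  assume h: "a < b" "(\<Sum>k\<le>n. f k * a ^ k) < 0" "0 < (\<Sum>k\<le>n. f k * b ^ k)"
  have "\<exists>c\<ge>a. c \<le> b \<and> (\<Sum>k\<le>n. f k * c ^ k) = 0"
    by (rule IVT') (use h in \<open>auto intro!: continuous_intros\<close>)
  then show "\<exists>c>a. c < b \<and> (\<Sum>k\<le>n. f k * c ^ k) = 0"
    using h by (metis less_eq_real_def less_irrefl)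
qed

text \<open>The value is an integer, so that signs in two different fields can be compared.\<close>

definition sg :: "'a::linordered_idom \<Rightarrow> int" where
  "sg u = (if u < 0 then - 1 else if u = 0 then 0 else 1)"

lemma sg_mult: "sg (u * v) = sg u * sg v"
  by (auto simp: sg_def mult_less_0_iff)

lemma sg_0 [simp]: "sg 0 = 0"
  by (simp add: sg_def)

lemma sg_eq_0_iff [simp]: "sg u = 0 \<longleftrightarrow> u = 0"
  by (simp add: sg_def)

lemma sg_neg_iff: "sg u = -1 \<longleftrightarrow> u < 0"
  by (simp add: sg_def)

lemma sg_pos_iff: "sg u = 1 \<longleftrightarrow> 0 < u"
  by (auto simp: sg_def)

section \<open>Intermediate values, Rolle's theorem and monotonicity over a real closed
  field\<close>

lemma poly_root_between:
  fixes p :: "'a::rcf poly"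
  assumes "a < b" "poly p a * poly p b < 0"
  shows "\<exists>c>a. c < b \<and> poly p c = 0"
proof (cases "poly p a < 0")
  case True
  then show ?thesis
    using sum_root_between[of a b "coeff p" "degree p"] assms
    by (auto simp: poly_altdef mult_less_0_iff)
next
  case False
  then show ?thesis
    using sum_root_between[of a b "coeff (-p)" "degree p"] assms
    by (auto simp: poly_altdef mult_less_0_iff sum_negf)
qed

lemma sg_poly_eq:
  fixes p :: "'a::rcf poly"
  assumes "a \<le> b" "\<And>c. a \<le> c \<Longrightarrow> c \<le> b \<Longrightarrow> poly p c \<noteq> 0"
  shows "sg (poly p a) = sg (poly p b)"
proof (rule ccontr)
  assume ne: "sg (poly p a) \<noteq> sg (poly p b)"
  then have "a < b" using assms(1) by (auto simp: order_less_le)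
  moreover have "poly p a * poly p b < 0"
    using ne assms(2)[of a] assms(2)[of b] \<open>a < b\<close>
    by (auto simp: sg_def mult_less_0_iff split: if_splits)
  ultimately show False using poly_root_between[of a b p] assms(2) by (meson less_imp_le)
qed

text \<open>The product rule for \<open>A ^ Suc m * (B ^ Suc n * g)\<close> with
  \<open>A' = B' = 1\<close>: \<open>Am\<close>, \<open>Bn\<close> stand for the m-th and n-th
  powers, \<open>M\<close>, \<open>N\<close> for the factors m + 1 and n + 1.\<close>

lemma product_identity:
  "A * Am * (B * Bn * g' + g * (N * Bn * 1)) + B * Bn * g * (M * Am * 1)
    = Am * Bn * (M * (B * g) + N * (A * g) + A * B * g')"
  for A B Am Bn M N g g' :: "'a::comm_ring_1"
  by (simp add: algebra_simps)

text \<open>No maximum principle is at hand over a general real closed field. Split off the full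
  multiplicities at both roots: the cofactor \<open>g\<close> keeps its sign on the closed interval,
  and the remaining factor \<open>h\<close> of the derivative is a positive multiple of
  \<open>(a - b) g(a)\<close> at a and of \<open>(b - a) g(b)\<close> at b, so it changes
  sign.\<close>

lemma poly_rolle_consecutive:
  fixes p :: "'a::rcf poly"
  assumes "a < b" "poly p a = 0" "poly p b = 0" and nr: "\<And>c. a < c \<Longrightarrow> c < b \<Longrightarrow> poly p c \<noteq> 0"
  shows "\<exists>c>a. c < b \<and> poly (pderiv p) c = 0"
proof -
  have p0: "p \<noteq> 0" using nr[of "(a+b)/2"] assms(1) by auto
  obtain g1 where g1: "p = [:-a,1:] ^ order a p * g1" "\<not> [:-a,1:] dvd g1"
    using order_decomp[OF p0] by blast
  have g10: "g1 \<noteq> 0" using p0 g1 by auto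
  obtain g where g: "g1 = [:-b,1:] ^ order b g1 * g" "\<not> [:-b,1:] dvd g"
    using order_decomp[OF g10] by blast
  have "poly g1 b = 0" using assms g1 by (metis (no_types, lifting) eq_iff_diff_eq_0 
     mult_eq_0_iff less_irrefl poly_mult poly_power power_eq_0_iff poly_pCons mult_zero_right add.right_neutral mult.right_neutral add.commute diff_conv_add_uminus mult.commute poly_0)
  then obtain n where n: "order b g1 = Suc n" using g10 order_root[of g1 b] by (cases "order b g1") auto
  obtain m where m: "order a p = Suc m" using p0 assms order_root[of p a] by (cases "order a p") auto
  define A where "A = [:-a,1:]"
  define B where "B = [:-b,1:]"
  have p: "p = A ^ Suc m * (B ^ Suc n * g)" using g1(1) g(1) n m by (simp add: A_def B_def)
  define h where "h = smult (of_nat (Suc m)) (B * g) + smult (of_nat (Suc n)) (A * g) + A * B * pderiv g"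
  have dA: "pderiv A = 1" "pderiv B = 1" by (auto simp: A_def B_def pderiv_pCons one_pCons)
  have sm: "smult c x = [:c:] * x" for c :: 'a and x by simp
  have pd: "pderiv p = A ^ m * B ^ n * h"
    unfolding p h_def pderiv_mult pderiv_power_Suc dA sm unfolding power_Suc
    by (rule product_identity)
  have ga: "poly g a \<noteq> 0"
  proof
    assume "poly g a = 0"
    then have "[:-a,1:] dvd g" by (simp add: poly_eq_0_iff_dvd)
    moreover have "g dvd g1" using g(1) by (metis dvd_triv_right)
    ultimately have "[:-a,1:] dvd g1" by (rule dvd_trans)
    then show False using g1(2) by simp
  qed
  have gb: "poly g b \<noteq> 0" using g(2) poly_eq_0_iff_dvd by blast
  have gab: "sg (poly g a) = sg (poly g b)"
  proof (rule sg_poly_eq)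
    fix c assume "a \<le> c" "c \<le> b"
    then show "poly g c \<noteq> 0" using ga gb nr[of c]
      by (cases "c = a"; cases "c = b") (auto simp: p)
  qed (use assms in auto)
  have pAB: "poly A a = 0" "poly B b = 0" "poly A b = b - a" "poly B a = a - b"
    by (auto simp: A_def B_def)
  have ha: "poly h a = of_nat (Suc m) * ((a - b) * poly g a)"
    by (simp add: h_def pAB del: of_nat_Suc)
  have hb: "poly h b = of_nat (Suc n) * ((b - a) * poly g b)"
    by (simp add: h_def pAB del: of_nat_Suc)
  have "sg (poly h a) * sg (poly h b) = -1"
  proof -
    have "sg (of_nat (Suc n) :: 'a) = 1" "sg (of_nat (Suc m) :: 'a) = 1"
      by (auto simp: sg_def simp del: of_nat_Suc)
    moreover have "sg (a - b) = -1" "sg (b - a) = 1" using assms by (auto simp: sg_def)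
    moreover have "sg (poly g b) * sg (poly g b) = 1" using gb by (auto simp: sg_def)
    ultimately show ?thesis unfolding ha hb sg_mult gab by simp
  qed
  then have "poly h a * poly h b < 0" unfolding sg_mult[symmetric] sg_neg_iff .
  from poly_root_between[OF assms(1) this] show ?thesis unfolding pd by auto
qed

text \<open>Reduction to consecutive roots: \<open>b\<close> is replaced by the least root beyond
  \<open>a\<close>.\<close>

lemma poly_rolle:
  fixes p :: "'a::rcf poly"
  assumes "a < b" "poly p a = 0" "poly p b = 0"
  shows "\<exists>c>a. c < b \<and> poly (pderiv p) c = 0"
proof (cases "p = 0")
  case True
  then show ?thesis using dense[OF assms(1)] by auto
next
  case False
  define S where "S = {x. poly p x = 0} \<inter> {x. a < x}"
  have S: "finite S" "b \<in> S" using poly_roots_finite[OF False] assms by (auto simp: S_def)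
  define b' where "b' = Min S"
  have b': "b' \<in> S" "b' \<le> b" using S Min_in[of S] Min_le[of S b] unfolding b'_def by blast+
  have "\<exists>c>a. c < b' \<and> poly (pderiv p) c = 0"
  proof (rule poly_rolle_consecutive)
    fix c assume "a < c" "c < b'"
    then have "c \<notin> S" using Min.coboundedI[OF S(1), of c] unfolding b'_def by fastforce
    then show "poly p c \<noteq> 0" using \<open>a < c\<close> by (auto simp: S_def)
  qed (use b' assms in \<open>auto simp: S_def\<close>)
  then show ?thesis using b' by force
qed

lemma poly_inj_between:
  fixes p :: "'a::rcf poly"
  assumes nr: "\<And>c. a < c \<Longrightarrow> c < b \<Longrightarrow> poly (pderiv p) c \<noteq> 0"
    and "a \<le> u" "u < v" "v \<le> b"
  shows "poly p u \<noteq> poly p v"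
proof
  assume "poly p u = poly p v"
  then have "\<exists>c>u. c < v \<and> poly (pderiv (p - [:poly p u:])) c = 0"
    using assms by (intro poly_rolle) auto
  then show False using nr assms by (force simp: pderiv_diff pderiv_pCons)
qed

lemma sg_between_opposite:
  fixes p :: "'a::rcf poly"
  assumes nr: "\<And>c. a < c \<Longrightarrow> c < b \<Longrightarrow> poly (pderiv p) c \<noteq> 0"
    and ab: "a < b" and "poly p a * poly p b < 0"
  shows "\<exists>c>a. c < b \<and> poly p c = 0 \<and> (\<forall>x. a < x \<longrightarrow> x < b \<longrightarrow>
     (x < c \<longrightarrow> sg (poly p x) = sg (poly p a)) \<and> (c < x \<longrightarrow> sg (poly p x) = sg (poly p b)))"
proof -
  obtain c where c: "a < c" "c < b" "poly p c = 0" using poly_root_between assms by blast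
  have "sg (poly p a) = sg (poly p x)" if "a < x" "x < c" for x
  proof (rule sg_poly_eq)
    fix d assume "a \<le> d" "d \<le> x"
    then show "poly p d \<noteq> 0" using poly_inj_between[of a b p d c] nr c that by auto
  qed (use that in auto)
  moreover have "sg (poly p x) = sg (poly p b)" if "c < x" "x < b" for x
  proof (rule sg_poly_eq)
    fix d assume "x \<le> d" "d \<le> b"
    then show "poly p d \<noteq> 0" using poly_inj_between[of a b p c d] nr c that by auto
  qed (use that in auto)
  ultimately show ?thesis using c by metis
qed

lemma sg_between_same:
  fixes p :: "'a::rcf poly"
  assumes nr: "\<And>c. a < c \<Longrightarrow> c < b \<Longrightarrow> poly (pderiv p) c \<noteq> 0"
    and x: "a < x" "x < b" and ns: "\<not> poly p a * poly p b < 0"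
  shows "sg (poly p x) = (if poly p a = 0 then sg (poly p b) else sg (poly p a))"
proof -
  have nz: "poly p c \<noteq> 0" if c: "a < c" "c < b" for c
  proof
    assume c0: "poly p c = 0"
    have ne: "poly p a \<noteq> 0" "poly p b \<noteq> 0"
      using poly_inj_between[of a b p a c] poly_inj_between[of a b p c b] nr c c0 by auto
    \<comment> \<open>A level strictly between 0 and both end values, which have the same sign. If p
      vanished at c, it would take the value m on both sides of c, against injectivity.\<close>
    define m where "m = (if 0 < poly p a then min (poly p a) (poly p b) / 2 else max (poly p a) (poly p b) / 2)"
    have pos: "0 < poly p a \<longleftrightarrow> 0 < poly p b" "poly p a < 0 \<longleftrightarrow> poly p b < 0"
      using ns ne by (auto simp: mult_less_0_iff)
    have m: "(poly p a - m) * (poly p c - m) < 0" "(poly p c - m) * (poly p b - m) < 0"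
    proof -
      consider "0 < poly p a" "0 < poly p b" | "poly p a < 0" "poly p b < 0"
        using ne pos by (metis linorder_neqE_linordered_idom)
      then have "(poly p a - m) * (- m) < 0 \<and> (- m) * (poly p b - m) < 0"
      proof cases
        case 1
        then have "0 < m" "m < poly p a" "m < poly p b" by (auto simp: m_def min_def)
        then show ?thesis by (simp add: mult_less_0_iff)
      next
        case 2
        then have "m < 0" "poly p a < m" "poly p b < m" by (auto simp: m_def max_def)
        then show ?thesis by (simp add: zero_less_mult_iff)
      qed
      then show "(poly p a - m) * (poly p c - m) < 0" "(poly p c - m) * (poly p b - m) < 0"
        using c0 by auto
    qed
    obtain u where u: "a < u" "u < c" "poly p u = m"
      using poly_root_between[of a c "p - [:m:]"] c m by auto
    obtain v where v: "c < v" "v < b" "poly p v = m"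
      using poly_root_between[of c b "p - [:m:]"] c m by auto
    show False using poly_inj_between[of a b p u v] nr u v by auto
  qed
  show ?thesis
  proof (cases "poly p a = 0")
    case False
    have "sg (poly p a) = sg (poly p x)"
    proof (rule sg_poly_eq)
      fix d assume "a \<le> d" "d \<le> x"
      then show "poly p d \<noteq> 0" using nz[of d] False x by (cases "d = a") auto
    qed (use x in auto)
    then show ?thesis using False by simp
  next
    case True
    have "poly p b \<noteq> 0" using poly_inj_between[of a b p a b] nr x True by auto
    have "sg (poly p x) = sg (poly p b)"
    proof (rule sg_poly_eq)
      fix d assume "x \<le> d" "d \<le> b"
      then show "poly p d \<noteq> 0" using nz[of d] \<open>poly p b \<noteq> 0\<close> x by (cases "d = b") auto
    qed (use x in auto)
    then show ?thesis using True by simp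
  qed
qed

text \<open>The bound is the leading coefficient rather than 0 because this makes the induction run:
  \<open>a + x * p(x)\<close> is at least \<open>a + x * l\<close>, which exceeds l for large
  x.\<close>

lemma poly_ge_lead_coeff:
  fixes p :: "'a::linordered_field poly"
  shows "0 < lead_coeff p \<Longrightarrow> \<exists>B. \<forall>x\<ge>B. lead_coeff p \<le> poly p x"
proof (induction p)
  case (pCons a p)
  show ?case
  proof (cases "p = 0")
    case False
    then obtain B where B: "\<forall>x\<ge>B. lead_coeff p \<le> poly p x" using pCons by auto
    let ?l = "lead_coeff p"
    have l: "0 < ?l" using pCons.prems False by simp
    have "?l \<le> a + x * poly p x" if x: "x \<ge> max 0 (max B ((?l - a) / ?l))" for x
    proof -
      have "?l - a \<le> x * ?l" using x l by (simp add: pos_divide_le_eq)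
      also have "\<dots> \<le> x * poly p x" using x B by (intro mult_left_mono) auto
      finally show ?thesis by simp
    qed
    then have "\<forall>x\<ge>max 0 (max B ((?l - a) / ?l)). lead_coeff (pCons a p) \<le> poly (pCons a p) x"
      using False by simp
    then show ?thesis by blast
  qed auto
qed simp

lemma sg_poly_at_top:
  fixes p :: "'a::linordered_field poly"
  shows "\<exists>B. \<forall>x\<ge>B. sg (poly p x) = sg (lead_coeff p)"
proof -
  consider "p = 0" | "0 < lead_coeff p" | "0 < lead_coeff (- p)"
    by (metis lead_coeff_minus neg_0_less_iff_less leading_coeff_0_iff linorder_neqE_linordered_idom)
  then show ?thesis
  proof cases
    case 2
    then show ?thesis using poly_ge_lead_coeff[OF 2] by (metis less_le_trans sg_pos_iff)
  next
    case 3
    then obtain B where "\<forall>x\<ge>B. 0 < poly (-p) x"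
      using poly_ge_lead_coeff[OF 3] less_le_trans by meson
    then show ?thesis using 3 by (intro exI[of _ B]) (auto simp: sg_def)
  qed simp
qed

lemma sg_poly_at_bot:
  fixes p :: "'a::linordered_field poly"
  shows "\<exists>B. \<forall>x\<le>B. sg (poly p x) = (-1) ^ degree p * sg (lead_coeff p)"
proof -
  define q where "q = pcompose p [:0, -1:]"
  have q: "poly q x = poly p (- x)" for x by (simp add: q_def poly_pcompose)
  have l: "lead_coeff q = lead_coeff p * (-1) ^ degree p"
    unfolding q_def by (subst lead_coeff_comp) auto
  have s: "sg ((-1) ^ n :: 'a) = (-1) ^ n" for n
  proof (induction n)
    case (Suc n)
    have "sg (-1 :: 'a) = -1" by (simp add: sg_def)
    then show ?case by (simp only: power_Suc sg_mult Suc)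
  qed (simp add: sg_def)
  obtain B where B: "\<forall>x\<ge>B. sg (poly q x) = sg (lead_coeff q)" using sg_poly_at_top by blast
  show ?thesis
  proof (intro exI[of _ "-B"] allI impI)
    fix x assume "x \<le> - B"
    then have "sg (poly q (-x)) = sg (lead_coeff q)" using B by simp
    then show "sg (poly p x) = (-1) ^ degree p * sg (lead_coeff p)"
      by (simp add: q l sg_mult s)
  qed
qed

text \<open>\<Phi> is a set of matched points of two ordered lines. It cuts both lines into points
  and open intervals, and related x and y lie in corresponding cells; no enumeration of the cells is
  required.\<close>

definition corr :: "('a::linordered_idom \<times> 'b::linordered_idom) set \<Rightarrow> 'a \<Rightarrow> 'b \<Rightarrow> bool" where
  "corr \<Phi> x y \<longleftrightarrow> (\<forall>(r, s)\<in>\<Phi>. sg (x - r) = sg (y - s))"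

definition order_iso :: "('a::linordered_idom \<times> 'b::linordered_idom) set \<Rightarrow> bool" where
  "order_iso \<Phi> \<longleftrightarrow> (\<forall>(r, s)\<in>\<Phi>. corr \<Phi> r s)"

text \<open>Equality of two sign tables: cell by cell, the paired polynomials have the same
  sign.\<close>

definition same_diagram :: "('a::rcf \<times> 'b::rcf) set \<Rightarrow> ('a poly \<times> 'b poly) set \<Rightarrow> bool" where
  "same_diagram \<Phi> F \<longleftrightarrow> finite \<Phi> \<and> order_iso \<Phi> \<and>
     (\<forall>x y p q. corr \<Phi> x y \<longrightarrow> (p, q) \<in> F \<longrightarrow> sg (poly p x) = sg (poly q y))"

lemma corrD:
  assumes "corr \<Phi> x y" "(r, s) \<in> \<Phi>"
  shows "x < r \<longleftrightarrow> y < s" "r < x \<longleftrightarrow> s < y" "x = r \<longleftrightarrow> y = s"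
proof -
  have "sg (x - r) = sg (y - s)" using assms by (auto simp: corr_def)
  then show "x < r \<longleftrightarrow> y < s" "r < x \<longleftrightarrow> s < y" "x = r \<longleftrightarrow> y = s"
    by (auto simp: sg_def split: if_splits)
qed

lemma corrI:
  assumes "\<And>r s. (r, s) \<in> \<Phi> \<Longrightarrow> (x < r \<longleftrightarrow> y < s) \<and> (r < x \<longleftrightarrow> s < y)"
  shows "corr \<Phi> x y"
  unfolding corr_def using assms by (fastforce simp: sg_def)

lemma corr_iff: "corr \<Phi> x y \<longleftrightarrow> (\<forall>r s. (r, s) \<in> \<Phi> \<longrightarrow> sg (x - r) = sg (y - s))"
  by (auto simp: corr_def)

lemma corr_subset: "corr \<Phi> x y \<Longrightarrow> \<Psi> \<subseteq> \<Phi> \<Longrightarrow> corr \<Psi> x y"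
  by (auto simp: corr_def)

lemma corr_converse: "corr (\<Phi>\<inverse>) y x \<longleftrightarrow> corr \<Phi> x y"
  unfolding corr_iff converse_iff by metis

lemma order_iso_converse: "order_iso (\<Phi>\<inverse>) \<longleftrightarrow> order_iso \<Phi>"
  by (auto simp: order_iso_def corr_converse)

lemma same_diagram_converse: "same_diagram (\<Phi>\<inverse>) (F\<inverse>) \<longleftrightarrow> same_diagram \<Phi> F"
  unfolding same_diagram_def corr_converse order_iso_converse finite_converse converse_iff by metis

lemma order_iso_corr: "order_iso \<Phi> \<Longrightarrow> (r, s) \<in> \<Phi> \<Longrightarrow> corr \<Phi> r s"
  by (auto simp: order_iso_def)

text \<open>Either set may be empty; in that case the lemma produces a point beyond all given
  ones.\<close>

lemma finite_sets_between:
  fixes L U :: "'b::linordered_field set"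
  assumes "finite L" "finite U" "\<And>l u. l \<in> L \<Longrightarrow> u \<in> U \<Longrightarrow> l < u"
  shows "\<exists>y. (\<forall>l\<in>L. l < y) \<and> (\<forall>u\<in>U. y < u)"
proof -
  consider "L = {}" "U = {}" | "L \<noteq> {}" "U = {}" | "L = {}" "U \<noteq> {}" | "L \<noteq> {}" "U \<noteq> {}" by blast
  then show ?thesis
  proof cases
    case 2
    have "l < Max L + 1" if "l \<in> L" for l
      using le_less_trans[OF Max_ge[OF assms(1) that] less_add_one] .
    then show ?thesis using 2 by blast
  next
    case 3
    have "Min U - 1 < u" if "u \<in> U" for u
      using less_le_trans[OF _ Min_le[OF assms(2) that], of "Min U - 1"] by simp
    then show ?thesis using 3 by blast
  next
    case 4
    then have "Max L < Min U" using assms Max_in Min_in by blast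
    then obtain y where "Max L < y" "y < Min U" using dense by blast
    then have "\<forall>l\<in>L. l < y" "\<forall>u\<in>U. y < u"
      using le_less_trans[OF Max_ge[OF assms(1)]] less_le_trans[OF _ Min_le[OF assms(2)]] by blast+
    then show ?thesis by blast
  qed auto
qed

lemma corr_exists:
  fixes \<Phi> :: "('a::linordered_idom \<times> 'b::linordered_field) set"
  assumes "finite \<Phi>" "order_iso \<Phi>"
  shows "\<exists>y. corr \<Phi> x y"
proof (cases "\<exists>s. (x, s) \<in> \<Phi>")
  case True
  then show ?thesis using assms(2) order_iso_corr by blast
next
  case False
  define L where "L = snd ` {(r, s). (r, s) \<in> \<Phi> \<and> r < x}"
  define U where "U = snd ` {(r, s). (r, s) \<in> \<Phi> \<and> x < r}"
  have fin: "finite L" "finite U" unfolding L_def U_def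
    by (rule finite_imageI, rule finite_subset[OF _ assms(1)], auto)+
  have "l < u" if lu: "l \<in> L" "u \<in> U" for l u
  proof -
    obtain r r' where r: "(r, l) \<in> \<Phi>" "r < x" "(r', u) \<in> \<Phi>" "x < r'"
      using lu by (auto simp: L_def U_def)
    then show ?thesis using corrD(1)[OF order_iso_corr[OF assms(2) r(1)] r(3)] by auto
  qed
  then obtain y where y: "\<forall>l\<in>L. l < y" "\<forall>u\<in>U. y < u" using finite_sets_between[OF fin] by blast
  have "corr \<Phi> x y"
  proof (rule corrI)
    fix r s assume rs: "(r, s) \<in> \<Phi>"
    then have "r \<noteq> x" using False by auto
    then consider "r < x" | "x < r" by fastforce
    then show "(x < r \<longleftrightarrow> y < s) \<and> (r < x \<longleftrightarrow> s < y)"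
    proof cases
      case 1
      then have "s \<in> L" using rs by (force simp: L_def)
      then show ?thesis using 1 y by auto
    next
      case 2
      then have "s \<in> U" using rs by (force simp: U_def)
      then show ?thesis using 2 y by auto
    qed
  qed
  then show ?thesis by blast
qed

text \<open>A root outside the matched points would share its cell with a whole interval to its
  right. The polynomial has constant sign on the cell, hence would vanish on infinitely many
  points.\<close>

lemma same_diagram_root:
  fixes \<Phi> :: "('a::rcf \<times> 'b::rcf) set"
  assumes sd: "same_diagram \<Phi> F" and pq: "(p, q) \<in> F" "p \<noteq> 0" and x: "poly p x = 0"
  shows "\<exists>y. (x, y) \<in> \<Phi> \<and> poly q y = 0"
proof -
  have fin: "finite \<Phi>" "order_iso \<Phi>" using sd by (auto simp: same_diagram_def)
  obtain y where y: "corr \<Phi> x y" using corr_exists fin by blast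
  have qy: "poly q y = 0" using sd y pq x unfolding same_diagram_def by (metis sg_eq_0_iff)
  show ?thesis
  proof (cases "\<exists>s. (x, s) \<in> \<Phi>")
    case True
    then obtain s where s: "(x, s) \<in> \<Phi>" by blast
    then show ?thesis using corrD(3)[OF y s] qy by auto
  next
    case False
    define U where "U = {r \<in> fst ` \<Phi>. x < r}"
    have "finite U" using fin by (simp add: U_def)
    then have "\<exists>u. (\<forall>l\<in>{x}. l < u) \<and> (\<forall>v\<in>U. u < v)"
      by (intro finite_sets_between) (auto simp: U_def)
    then obtain u where u: "x < u" "\<forall>v\<in>U. u < v" by blast
    have "poly p x' = 0" if x': "x < x'" "x' < u" for x'
    proof -
      have "corr \<Phi> x' y"
      proof (rule corrI)
        fix r s assume rs: "(r, s) \<in> \<Phi>"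
        then have "r \<noteq> x" using False by auto
        moreover have "u < r" if "x < r"
        proof -
          have "r \<in> U" unfolding U_def using rs that by force
          then show ?thesis using u by blast
        qed
        ultimately have "x' < r \<longleftrightarrow> x < r" "r < x' \<longleftrightarrow> r < x"
          using x' by (meson less_trans less_asym linorder_neqE)+
        then show "(x' < r \<longleftrightarrow> y < s) \<and> (r < x' \<longleftrightarrow> s < y)" using corrD[OF y rs] by auto
      qed
      then have "sg (poly p x') = sg (poly q y)" using sd pq(1) unfolding same_diagram_def by blast
      then show ?thesis using qy by simp
    qed
    then have "{x<..<u} \<subseteq> {z. poly p z = 0}" by auto
    then have "finite {x<..<u}" using poly_roots_finite[OF pq(2)] by (rule finite_subset)
    then show ?thesis using infinite_Ioo[OF u(1)] by blast
  qed
qed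

text \<open>By Rolle a root of the derivative separates x from x'. It is a matched point, so its
  partner separates y from y' in the same order.\<close>

lemma root_pairs_mono:
  fixes \<Phi> :: "('a::rcf \<times> 'b::rcf) set"
  assumes c: "corr \<Phi> x y" "corr \<Phi> x' y'" and r: "poly p x = 0" "poly p x' = 0" and "x < x'"
    and d: "\<And>c. poly (pderiv p) c = 0 \<Longrightarrow> \<exists>s. (c, s) \<in> \<Phi>"
  shows "y < y'"
proof -
  obtain t where t: "x < t" "t < x'" "poly (pderiv p) t = 0" using poly_rolle assms by blast
  then obtain s where s: "(t, s) \<in> \<Phi>" using d by blast
  show ?thesis using corrD(1)[OF c(1) s] corrD(2)[OF c(2) s] t by auto
qed

lemma sg_poly_same_cut:
  fixes q :: "'a::rcf poly"
  assumes "\<And>s. poly q s = 0 \<Longrightarrow> (y < s \<longleftrightarrow> z < s) \<and> (s < y \<longleftrightarrow> s < z)"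
  shows "sg (poly q y) = sg (poly q z)"
proof (cases "poly q y = 0 \<or> poly q z = 0")
  case True
  then have "y = z" using assms[of y] assms[of z] by (metis linorder_neqE order_less_irrefl)
  then show ?thesis by simp
next
  case False
  show ?thesis
  proof (cases "y \<le> z")
    case True
    show ?thesis
    proof (rule sg_poly_eq[OF True])
      fix c assume "y \<le> c" "c \<le> z"
      then show "poly q c \<noteq> 0" using assms[of c] False by (metis leD order_le_imp_less_or_eq)
    qed
  next
    case False2: False
    then have "z \<le> y" by simp
    have "sg (poly q z) = sg (poly q y)"
    proof (rule sg_poly_eq[OF \<open>z \<le> y\<close>])
      fix c assume "z \<le> c" "c \<le> y"
      then show "poly q c \<noteq> 0" using assms[of c] False by (metis leD order_le_imp_less_or_eq)
    qed
    then show ?thesis by simp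
  qed
qed

lemma corr_insert: "corr (insert (r, s) \<Phi>) x y \<longleftrightarrow> sg (x - r) = sg (y - s) \<and> corr \<Phi> x y"
  by (auto simp: corr_iff)

text \<open>The step of Cohen and Hoermander: the roots of \<open>F\<close>, which include those of the derivative of \<open>P\<close>, cut
  the line into intervals on which \<open>P\<close> is strictly monotone, and the remainders \<open>u\<close> give the signs of \<open>P\<close>
  at the end points; the new pairs are the roots of \<open>P\<close> and \<open>Q\<close> between end points of opposite sign.\<close>

lemma same_diagram_step:
  fixes F :: "('a::rcf poly \<times> 'b::rcf poly) set"
  assumes sd: "same_diagram \<Phi> G" and sub: "F \<subseteq> G" and fin: "finite F"
    and nz: "\<And>p q. (p, q) \<in> F \<Longrightarrow> p \<noteq> 0 \<and> q \<noteq> 0"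
    and deg: "degree P = degree Q" and lc: "sg (lead_coeff P) = sg (lead_coeff Q)"
    and P0: "P \<noteq> 0" "Q \<noteq> 0" and der: "(pderiv P, pderiv Q) \<in> F"
    and rem: "\<And>p q. (p, q) \<in> F \<Longrightarrow> \<exists>u v. (u, v) \<in> G \<and>
      (\<forall>x. poly p x = 0 \<longrightarrow> sg (poly u x) = sg (poly P x)) \<and>
      (\<forall>y. poly q y = 0 \<longrightarrow> sg (poly v y) = sg (poly Q y))"
  shows "\<exists>\<Psi>. same_diagram \<Psi> (insert (P, Q) F)"
proof -
  define RX where "RX = {x. \<exists>p q. (p, q) \<in> F \<and> poly p x = 0}"
  have "RX = (\<Union>(p, q)\<in>F. {x. poly p x = 0})" by (auto simp: RX_def)
  then have finX: "finite RX" using fin nz poly_roots_finite by auto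
  have \<Phi>: "finite \<Phi>" "order_iso \<Phi>"
    and sdD: "\<And>x y p q. corr \<Phi> x y \<Longrightarrow> (p, q) \<in> G \<Longrightarrow> sg (poly p x) = sg (poly q y)"
    using sd by (auto simp: same_diagram_def)
  \<comment> \<open>Only roots of members of \<open>F\<close> are kept: there a remainder of
    \<open>P\<close> reveals the sign of \<open>P\<close>, whereas nothing is known about it at the
    other matched points.\<close>
  define \<Phi>0 where "\<Phi>0 = {(r, s). (r, s) \<in> \<Phi> \<and> r \<in> RX}"
  have sub0: "\<Phi>0 \<subseteq> \<Phi>" by (auto simp: \<Phi>0_def)
  then have fin0: "finite \<Phi>0" using \<Phi>(1) finite_subset by blast
  have rootP: "\<exists>s. (x, s) \<in> \<Phi>0" if "(p, q) \<in> F" "poly p x = 0" for p q x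
    using same_diagram_root[OF sd, of p q x] that nz[OF that(1)] sub by (auto simp: \<Phi>0_def RX_def)
  have rootQ: "\<exists>r. (r, y) \<in> \<Phi>0" if "(p, q) \<in> F" "poly q y = 0" for p q y
  proof -
    have "same_diagram (\<Phi>\<inverse>) (G\<inverse>)" using sd by (simp add: same_diagram_converse)
    from same_diagram_root[OF this, of q p y] that sub nz
    obtain r where "(r, y) \<in> \<Phi>" "poly p r = 0" by auto
    then show ?thesis using that(1) by (auto simp: \<Phi>0_def RX_def)
  qed
  obtain B1 where B1: "\<And>x. x \<ge> B1 \<Longrightarrow> sg (poly P x) = sg (lead_coeff P)" using sg_poly_at_top by blast
  obtain B2 where B2: "\<And>x. x \<ge> B2 \<Longrightarrow> sg (poly Q x) = sg (lead_coeff Q)" using sg_poly_at_top by blast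
  obtain C1 where C1: "\<And>x. x \<le> C1 \<Longrightarrow> sg (poly P x) = (-1) ^ degree P * sg (lead_coeff P)"
    using sg_poly_at_bot by blast
  obtain C2 where C2: "\<And>x. x \<le> C2 \<Longrightarrow> sg (poly Q x) = (-1) ^ degree Q * sg (lead_coeff Q)"
    using sg_poly_at_bot by blast
  \<comment> \<open>Two matched sentinels on each line, beyond all kept points and far enough out
    that \<open>P\<close> and \<open>Q\<close> have the signs prescribed by degree and leading
    coefficient. Every remaining cell then lies between end points with known signs.\<close>
  obtain u1 where u1: "\<forall>l\<in>insert B1 (fst ` \<Phi>0). l < u1"
    using finite_sets_between[of "insert B1 (fst ` \<Phi>0)" "{}"] fin0 by auto
  obtain u2 where u2: "\<forall>l\<in>insert B2 (snd ` \<Phi>0). l < u2"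
    using finite_sets_between[of "insert B2 (snd ` \<Phi>0)" "{}"] fin0 by auto
  obtain l1 where l1: "\<forall>l\<in>insert u1 (insert C1 (fst ` \<Phi>0)). l1 < l"
    using finite_sets_between[of "{}" "insert u1 (insert C1 (fst ` \<Phi>0))"] fin0 by auto
  obtain l2 where l2: "\<forall>l\<in>insert u2 (insert C2 (snd ` \<Phi>0)). l2 < l"
    using finite_sets_between[of "{}" "insert u2 (insert C2 (snd ` \<Phi>0))"] fin0 by auto
  define \<Psi> where "\<Psi> = insert (u1, u2) (insert (l1, l2) \<Phi>0)"
  have sub\<Psi>: "\<Phi>0 \<subseteq> \<Psi>" by (auto simp: \<Psi>_def)
  have fin\<Psi>: "finite \<Psi>" using fin0 by (simp add: \<Psi>_def)
  have b: "l1 < r" "r < u1" "l2 < s" "s < u2" if "(r, s) \<in> \<Phi>0" for r s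
    using that u1 u2 l1 l2 by force+
  have lu: "l1 < u1" "l2 < u2" using l1 l2 by auto
  have ord\<Psi>: "order_iso \<Psi>"
  proof -
    have "corr \<Psi> r s" if rs: "(r, s) \<in> \<Psi>" for r s
    proof -
      consider "r = u1" "s = u2" | "r = l1" "s = l2" | "(r, s) \<in> \<Phi>0" using rs by (auto simp: \<Psi>_def)
      then show ?thesis
      proof cases
        case 1
        have "corr \<Phi>0 u1 u2" by (rule corrI) (use b in force)
        then show ?thesis using 1 lu by (auto simp: \<Psi>_def corr_insert sg_def)
      next
        case 2
        have "corr \<Phi>0 l1 l2" by (rule corrI) (use b in force)
        then show ?thesis using 2 lu by (auto simp: \<Psi>_def corr_insert sg_def)
      next
        case 3
        have "corr \<Phi>0 r s" using order_iso_corr[OF \<Phi>(2)] 3 sub0 corr_subset by blast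
        moreover have "sg (r - u1) = -1" "sg (s - u2) = -1" "sg (r - l1) = 1" "sg (s - l2) = 1"
          using b[OF 3] by (auto simp: sg_def)
        ultimately show ?thesis by (auto simp: \<Psi>_def corr_insert)
      qed
    qed
    then show ?thesis by (auto simp: order_iso_def)
  qed
  have signF: "sg (poly p x) = sg (poly q y)" if c: "corr \<Psi> x y" and pq: "(p, q) \<in> F" for x y p q
  proof -
    \<comment> \<open>Since matched points were removed, y need not correspond to x under \<Phi>.
      The auxiliary z does, and y and z lie on the same side of every root of q, as these roots were
      all kept.\<close>
    obtain z where z: "corr \<Phi> x z" using corr_exists \<Phi> by blast
    have "sg (poly p x) = sg (poly q z)" using sdD[OF z] pq sub by blast
    also have "\<dots> = sg (poly q y)"
    proof (rule sg_poly_same_cut)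
      fix s assume "poly q s = 0"
      then obtain r where r: "(r, s) \<in> \<Phi>0" using rootQ pq by blast
      have "(r, s) \<in> \<Psi>" "(r, s) \<in> \<Phi>" using r sub\<Psi> sub0 by auto
      then show "(z < s \<longleftrightarrow> y < s) \<and> (s < z \<longleftrightarrow> s < y)" using corrD[OF c] corrD[OF z] by metis
    qed
    finally show ?thesis .
  qed
  have ends: "sg (poly P r) = sg (poly Q s)" if rs: "(r, s) \<in> \<Psi>" for r s
  proof -
    consider "r = u1" "s = u2" | "r = l1" "s = l2" | "(r, s) \<in> \<Phi>0" using rs by (auto simp: \<Psi>_def)
    then show ?thesis
    proof cases
      case 1
      then show ?thesis using B1[of u1] B2[of u2] u1 u2 lc by auto
    next
      case 2
      then show ?thesis using C1[of l1] C2[of l2] l1 l2 lc deg by auto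
    next
      case 3
      then obtain p q where pq: "(p, q) \<in> F" "poly p r = 0" by (auto simp: \<Phi>0_def RX_def)
      have c: "corr \<Phi> r s" using 3 sub0 \<Phi>(2) order_iso_corr by blast
      have "sg (poly p r) = sg (poly q s)" using sdD[OF c] pq(1) sub by blast
      then have "poly q s = 0" using pq by (metis sg_eq_0_iff)
      then show ?thesis using rem[OF pq(1)] sdD[OF c] pq(2) by metis
    qed
  qed
  define \<Psi>1 where "\<Psi>1 = \<Psi> \<union> {(x, y). poly P x = 0 \<and> poly Q y = 0 \<and> corr \<Psi> x y}"
  have sub1: "\<Psi> \<subseteq> \<Psi>1" by (auto simp: \<Psi>1_def)
  have "\<Psi>1 \<subseteq> \<Psi> \<union> {x. poly P x = 0} \<times> {y. poly Q y = 0}" by (auto simp: \<Psi>1_def)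
  then have fin1: "finite \<Psi>1"
    by (rule finite_subset) (intro finite_UnI finite_cartesian_product poly_roots_finite fin\<Psi> P0)
  have new: "x < x' \<longleftrightarrow> y < y'"
    if r: "poly P x = 0" "poly Q y = 0" "poly P x' = 0" "poly Q y' = 0" and c: "corr \<Psi> x y" "corr \<Psi> x' y'"
    for x y x' y'
  proof
    assume "x < x'"
    then show "y < y'" using root_pairs_mono[OF c r(1) r(3)] rootP[OF der] sub\<Psi> by blast
  next
    assume "y < y'"
    then show "x < x'"
      using root_pairs_mono[of "\<Psi>\<inverse>" y x y' x' Q] c r rootQ[OF der] sub\<Psi> unfolding corr_converse converse_iff
      by blast
  qed
  have "order_iso \<Psi>1"
  proof -
    have "corr \<Psi>1 x y" if xy: "(x, y) \<in> \<Psi>1" for x y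
    proof (rule corrI)
      fix r s assume rs: "(r, s) \<in> \<Psi>1"
      have c: "corr \<Psi> x y" "corr \<Psi> r s" using xy rs order_iso_corr[OF ord\<Psi>] by (auto simp: \<Psi>1_def)
      consider "(x, y) \<in> \<Psi>" | "(r, s) \<in> \<Psi>" | "poly P x = 0" "poly Q y = 0" "poly P r = 0" "poly Q s = 0"
        using xy rs by (auto simp: \<Psi>1_def)
      then show "(x < r \<longleftrightarrow> y < s) \<and> (r < x \<longleftrightarrow> s < y)"
      proof cases
        case 1
        then show ?thesis using corrD[OF c(2)] by blast
      next
        case 2
        then show ?thesis using corrD[OF c(1)] by blast
      next
        case 3
        then show ?thesis using new[OF 3 c] new[of r s x y] c by blast
      qed
    qed
    then show ?thesis by (auto simp: order_iso_def)
  qed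
  moreover have "sg (poly P x) = sg (poly Q y)" if c1: "corr \<Psi>1 x y" for x y
  proof -
    have c: "corr \<Psi> x y" using corr_subset[OF c1 sub1] .
    have u: "(u1, u2) \<in> \<Psi>" and l: "(l1, l2) \<in> \<Psi>" by (auto simp: \<Psi>_def)
    consider (dom) s where "(x, s) \<in> \<Psi>" | (up) "u1 < x" | (lo) "x < l1"
      | (mid) "l1 < x" "x < u1" "\<nexists>s. (x, s) \<in> \<Psi>"
      using u l by (metis linorder_neqE)
    then show ?thesis
    proof cases
      case dom
      then show ?thesis using ends[OF dom] corrD(3)[OF c dom] by simp
    next
      case up
      then have "u2 < y" using corrD(2)[OF c u] by simp
      then show ?thesis using up B1[of x] B2[of y] u1 u2 lc by auto
    next
      case lo
      then have "y < l2" using corrD(1)[OF c l] by simp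
      then show ?thesis using lo C1[of x] C2[of y] l1 l2 lc deg by auto
    next
      case mid
      define L where "L = {r \<in> fst ` \<Psi>. r < x}"
      define U where "U = {r \<in> fst ` \<Psi>. x < r}"
      have finLU: "finite L" "finite U" using fin\<Psi> by (auto simp: L_def U_def)
      have "l1 \<in> L" "u1 \<in> U" using u l mid by (force simp: L_def U_def)+
      then have "Max L \<in> L" "Min U \<in> U" using Max_in[OF finLU(1)] Min_in[OF finLU(2)] by blast+
      then obtain a a' b b' where ab: "(a, a') \<in> \<Psi>" "a = Max L" "a < x" "(b, b') \<in> \<Psi>" "b = Min U" "x < b"
        unfolding L_def U_def by fastforce
      have out: "r \<le> a \<or> b \<le> r" if "(r, s) \<in> \<Psi>" for r s
      proof -
        have "r \<in> L \<or> r \<in> U" using that mid(3) unfolding L_def U_def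
          by (metis (mono_tags, lifting) fst_conv image_eqI linorder_neqE mem_Collect_eq)
        then show ?thesis using Max_ge[OF finLU(1)] Min_le[OF finLU(2)] ab by blast
      qed
      have ab': "a' < y" "y < b'" using corrD[OF c ab(1)] corrD[OF c ab(4)] ab by auto
      have ordD: "r < a \<longleftrightarrow> s < a'" "r = a \<longleftrightarrow> s = a'" "b < r \<longleftrightarrow> b' < s" "r = b \<longleftrightarrow> s = b'"
        if "(r, s) \<in> \<Psi>" for r s
        using corrD[OF order_iso_corr[OF ord\<Psi> that] ab(1)] corrD[OF order_iso_corr[OF ord\<Psi> that] ab(4)]
        by auto
      have out': "s \<le> a' \<or> b' \<le> s" if "(r, s) \<in> \<Psi>" for r s
        using out[OF that] ordD[OF that] by (auto simp: le_less)
      have nrP: "poly (pderiv P) t \<noteq> 0" if "a < t" "t < b" for t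
        using rootP[OF der, of t] out that sub\<Psi> by fastforce
      have nrQ: "poly (pderiv Q) t \<noteq> 0" if "a' < t" "t < b'" for t
        using rootQ[OF der, of t] out' that sub\<Psi> by fastforce
      have e: "sg (poly P a) = sg (poly Q a')" "sg (poly P b) = sg (poly Q b')"
        using ends ab by auto
      have opp: "poly P a * poly P b < 0 \<longleftrightarrow> poly Q a' * poly Q b' < 0"
        using e unfolding sg_neg_iff[symmetric] sg_mult by simp
      show ?thesis
      proof (cases "poly P a * poly P b < 0")
        case True
        have "a < b" "a' < b'" using ab ab' by auto
        obtain t where t: "a < t" "t < b" "poly P t = 0" and
          tx: "x < t \<longrightarrow> sg (poly P x) = sg (poly P a)" "t < x \<longrightarrow> sg (poly P x) = sg (poly P b)"
          using sg_between_opposite[of a b P, OF nrP \<open>a < b\<close> True] ab by blast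
        obtain t' where t': "a' < t'" "t' < b'" "poly Q t' = 0" and
          ty: "y < t' \<longrightarrow> sg (poly Q y) = sg (poly Q a')" "t' < y \<longrightarrow> sg (poly Q y) = sg (poly Q b')"
          using sg_between_opposite[of a' b' Q, OF nrQ \<open>a' < b'\<close>] opp True ab' by blast
        have "corr \<Psi> t t'"
        proof (rule corrI)
          fix r s assume rs: "(r, s) \<in> \<Psi>"
          have "r \<le> a \<longleftrightarrow> s \<le> a'" "b \<le> r \<longleftrightarrow> b' \<le> s" using ordD[OF rs] by (auto simp: le_less)
          then show "(t < r \<longleftrightarrow> t' < s) \<and> (r < t \<longleftrightarrow> s < t')"
            using out[OF rs] out'[OF rs] t t' by auto
        qed
        then have "(t, t') \<in> \<Psi>1" using t t' by (auto simp: \<Psi>1_def)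
        note d = corrD[OF c1 this]
        consider "x < t" | "x = t" | "t < x" by fastforce
        then show ?thesis
        proof cases
          case 1 then show ?thesis using d tx ty e by simp
        next
          case 2 then show ?thesis using d t t' by simp
        next
          case 3 then show ?thesis using d tx ty e by simp
        qed
      next
        case False
        have "sg (poly P x) = (if poly P a = 0 then sg (poly P b) else sg (poly P a))"
          using sg_between_same[of a b P x] nrP ab False by blast
        moreover have "sg (poly Q y) = (if poly Q a' = 0 then sg (poly Q b') else sg (poly Q a'))"
          using sg_between_same[of a' b' Q y] nrQ ab' False opp by blast
        moreover have "poly P a = 0 \<longleftrightarrow> poly Q a' = 0" using e(1) by (metis sg_eq_0_iff)
        ultimately show ?thesis using e by simp
      qed
    qed
  qed
  moreover have "sg (poly p x) = sg (poly q y)" if "corr \<Psi>1 x y" "(p, q) \<in> F" for x y p q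
    using signF corr_subset[OF that(1) sub1] that(2) by blast
  ultimately have "same_diagram \<Psi>1 (insert (P, Q) F)"
    using fin1 by (auto simp: same_diagram_def)
  then show ?thesis by blast
qed

subsection \<open>Transfer of sign conditions\<close>

text \<open>Elimination runs on syntax, so that one finite set of conditions can be evaluated in
  both fields. \<open>Nm\<close> is separate from \<open>Cn\<close> because the factors produced by
  differentiation must be genuine integers even while nothing is assumed about the interpretation of
  constants.\<close>

datatype 'v tm = Vr 'v | Cn real | Nm nat | Ad "'v tm" "'v tm" | Sb "'v tm" "'v tm" | Ml "'v tm" "'v tm"

primrec tm_eval :: "(real \<Rightarrow> 'a) \<Rightarrow> ('v \<Rightarrow> 'a) \<Rightarrow> 'v tm \<Rightarrow> 'a::comm_ring_1" where
  "tm_eval \<phi> e (Vr v) = e v"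
| "tm_eval \<phi> e (Cn c) = \<phi> c"
| "tm_eval \<phi> e (Nm n) = of_nat n"
| "tm_eval \<phi> e (Ad s t) = tm_eval \<phi> e s + tm_eval \<phi> e t"
| "tm_eval \<phi> e (Sb s t) = tm_eval \<phi> e s - tm_eval \<phi> e t"
| "tm_eval \<phi> e (Ml s t) = tm_eval \<phi> e s * tm_eval \<phi> e t"

text \<open>Coefficient lists are written with the leading coefficient first.\<close>

primrec list_poly :: "(real \<Rightarrow> 'a) \<Rightarrow> ('v \<Rightarrow> 'a) \<Rightarrow> 'v tm list \<Rightarrow> 'a::comm_ring_1 poly" where
  "list_poly \<phi> e [] = 0"
| "list_poly \<phi> e (a # as) = monom (tm_eval \<phi> e a) (length as) + list_poly \<phi> e as"

lemma poly_list_poly_Cons: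
  "poly (list_poly \<phi> e (a # as)) x = tm_eval \<phi> e a * x ^ length as + poly (list_poly \<phi> e as) x"
  by (simp add: poly_monom)

lemma coeff_list_poly: "length as \<le> n \<Longrightarrow> coeff (list_poly \<phi> e as) n = 0"
  by (induction as) auto

lemma lead_list_poly:
  assumes "tm_eval \<phi> e a \<noteq> 0"
  shows "degree (list_poly \<phi> e (a # as)) = length as" "lead_coeff (list_poly \<phi> e (a # as)) = tm_eval \<phi> e a"
    "list_poly \<phi> e (a # as) \<noteq> 0"
proof -
  let ?p = "list_poly \<phi> e (a # as)"
  have c: "coeff ?p (length as) = tm_eval \<phi> e a" by (simp add: coeff_list_poly)
  have "degree ?p \<le> length as"
    by (rule degree_le) (auto simp: coeff_list_poly simp del: list_poly.simps(2))
  moreover have "length as \<le> degree ?p" using c assms by (intro le_degree) auto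
  ultimately show d: "degree ?p = length as" by simp
  show "lead_coeff ?p = tm_eval \<phi> e a" unfolding d c ..
  show "?p \<noteq> 0" using c assms by (metis coeff_0)
qed

primrec list_deriv :: "'v tm list \<Rightarrow> 'v tm list" where
  "list_deriv [] = []"
| "list_deriv (a # as) = (if as = [] then [] else Ml (Nm (length as)) a # list_deriv as)"

lemma length_list_deriv: "length (list_deriv as) = length as - 1"
  by (induction as) (auto simp: neq_Nil_conv)

lemma list_poly_deriv: "list_poly \<phi> e (list_deriv as) = pderiv (list_poly \<phi> e as)"
  by (induction as) (auto simp: pderiv_add pderiv_monom length_list_deriv)

text \<open>One step of pseudo-division by \<open>c # vs\<close>; the factor \<open>c\<^sup>2\<close> instead of \<open>c\<close> keeps signs.\<close>

fun list_reduce :: "'v tm \<Rightarrow> 'v tm \<Rightarrow> 'v tm list \<Rightarrow> 'v tm list \<Rightarrow> 'v tm list" where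
  "list_reduce c a vs [] = []"
| "list_reduce c a [] (u # us) = Ml (Ml c c) u # list_reduce c a [] us"
| "list_reduce c a (v # vs) (u # us) = Sb (Ml (Ml c c) u) (Ml (Ml c a) v) # list_reduce c a vs us"

lemma length_list_reduce [simp]: "length (list_reduce c a vs us) = length us"
  by (induction c a vs us rule: list_reduce.induct) auto

lemma poly_list_reduce:
  "length vs \<le> length us \<Longrightarrow> poly (list_poly \<phi> e (list_reduce c a vs us)) x =
    tm_eval \<phi> e c ^ 2 * poly (list_poly \<phi> e us) x -
    tm_eval \<phi> e c * tm_eval \<phi> e a * x ^ (length us - length vs) * poly (list_poly \<phi> e vs) x"
proof (induction c a vs us rule: list_reduce.induct)
  case (3 c a v vs u us)
  have "x ^ length us = x ^ (length us - length vs) * x ^ length vs"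
    using 3 by (simp flip: power_add)
  then show ?case using 3 by (simp add: poly_monom algebra_simps power2_eq_square)
qed (auto simp: poly_monom algebra_simps power2_eq_square)

function list_rem :: "'v tm list \<Rightarrow> 'v tm list \<Rightarrow> 'v tm list" where
  "list_rem q [] = []"
| "list_rem q (a # us) = (if length us < length (tl q) then a # us
     else list_rem q (list_reduce (hd q) a (tl q) us))"
  by pat_completeness auto
termination by (relation "Wellfounded.measure (\<lambda>(q, p). length p)") auto

lemma length_list_rem: "q \<noteq> [] \<Longrightarrow> length (list_rem q p) < length q"
  by (induction q p rule: list_rem.induct) auto

text \<open>At a root of the divisor each reduction step merely multiplies the value by
  \<open>c\<^sup>2 > 0\<close>.\<close>

lemma sg_list_rem:
  fixes \<phi> :: "real \<Rightarrow> 'a::linordered_field"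
  assumes "q \<noteq> []" "tm_eval \<phi> e (hd q) \<noteq> 0" "poly (list_poly \<phi> e q) x = 0"
  shows "sg (poly (list_poly \<phi> e (list_rem q p)) x) = sg (poly (list_poly \<phi> e p) x)"
  using assms
proof (induction q p rule: list_rem.induct)
  case (2 q a us)
  show ?case
  proof (cases "length us < length (tl q)")
    case False
    obtain c vs where q: "q = c # vs" using 2 by (cases q) auto
    let ?E = "tm_eval \<phi> e" and ?P = "\<lambda>l. poly (list_poly \<phi> e l) x"
    have len: "length vs \<le> length us" using False q by simp
    have vs: "?P vs = - ?E c * x ^ length vs"
      using 2(4) unfolding q poly_list_poly_Cons by (simp add: eq_neg_iff_add_eq_0 add.commute)
    have xx: "x ^ length us = x ^ (length us - length vs) * x ^ length vs"
      using len by (simp flip: power_add)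
    have "?P (list_reduce c a vs us) = ?E c ^ 2 * ?P (a # us)"
      unfolding poly_list_reduce[OF len] vs poly_list_poly_Cons xx
      by (simp add: algebra_simps power2_eq_square)
    moreover have "sg (?E c ^ 2) = 1" using 2(3) by (simp add: q sg_pos_iff)
    ultimately have "sg (?P (list_reduce c a vs us)) = sg (?P (a # us))" by (simp only: sg_mult mult_1_left)
    moreover have "sg (?P (list_rem q (a # us))) = sg (?P (list_reduce c a vs us))"
      using 2(1)[OF False] 2(2-4) False by (simp add: q)
    ultimately show ?thesis by simp
  qed simp
qed simp

abbreviation list_pairs ::
  "(real \<Rightarrow> 'a::comm_ring_1) \<Rightarrow> (real \<Rightarrow> 'b::comm_ring_1) \<Rightarrow> ('v \<Rightarrow> 'a) \<Rightarrow> ('v \<Rightarrow> 'b) \<Rightarrow> 'v tm list set \<Rightarrow> ('a poly \<times> 'b poly) set" where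
  "list_pairs \<phi> \<psi> e e' F \<equiv> (\<lambda>l. (list_poly \<phi> e l, list_poly \<psi> e' l)) ` F"

text \<open>By induction on the multiset of lengths: if some leading coefficient vanishes it is dropped,
  otherwise a longest polynomial is replaced by its derivative and by its remainders modulo the
  other ones.\<close>

lemma same_diagram_exists:
  fixes \<phi> :: "real \<Rightarrow> 'a::rcf" and \<psi> :: "real \<Rightarrow> 'b::rcf" and F :: "'v tm list multiset"
  shows "\<exists>E. finite E \<and> (\<forall>e e'. (\<forall>t\<in>E. sg (tm_eval \<phi> e t) = sg (tm_eval \<psi> e' t)) \<longrightarrow>
    (\<exists>\<Phi>. same_diagram \<Phi> (list_pairs \<phi> \<psi> e e' (set_mset F))))"
proof (induction "image_mset length F" arbitrary: F rule: less_induct)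
  case less
  let ?agree = "\<lambda>E e e'. \<forall>t\<in>E. sg (tm_eval \<phi> e t) = sg (tm_eval \<psi> e' t)"
  let ?good = "\<lambda>F E. finite E \<and> (\<forall>e e'. ?agree E e e' \<longrightarrow>
    (\<exists>\<Phi>. same_diagram \<Phi> (list_pairs \<phi> \<psi> e e' (set_mset F))))"
  consider (nil) "[] \<in># F" | (const) "\<forall>l\<in>#F. length l = 1" | (step) "[] \<notin># F" "\<exists>l\<in>#F. length l \<noteq> 1" by auto
  then show ?case
  proof cases
    case nil
    then obtain F' where F: "F = add_mset [] F'" by (metis multi_member_split)
    have "image_mset length F' < image_mset length F" unfolding F
      by (simp add: subset_imp_less_mset)
    from less(1)[OF this] obtain E where fE: "finite E" and E: "\<And>e e'. ?agree E e e' \<Longrightarrow>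
      \<exists>\<Phi>. same_diagram \<Phi> (list_pairs \<phi> \<psi> e e' (set_mset F'))" by blast
    have R: "\<exists>\<Phi>. same_diagram \<Phi> (list_pairs \<phi> \<psi> e e' (set_mset F))" if ag: "?agree E e e'" for e e'
    proof -
      obtain \<Phi> where "same_diagram \<Phi> (list_pairs \<phi> \<psi> e e' (set_mset F'))" using E[OF ag] by blast
      then have "same_diagram \<Phi> (list_pairs \<phi> \<psi> e e' (set_mset F))"
        by (auto simp: F same_diagram_def)
      then show ?thesis by blast
    qed
    show ?thesis by (rule exI[of _ E], intro conjI allI impI, rule fE, rule R)
  next
    case const
    have R: "\<exists>\<Phi>. same_diagram \<Phi> (list_pairs \<phi> \<psi> e e' (set_mset F))" if ag: "?agree (hd ` set_mset F) e e'" for e e'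
    proof -
      have "sg (poly (list_poly \<phi> e l) x) = sg (poly (list_poly \<psi> e' l) y)" if "l \<in># F" for l x y
      proof -
        have "length l = 1" using const that by blast
        then obtain a where "l = [a]" by (cases l) auto
        moreover have "sg (tm_eval \<phi> e (hd l)) = sg (tm_eval \<psi> e' (hd l))" using that ag by blast
        ultimately show ?thesis by (simp add: poly_monom)
      qed
      then have "same_diagram {} (list_pairs \<phi> \<psi> e e' (set_mset F))"
        by (auto simp: same_diagram_def order_iso_def)
      then show ?thesis by blast
    qed
    show ?thesis by (rule exI[of _ "hd ` set_mset F"], intro conjI allI impI, simp, rule R)
  next
    case step
    define m where "m = Max (length ` set_mset F)"
    have "F \<noteq> {#}" using step by auto
    then have "m \<in> length ` set_mset F" unfolding m_def by (intro Max_in) auto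
    then obtain p where p: "p \<in># F" "length p = m" by auto
    have le_m: "length l \<le> m" if "l \<in># F" for l unfolding m_def using that by auto
    have m2: "m \<ge> 2"
    proof -
      obtain l where l: "l \<in># F" "length l \<noteq> 1" using step by blast
      then have "length l \<noteq> 0" using step(1) by auto
      then show ?thesis using le_m[OF l(1)] l(2) by linarith
    qed
    obtain F' where F: "F = add_mset p F'" using p by (metis multi_member_split)
    define G where "G = add_mset (list_deriv p) F' + image_mset (\<lambda>l. list_rem l p) (add_mset (list_deriv p) F')"
    have len_d: "length (list_deriv p) = m - 1" using p by (simp add: length_list_deriv)
    have nonnil: "l \<noteq> []" if "l \<in># F" for l using that step(1) by auto
    have d_nonnil: "list_deriv p \<noteq> []" using len_d m2 by (metis One_nat_def Suc_1 diff_is_0_eq length_0_conv not_less_eq_eq)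
    have "image_mset length G < image_mset length F"
    proof -
      define N where "N = image_mset length (add_mset (list_deriv p) (image_mset (\<lambda>l. list_rem l p) (add_mset (list_deriv p) F')))"
      have "image_mset length G = image_mset length F' + N" by (simp add: G_def N_def)
      moreover have "image_mset length F = image_mset length F' + {#m#}" using p by (simp add: F)
      moreover have "image_mset length F' + N < image_mset length F' + {#m#}"
      proof -
        have "\<forall>k\<in>#N. k < m"
        proof
          fix k assume "k \<in># N"
          then consider "k = length (list_deriv p)" | l where "l \<in># add_mset (list_deriv p) F'" "k = length (list_rem l p)"
            by (auto simp: N_def)
          then show "k < m"
          proof cases
            case 1 then show ?thesis using len_d m2 by simp
          next
            case 2
            then have "l \<noteq> []" "length l \<le> m" using d_nonnil nonnil le_m len_d by (auto simp: F)
            then show ?thesis using 2 length_list_rem[of l p] by simp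
          qed
        qed
        then have "N < {#m#}" by (simp add: ex_gt_imp_less_multiset)
        then show ?thesis by simp
      qed
      ultimately show ?thesis by simp
    qed
    from less(1)[OF this] obtain EG where fEG: "finite EG" and EG: "\<And>e e'. ?agree EG e e' \<Longrightarrow>
      \<exists>\<Phi>. same_diagram \<Phi> (list_pairs \<phi> \<psi> e e' (set_mset G))" by blast
    define drop where "drop l = add_mset (tl l) (F - {#l#})" for l
    have "\<exists>E. ?good (drop l) E" if l: "l \<in># F" for l
    proof (rule less(1))
      obtain F2 where F2: "F = add_mset l F2" using l by (metis multi_member_split)
      have "length (tl l) < length l" using nonnil[OF l] by (cases l) auto
      then have "{#length (tl l)#} < {#length l#}" by simp
      then have "image_mset length F2 + {#length (tl l)#} < image_mset length F2 + {#length l#}" by simp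
      then show "image_mset length (drop l) < image_mset length F" by (simp add: drop_def F2)
    qed
    then have "\<forall>l\<in>#F. \<exists>E. ?good (drop l) E" by blast
    from bchoice[OF this] obtain ED where ED': "\<forall>l\<in>#F. ?good (drop l) (ED l)" ..
    have fED: "finite (ED l)" if "l \<in># F" for l using ED' that by blast
    have ED: "\<exists>\<Phi>. same_diagram \<Phi> (list_pairs \<phi> \<psi> e e' (set_mset (drop l)))"
      if "l \<in># F" "?agree (ED l) e e'" for l e e' using ED' that by blast
    \<comment> \<open>Including all leading coefficients makes the case distinction on their
      vanishing come out the same way in both fields.\<close>
    define E where "E = hd ` set_mset F \<union> EG \<union> (\<Union>l\<in>set_mset F. ED l)"
    have R: "\<exists>\<Phi>. same_diagram \<Phi> (list_pairs \<phi> \<psi> e e' (set_mset F))" if ag: "?agree E e e'" for e e'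
    proof (cases "\<exists>l\<in>#F. tm_eval \<phi> e (hd l) = 0")
      case True
      then obtain l where l: "l \<in># F" "tm_eval \<phi> e (hd l) = 0" by blast
      obtain F2 where F2: "F = add_mset l F2" using l by (metis multi_member_split)
      have "hd l \<in> E" using l by (auto simp: E_def)
      then have l': "tm_eval \<psi> e' (hd l) = 0" using ag l by (metis sg_eq_0_iff)
      have "?agree (ED l) e e'" using ag l by (auto simp: E_def)
      then obtain \<Phi> where \<Phi>: "same_diagram \<Phi> (list_pairs \<phi> \<psi> e e' (set_mset (drop l)))" using ED[OF l(1)] by meson
      have "list_poly \<phi> e l = list_poly \<phi> e (tl l)" "list_poly \<psi> e' l = list_poly \<psi> e' (tl l)"
        using l(2) l' nonnil[OF l(1)] by (cases l; simp)+
      then have "list_pairs \<phi> \<psi> e e' (set_mset F) = list_pairs \<phi> \<psi> e e' (set_mset (drop l))"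
        by (simp add: drop_def F2)
      then show ?thesis using \<Phi> by auto
    next
      case False
      have ne: "tm_eval \<phi> e (hd l) \<noteq> 0" "tm_eval \<psi> e' (hd l) \<noteq> 0" if "l \<in># F" for l
      proof -
        show "tm_eval \<phi> e (hd l) \<noteq> 0" using False that by blast
        moreover have "hd l \<in> E" using that by (auto simp: E_def)
        ultimately show "tm_eval \<psi> e' (hd l) \<noteq> 0" using ag by (metis sg_eq_0_iff)
      qed
      have "?agree EG e e'" using ag by (auto simp: E_def)
      then obtain \<Phi> where \<Phi>: "same_diagram \<Phi> (list_pairs \<phi> \<psi> e e' (set_mset G))" using EG by meson
      obtain a as where pa: "p = a # as" "as \<noteq> []"
      proof (cases p)
        case (Cons a as)
        then have "as \<noteq> []" using p m2 by auto
        then show ?thesis using that Cons by blast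
      qed (use p m2 in auto)
      have a0: "tm_eval \<phi> e a \<noteq> 0" "tm_eval \<psi> e' a \<noteq> 0" using ne[OF p(1)] by (auto simp: pa)
      have hd_d: "hd (list_deriv p) = Ml (Nm (length as)) a" by (simp add: pa)
      have ne': "tm_eval \<phi> e (hd l) \<noteq> 0 \<and> tm_eval \<psi> e' (hd l) \<noteq> 0 \<and> l \<noteq> []" if "l \<in># add_mset (list_deriv p) F'" for l
        using that ne[of l] nonnil[of l] a0 d_nonnil hd_d pa by (auto simp: F)
      have "\<exists>\<Psi>. same_diagram \<Psi> (insert (list_poly \<phi> e p, list_poly \<psi> e' p)
         (list_pairs \<phi> \<psi> e e' (set_mset (add_mset (list_deriv p) F'))))"
      proof (rule same_diagram_step[OF \<Phi>])
        show "list_pairs \<phi> \<psi> e e' (set_mset (add_mset (list_deriv p) F')) \<subseteq> list_pairs \<phi> \<psi> e e' (set_mset G)"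
          by (auto simp: G_def)
        show "finite (list_pairs \<phi> \<psi> e e' (set_mset (add_mset (list_deriv p) F')))" by simp
        show "degree (list_poly \<phi> e p) = degree (list_poly \<psi> e' p)"
          unfolding pa by (simp only: lead_list_poly(1)[OF a0(1)] lead_list_poly(1)[OF a0(2)])
        have "hd p \<in> E" using p by (auto simp: E_def)
        then show "sg (lead_coeff (list_poly \<phi> e p)) = sg (lead_coeff (list_poly \<psi> e' p))"
          using ag unfolding pa by (simp only: lead_list_poly(2)[OF a0(1)] lead_list_poly(2)[OF a0(2)] list.sel)
        show "list_poly \<phi> e p \<noteq> 0" "list_poly \<psi> e' p \<noteq> 0"
          unfolding pa using lead_list_poly(3) a0 by blast+
        show "(pderiv (list_poly \<phi> e p), pderiv (list_poly \<psi> e' p)) \<in> list_pairs \<phi> \<psi> e e' (set_mset (add_mset (list_deriv p) F'))"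
          by (simp add: list_poly_deriv)
      next
        fix P Q assume "(P, Q) \<in> list_pairs \<phi> \<psi> e e' (set_mset (add_mset (list_deriv p) F'))"
        then obtain l where l: "l \<in># add_mset (list_deriv p) F'" and PQ: "P = list_poly \<phi> e l" "Q = list_poly \<psi> e' l" by auto
        note n = ne'[OF l]
        obtain b bs where bl: "l = b # bs" using n by (cases l) auto
        show "P \<noteq> 0 \<and> Q \<noteq> 0" unfolding PQ bl using lead_list_poly(3) n bl by (metis list.sel(1))
        have "list_rem l p \<in># G" using l by (auto simp: G_def)
        then show "\<exists>u v. (u, v) \<in> list_pairs \<phi> \<psi> e e' (set_mset G) \<and>
           (\<forall>x. poly P x = 0 \<longrightarrow> sg (poly u x) = sg (poly (list_poly \<phi> e p) x)) \<and>
           (\<forall>y. poly Q y = 0 \<longrightarrow> sg (poly v y) = sg (poly (list_poly \<psi> e' p) y))"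
          using n unfolding PQ
          by (intro exI[of _ "list_poly \<phi> e (list_rem l p)"] exI[of _ "list_poly \<psi> e' (list_rem l p)"])
             (auto simp: sg_list_rem)
      qed
      then obtain \<Psi> where \<Psi>: "same_diagram \<Psi> (insert (list_poly \<phi> e p, list_poly \<psi> e' p)
         (list_pairs \<phi> \<psi> e e' (set_mset (add_mset (list_deriv p) F'))))" by blast
      have "list_pairs \<phi> \<psi> e e' (set_mset F) \<subseteq> insert (list_poly \<phi> e p, list_poly \<psi> e' p)
         (list_pairs \<phi> \<psi> e e' (set_mset (add_mset (list_deriv p) F')))" by (auto simp: F)
      then have "same_diagram \<Psi> (list_pairs \<phi> \<psi> e e' (set_mset F))"
        using \<Psi> unfolding same_diagram_def by blast
      then show ?thesis by blast
    qed
    have fE: "finite E" unfolding E_def using fEG fED by auto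
    show ?thesis by (rule exI[of _ E], intro conjI allI impI, rule fE, rule R)
  qed
qed

text \<open>Coefficient lists in one variable, now with the constant coefficient first.\<close>

fun coeffs_add :: "'v tm list \<Rightarrow> 'v tm list \<Rightarrow> 'v tm list" where
  "coeffs_add [] bs = bs"
| "coeffs_add as [] = as"
| "coeffs_add (a # as) (b # bs) = Ad a b # coeffs_add as bs"

primrec coeffs_mult :: "'v tm list \<Rightarrow> 'v tm list \<Rightarrow> 'v tm list" where
  "coeffs_mult [] bs = []"
| "coeffs_mult (a # as) bs = coeffs_add (map (Ml a) bs) (Nm 0 # coeffs_mult as bs)"

primrec coeffs_in :: "'v \<Rightarrow> 'v tm \<Rightarrow> 'v tm list" where
  "coeffs_in v (Vr w) = (if w = v then [Nm 0, Nm 1] else [Vr w])"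
| "coeffs_in v (Cn c) = [Cn c]"
| "coeffs_in v (Nm n) = [Nm n]"
| "coeffs_in v (Ad s t) = coeffs_add (coeffs_in v s) (coeffs_in v t)"
| "coeffs_in v (Sb s t) = coeffs_add (coeffs_in v s) (map (Sb (Nm 0)) (coeffs_in v t))"
| "coeffs_in v (Ml s t) = coeffs_mult (coeffs_in v s) (coeffs_in v t)"

primrec horner :: "(real \<Rightarrow> 'a) \<Rightarrow> ('v \<Rightarrow> 'a) \<Rightarrow> 'v tm list \<Rightarrow> 'a \<Rightarrow> 'a::comm_ring_1" where
  "horner \<phi> e [] x = 0"
| "horner \<phi> e (a # as) x = tm_eval \<phi> e a + x * horner \<phi> e as x"

lemma horner_add: "horner \<phi> e (coeffs_add as bs) x = horner \<phi> e as x + horner \<phi> e bs x"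
  by (induction as bs rule: coeffs_add.induct) (auto simp: algebra_simps)

lemma horner_scale: "horner \<phi> e (map (Ml a) as) x = tm_eval \<phi> e a * horner \<phi> e as x"
  by (induction as) (auto simp: algebra_simps)

lemma horner_neg: "horner \<phi> e (map (Sb (Nm 0)) as) x = - horner \<phi> e as x"
  by (induction as) (auto simp: algebra_simps)

lemma horner_mult: "horner \<phi> e (coeffs_mult as bs) x = horner \<phi> e as x * horner \<phi> e bs x"
  by (induction as) (auto simp: algebra_simps horner_add horner_scale)

lemma horner_coeffs_in: "horner \<phi> e (coeffs_in v t) x = tm_eval \<phi> (e(v := x)) t"
  by (induction t) (auto simp: horner_add horner_neg horner_mult)

lemma poly_list_poly_snoc:
  "poly (list_poly \<phi> e (as @ [a])) x = x * poly (list_poly \<phi> e as) x + tm_eval \<phi> e a"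
  by (induction as) (auto simp: poly_monom algebra_simps)

lemma poly_list_poly_rev: "poly (list_poly \<phi> e (rev as)) x = horner \<phi> e as x"
  by (induction as) (auto simp: poly_list_poly_snoc)

text \<open>Read as polynomials in v, the terms have a common sign diagram once the conditions
  \<open>E\<close> on the other variables agree; y is any point in the cell corresponding to that of
  x.\<close>

lemma eliminate_variable:
  fixes \<phi> :: "real \<Rightarrow> 'a::rcf" and \<psi> :: "real \<Rightarrow> 'b::rcf"
  assumes "finite F"
  shows "\<exists>E. finite E \<and> (\<forall>e e'. (\<forall>t\<in>E. sg (tm_eval \<phi> e t) = sg (tm_eval \<psi> e' t)) \<longrightarrow>
    (\<forall>x. \<exists>y. \<forall>t\<in>F. sg (tm_eval \<phi> (e(v := x)) t) = sg (tm_eval \<psi> (e'(v := y)) t)))"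
proof -
  define L where "L = image_mset (\<lambda>t. rev (coeffs_in v t)) (mset_set F)"
  obtain E where E: "finite E" "\<And>e e'. (\<forall>t\<in>E. sg (tm_eval \<phi> e t) = sg (tm_eval \<psi> e' t)) \<Longrightarrow>
    (\<exists>\<Phi>. same_diagram \<Phi> (list_pairs \<phi> \<psi> e e' (set_mset L)))" using same_diagram_exists[of \<phi> \<psi> L] by blast
  have "\<exists>y. \<forall>t\<in>F. sg (tm_eval \<phi> (e(v := x)) t) = sg (tm_eval \<psi> (e'(v := y)) t)"
    if ag: "\<forall>t\<in>E. sg (tm_eval \<phi> e t) = sg (tm_eval \<psi> e' t)" for e e' x
  proof -
    obtain \<Phi> where \<Phi>: "same_diagram \<Phi> (list_pairs \<phi> \<psi> e e' (set_mset L))" using E(2) ag by blast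
    have "finite \<Phi>" "order_iso \<Phi>" using \<Phi> by (auto simp: same_diagram_def)
    from corr_exists[OF this] obtain y where y: "corr \<Phi> x y" by blast
    have "sg (tm_eval \<phi> (e(v := x)) t) = sg (tm_eval \<psi> (e'(v := y)) t)" if "t \<in> F" for t
    proof -
      let ?l = "rev (coeffs_in v t)"
      have "(list_poly \<phi> e ?l, list_poly \<psi> e' ?l) \<in> list_pairs \<phi> \<psi> e e' (set_mset L)"
        using that assms by (auto simp: L_def)
      then have "sg (poly (list_poly \<phi> e ?l) x) = sg (poly (list_poly \<psi> e' ?l) y)"
        using \<Phi> y unfolding same_diagram_def by blast
      then show ?thesis by (simp add: poly_list_poly_rev horner_coeffs_in)
    qed
    then show ?thesis by blast
  qed
  then show ?thesis using E(1) by blast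
qed

lemma eliminate_variables:
  fixes \<phi> :: "real \<Rightarrow> 'a::rcf" and \<psi> :: "real \<Rightarrow> 'b::rcf"
  assumes "finite V" "finite F"
  shows "\<exists>E. finite E \<and> (\<forall>e e'. (\<forall>t\<in>E. sg (tm_eval \<phi> e t) = sg (tm_eval \<psi> e' t)) \<longrightarrow>
    (\<forall>x. \<exists>y. \<forall>t\<in>F. sg (tm_eval \<phi> (override_on e x V) t) = sg (tm_eval \<psi> (override_on e' y V) t)))"
  using assms
proof (induction V arbitrary: F rule: finite_induct)
  case empty
  then show ?case by auto
next
  case (insert v V)
  obtain E where E: "finite E" "\<And>e e'. (\<forall>t\<in>E. sg (tm_eval \<phi> e t) = sg (tm_eval \<psi> e' t)) \<Longrightarrow>
    (\<forall>x. \<exists>y. \<forall>t\<in>F. sg (tm_eval \<phi> (override_on e x V) t) = sg (tm_eval \<psi> (override_on e' y V) t))"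
    using insert.IH[OF insert.prems] by blast
  obtain E' where E': "finite E'" "\<And>e e'. (\<forall>t\<in>E'. sg (tm_eval \<phi> e t) = sg (tm_eval \<psi> e' t)) \<Longrightarrow>
    (\<forall>x. \<exists>y. \<forall>t\<in>E. sg (tm_eval \<phi> (e(v := x)) t) = sg (tm_eval \<psi> (e'(v := y)) t))"
    using eliminate_variable[OF E(1)] by metis
  have "\<exists>y. \<forall>t\<in>F. sg (tm_eval \<phi> (override_on e x (insert v V)) t) = sg (tm_eval \<psi> (override_on e' y (insert v V)) t)"
    if ag: "\<forall>t\<in>E'. sg (tm_eval \<phi> e t) = sg (tm_eval \<psi> e' t)" for e e' x
  proof -
    obtain z where "\<forall>t\<in>E. sg (tm_eval \<phi> (e(v := x v)) t) = sg (tm_eval \<psi> (e'(v := z)) t)"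
      using E'(2)[OF ag] by blast
    from E(2)[OF this] obtain y where
      y: "\<forall>t\<in>F. sg (tm_eval \<phi> (override_on (e(v := x v)) x V) t) = sg (tm_eval \<psi> (override_on (e'(v := z)) y V) t)"
      by blast
    have "override_on (e(v := x v)) x V = override_on e x (insert v V)"
      by (auto simp: override_on_def)
    moreover have "override_on (e'(v := z)) y V = override_on e' (y(v := z)) (insert v V)"
      using insert.hyps by (auto simp: override_on_def)
    ultimately show ?thesis using y by metis
  qed
  then show ?case using E'(1) by blast
qed

text \<open>Eliminating all variables leaves conditions that no longer depend on the point.
  Evaluated at the origin they are signs of real constants, and these are preserved by the
  homomorphism.\<close>

theorem sign_transfer:
  fixes \<phi> :: "real \<Rightarrow> 'a::rcf" and x :: "'v::finite \<Rightarrow> 'a"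
  assumes "finite F"
    and hom: "\<phi> 0 = 0" "\<phi> 1 = 1" "\<And>a b. \<phi> (a + b) = \<phi> a + \<phi> b" "\<And>a b. \<phi> (a * b) = \<phi> a * \<phi> b"
  shows "\<exists>y. \<forall>t\<in>F. sg (tm_eval \<phi> x t) = sg (tm_eval (\<lambda>c. c) y t)"
proof -
  have neg: "\<phi> (- a) = - \<phi> a" for a using hom(3)[of a "-a"] hom(1) by (simp add: eq_neg_iff_add_eq_0 add.commute)
  have nat: "\<phi> (of_nat n) = of_nat n" for n by (induction n) (auto simp: hom)
  have sub: "\<phi> (a - b) = \<phi> a - \<phi> b" for a b using hom(3)[of a "-b"] neg by simp
  \<comment> \<open>A ring homomorphism from the reals preserves order because positive reals are
    squares.\<close>
  have pos: "0 < \<phi> a" if "0 < a" for a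
  proof -
    have "\<phi> a = \<phi> (sqrt a) * \<phi> (sqrt a)" using that by (simp flip: hom(4))
    moreover have "\<phi> (sqrt a) \<noteq> 0"
    proof
      assume "\<phi> (sqrt a) = 0"
      then have "\<phi> (sqrt a * inverse (sqrt a)) = 0" by (simp only: hom mult_zero_left)
      then show False using that hom(2) by simp
    qed
    ultimately show ?thesis by (metis not_square_less_zero linorder_neqE mult_eq_0_iff)
  qed
  have sg: "sg (\<phi> a) = sg a" for a
    using pos[of a] pos[of "-a"] hom(1) by (cases a "0 :: real" rule: linorder_cases) (auto simp: sg_def neg)
  have ev: "tm_eval \<phi> (\<lambda>v. \<phi> (e v)) t = \<phi> (tm_eval (\<lambda>c. c) e t)" for t and e :: "'v \<Rightarrow> real"
    by (induction t) (auto simp: hom sub nat)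
  obtain E where "finite E" and E: "\<And>e e'. (\<forall>t\<in>E. sg (tm_eval \<phi> e t) = sg (tm_eval (\<lambda>c. c) e' t)) \<Longrightarrow>
    (\<forall>x. \<exists>y. \<forall>t\<in>F. sg (tm_eval \<phi> (override_on e x UNIV) t) = sg (tm_eval (\<lambda>c. c :: real) (override_on e' y UNIV) t))"
    using eliminate_variables[of UNIV F \<phi> "\<lambda>c. c :: real"] assms(1) by auto
  \<comment> \<open>The environment is arbitrary since all variables are overridden afterwards; the
    origin has the advantage of being the image of a real point.\<close>
  have "\<forall>t\<in>E. sg (tm_eval \<phi> (\<lambda>v. \<phi> 0) t) = sg (tm_eval (\<lambda>c. c) (\<lambda>v. 0) t)"
    using ev[of "\<lambda>v. 0"] sg by simp
  from E[OF this] show ?thesis by (metis override_on_apply_in UNIV_I ext)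
qed

subsection \<open>Polynomials in several variables\<close>

definition mmon :: "('v \<Rightarrow> 'a) \<Rightarrow> ('v \<Rightarrow>\<^sub>0 nat) \<Rightarrow> 'a::comm_semiring_1" where
  "mmon \<phi> a = (\<Prod>i\<in>Poly_Mapping.keys a. \<phi> i ^ Poly_Mapping.lookup a i)"

lemma msubst_mmon: "msubst c \<phi> p = (\<Sum>a\<in>Poly_Mapping.keys p. c (Poly_Mapping.lookup p a) * mmon \<phi> a)"
  by (simp add: msubst_def mmon_def)

lemma mmon_superset:
  assumes "finite S" "Poly_Mapping.keys a \<subseteq> S"
  shows "mmon \<phi> a = (\<Prod>i\<in>S. \<phi> i ^ Poly_Mapping.lookup a i)"
  unfolding mmon_def using assms by (intro prod.mono_neutral_left) (auto simp: in_keys_iff)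

lemma mmon_0 [simp]: "mmon \<phi> 0 = 1"
  by (simp add: mmon_def)

lemma mmon_add: "mmon \<phi> (a + b) = mmon \<phi> a * mmon \<phi> b"
proof -
  let ?S = "Poly_Mapping.keys a \<union> Poly_Mapping.keys b"
  have "Poly_Mapping.keys (a + b) \<subseteq> ?S" by (rule Poly_Mapping.keys_add)
  then show ?thesis
    by (simp add: mmon_superset[of ?S] lookup_add power_add prod.distrib)
qed

lemma mmon_single: "mmon \<phi> (Poly_Mapping.single i n) = \<phi> i ^ n"
  by (subst mmon_superset[of "{i}"]) (auto simp: lookup_single)

lemma mpoly_sum_singles:
  "(p :: 'v mpoly) = (\<Sum>a\<in>Poly_Mapping.keys p. Poly_Mapping.single a (Poly_Mapping.lookup p a))"
proof (rule poly_mapping_eqI)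
  fix k
  show "Poly_Mapping.lookup p k =
    Poly_Mapping.lookup (\<Sum>a\<in>Poly_Mapping.keys p. Poly_Mapping.single a (Poly_Mapping.lookup p a)) k"
    by (simp add: lookup_sum lookup_single when_def in_keys_iff)
qed

lemma mpoly_single_induct:
  fixes p :: "'v mpoly"
  assumes s: "\<And>a x. P (Poly_Mapping.single a x)" and add: "\<And>p q. P p \<Longrightarrow> P q \<Longrightarrow> P (p + q)"
  shows "P p"
proof -
  have "P (\<Sum>a\<in>S. Poly_Mapping.single a (Poly_Mapping.lookup p a))" if "finite S" for S
    using that
  proof (induction S rule: finite_induct)
    case empty
    show ?case using s[of 0 0] by simp
  next
    case (insert a S)
    then show ?case using add[OF s] by simp
  qed
  from this[of "Poly_Mapping.keys p"] show ?thesis using mpoly_sum_singles[of p] by simp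
qed

lemma single_eq_mmon: "Poly_Mapping.single a x = mconst x * mmon mvar a" for a :: "'v \<Rightarrow>\<^sub>0 nat"
proof -
  have pw: "mvar i ^ n = (Poly_Mapping.single (Poly_Mapping.single i n) 1 :: 'v mpoly)" for i :: 'v and n
    by (induction n) (auto simp: mvar_def mult_single simp flip: single_add)
  have "(\<Prod>i\<in>S. mvar i ^ Poly_Mapping.lookup a i) =
    (Poly_Mapping.single (\<Sum>i\<in>S. Poly_Mapping.single i (Poly_Mapping.lookup a i)) 1 :: 'v mpoly)" if "finite S" for S
    using that by (induction S rule: finite_induct) (auto simp: pw mult_single)
  from this[of "Poly_Mapping.keys a"] have "mmon mvar a =
    (Poly_Mapping.single (\<Sum>i\<in>Poly_Mapping.keys a. Poly_Mapping.single i (Poly_Mapping.lookup a i)) 1 :: 'v mpoly)"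
    by (simp add: mmon_def)
  moreover have "(\<Sum>i\<in>Poly_Mapping.keys a. Poly_Mapping.single i (Poly_Mapping.lookup a i)) = a"
    by (rule poly_mapping_eqI) (simp add: lookup_sum lookup_single when_def in_keys_iff)
  ultimately show ?thesis by (simp add: mconst_def mult_single)
qed

lemma mpoly_induct [case_names const var add mult]:
  fixes p :: "'v mpoly"
  assumes "\<And>c. P (mconst c)" "\<And>i. P (mvar i)" "\<And>p q. P p \<Longrightarrow> P q \<Longrightarrow> P (p + q)" "\<And>p q. P p \<Longrightarrow> P q \<Longrightarrow> P (p * q)"
  shows "P p"
proof (induction p rule: mpoly_single_induct)
  case (1 a x)
  have one: "P 1" using assms(1)[of 1] by (simp add: mconst_def)
  have pw: "P (mvar i ^ n)" for i n by (induction n) (auto intro: assms one)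
  have "P (\<Prod>i\<in>S. mvar i ^ Poly_Mapping.lookup a i)" if "finite S" for S
    using that by (induction S rule: finite_induct) (auto intro: assms(4) one pw)
  then have "P (mmon mvar a)" by (simp add: mmon_def)
  then show ?case unfolding single_eq_mmon by (intro assms)
qed (rule assms)

lemma mconst_simps [simp]: "mconst 0 = 0" "mconst 1 = 1"
  by (simp_all add: mconst_def)

lemma mconst_add: "mconst (a + b) = mconst a + mconst b"
  by (simp add: mconst_def single_add)

lemma mconst_mult: "mconst (a * b) = mconst a * mconst b"
  by (simp add: mconst_def mult_single)

lemma mconst_minus: "mconst (- a) = - mconst a"
  by (simp add: mconst_def single_uminus)

lemma mconst_diff: "mconst (a - b) = mconst a - mconst b"
  by (simp add: mconst_def single_diff)

section \<open>Ring homomorphisms and evaluation\<close>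

definition ring_map :: "('a::comm_ring_1 \<Rightarrow> 'b::comm_ring_1) \<Rightarrow> bool" where
  "ring_map \<phi> \<longleftrightarrow> \<phi> 1 = 1 \<and> (\<forall>a b. \<phi> (a + b) = \<phi> a + \<phi> b) \<and> (\<forall>a b. \<phi> (a * b) = \<phi> a * \<phi> b)"

lemma ring_mapD:
  assumes "ring_map \<phi>"
  shows "\<phi> 0 = 0" "\<phi> 1 = 1" "\<phi> (a + b) = \<phi> a + \<phi> b" "\<phi> (a * b) = \<phi> a * \<phi> b"
    "\<phi> (- a) = - \<phi> a" "\<phi> (a - b) = \<phi> a - \<phi> b" "\<phi> (a ^ n) = \<phi> a ^ n"
proof -
  show r: "\<phi> 1 = 1" "\<phi> (a + b) = \<phi> a + \<phi> b" "\<phi> (a * b) = \<phi> a * \<phi> b" for a b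
    using assms by (auto simp: ring_map_def)
  show z: "\<phi> 0 = 0" using r(2)[of 0 0] by simp
  show m: "\<phi> (- a) = - \<phi> a" for a using r(2)[of a "-a"] z by (simp add: eq_neg_iff_add_eq_0 add.commute)
  show "\<phi> (a - b) = \<phi> a - \<phi> b" using r(2)[of a "-b"] m by simp
  show "\<phi> (a ^ n) = \<phi> a ^ n" by (induction n) (auto simp: r)
qed

lemma ring_map_sum: "ring_map \<phi> \<Longrightarrow> \<phi> (sum f A) = (\<Sum>x\<in>A. \<phi> (f x))"
  by (induction A rule: infinite_finite_induct) (auto simp: ring_mapD)

lemma ring_map_prod: "ring_map \<phi> \<Longrightarrow> \<phi> (prod f A) = (\<Prod>x\<in>A. \<phi> (f x))"
  by (induction A rule: infinite_finite_induct) (auto simp: ring_mapD)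

lemma ring_map_comp: "ring_map \<phi> \<Longrightarrow> ring_map \<psi> \<Longrightarrow> ring_map (\<lambda>x. \<phi> (\<psi> x))"
  by (simp add: ring_map_def)

lemma ring_map_id: "ring_map (\<lambda>x. x)"
  by (simp add: ring_map_def)

lemma ring_map_mconst: "ring_map mconst"
  by (simp add: ring_map_def mconst_add mconst_mult)

lemma msubst_superset:
  assumes "finite S" "Poly_Mapping.keys p \<subseteq> S" "c 0 = 0"
  shows "msubst c \<phi> p = (\<Sum>a\<in>S. c (Poly_Mapping.lookup p a) * mmon \<phi> a)"
  unfolding msubst_mmon using assms by (intro sum.mono_neutral_left) (auto simp: in_keys_iff)

lemma msubst_single: "c 0 = 0 \<Longrightarrow> msubst c \<phi> (Poly_Mapping.single a x) = c x * mmon \<phi> a"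
  by (subst msubst_superset[of "{a}"]) (auto simp: lookup_single)

lemma ring_map_msubst:
  assumes c: "ring_map c"
  shows "ring_map (msubst c \<phi>)"
proof -
  have add: "msubst c \<phi> (p + q) = msubst c \<phi> p + msubst c \<phi> q" for p q
  proof -
    let ?S = "Poly_Mapping.keys p \<union> Poly_Mapping.keys q"
    have "Poly_Mapping.keys (p + q) \<subseteq> ?S" by (rule Poly_Mapping.keys_add)
    then show ?thesis
      by (simp add: msubst_superset[of ?S] ring_mapD[OF c] lookup_add distrib_right sum.distrib)
  qed
  have single: "msubst c \<phi> (Poly_Mapping.single a x) = c x * mmon \<phi> a" for a x
    using msubst_single ring_mapD(1)[OF c] by blast
  have "msubst c \<phi> (Poly_Mapping.single a x * q) = c x * mmon \<phi> a * msubst c \<phi> q" for a x q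
    by (induction q rule: mpoly_single_induct)
       (simp_all add: mult_single single mmon_add ring_mapD[OF c] distrib_left add algebra_simps)
  then have "msubst c \<phi> (p * q) = msubst c \<phi> p * msubst c \<phi> q" for p q
    by (induction p rule: mpoly_single_induct) (simp_all add: single add distrib_right)
  moreover have "msubst c \<phi> 1 = 1"
    using single[of 0 1] by (simp add: ring_mapD[OF c])
  ultimately show ?thesis using add by (simp add: ring_map_def)
qed

lemma msubst_mconst [simp]: "c 0 = 0 \<Longrightarrow> msubst c \<phi> (mconst x) = c x"
  by (simp add: mconst_def msubst_single)

lemma msubst_mvar [simp]: "ring_map c \<Longrightarrow> msubst c \<phi> (mvar i) = \<phi> i"
  by (simp add: mvar_def msubst_single mmon_single ring_mapD)

lemma ring_map_eqI:
  assumes "ring_map \<phi>" "ring_map \<psi>" "\<And>c. \<phi> (mconst c) = \<psi> (mconst c)" "\<And>i. \<phi> (mvar i) = \<psi> (mvar i)"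
  shows "\<phi> p = \<psi> p"
  by (induction p rule: mpoly_induct) (simp_all add: assms ring_mapD)

lemma ring_map_eq_msubst:
  assumes "ring_map \<phi>"
  shows "\<phi> p = msubst (\<lambda>c. \<phi> (mconst c)) (\<lambda>i. \<phi> (mvar i)) p"
proof -
  have c: "ring_map (\<lambda>c. \<phi> (mconst c))" using assms ring_map_mconst by (rule ring_map_comp)
  show ?thesis
    by (rule ring_map_eqI[OF assms ring_map_msubst[OF c]]) (simp_all add: c ring_mapD[OF assms] ring_mapD[OF c])
qed

abbreviation meval :: "('v \<Rightarrow> real) \<Rightarrow> 'v mpoly \<Rightarrow> real" where
  "meval \<equiv> msubst (\<lambda>c. c)"

lemmas ring_map_meval = ring_map_msubst[OF ring_map_id]

lemma meval_simps [simp]: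
  "meval x 0 = 0" "meval x 1 = 1" "meval x (p + q) = meval x p + meval x q"
  "meval x (p * q) = meval x p * meval x q" "meval x (- p) = - meval x p"
  "meval x (p - q) = meval x p - meval x q" "meval x (p ^ n) = meval x p ^ n" "meval x (mconst c) = c"
  "meval x (mvar i) = x i" "meval x (sum f A) = (\<Sum>k\<in>A. meval x (f k))" "meval x (prod f A) = (\<Prod>k\<in>A. meval x (f k))"
  by (simp_all add: ring_mapD[OF ring_map_meval] ring_map_sum[OF ring_map_meval] ring_map_prod[OF ring_map_meval] ring_map_id)

lemma peval_eq_meval: "peval p x = meval (($) x) p"
  by (simp add: peval_def)

section \<open>Partial derivatives and the transfer of signs to real points\<close>

lemma mderiv_superset:
  assumes "finite S" "Poly_Mapping.keys p \<subseteq> S"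
  shows "mderiv i p = (\<Sum>a\<in>S. Poly_Mapping.single (a - Poly_Mapping.single i 1)
    (Poly_Mapping.lookup p a * of_nat (Poly_Mapping.lookup a i)))"
  unfolding mderiv_def using assms by (intro sum.mono_neutral_left) (auto simp: in_keys_iff)

lemma mderiv_add: "mderiv i (p + q) = mderiv i p + mderiv i q"
proof -
  let ?S = "Poly_Mapping.keys p \<union> Poly_Mapping.keys q"
  have "Poly_Mapping.keys (p + q) \<subseteq> ?S" by (rule Poly_Mapping.keys_add)
  then show ?thesis
    by (simp add: mderiv_superset[of ?S] lookup_add distrib_right sum.distrib single_add)
qed

lemma mderiv_single: "mderiv i (Poly_Mapping.single a x) =
  Poly_Mapping.single (a - Poly_Mapping.single i 1) (x * of_nat (Poly_Mapping.lookup a i))"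
  by (subst mderiv_superset[of "{a}"]) (auto simp: lookup_single)

lemma mderiv_mult: "mderiv i (p * q) = mderiv i p * q + p * mderiv i q"
proof -
  let ?e = "Poly_Mapping.single i (1 :: nat)"
  \<comment> \<open>Truncated subtraction of exponents commutes with addition only if i occurs in a;
    in the other case the coefficient is 0.\<close>
  have shift: "a - ?e + b = a + b - ?e" if "Poly_Mapping.lookup a i \<noteq> 0" for a b
    using that by (intro poly_mapping_eqI) (auto simp: lookup_add lookup_minus lookup_single when_def)
  have s: "mderiv i (Poly_Mapping.single a x * Poly_Mapping.single b y) =
     mderiv i (Poly_Mapping.single a x) * Poly_Mapping.single b y +
     Poly_Mapping.single a x * mderiv i (Poly_Mapping.single b y)" for a b x y
  proof -
    have 1: "mderiv i (Poly_Mapping.single a x) * Poly_Mapping.single b y =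
      Poly_Mapping.single (a + b - ?e) (x * y * of_nat (Poly_Mapping.lookup a i))"
      using shift[of a b] by (cases "Poly_Mapping.lookup a i = 0") (simp_all add: mderiv_single mult_single algebra_simps)
    have 2: "Poly_Mapping.single a x * mderiv i (Poly_Mapping.single b y) =
      Poly_Mapping.single (a + b - ?e) (x * y * of_nat (Poly_Mapping.lookup b i))"
      using shift[of b a] by (cases "Poly_Mapping.lookup b i = 0") (simp_all add: mderiv_single mult_single algebra_simps)
    show ?thesis unfolding 1 2
      by (simp add: mult_single mderiv_single lookup_add algebra_simps flip: single_add)
  qed
  have "mderiv i (Poly_Mapping.single a x * q) =
     mderiv i (Poly_Mapping.single a x) * q + Poly_Mapping.single a x * mderiv i q" for a x
    by (induction q rule: mpoly_single_induct) (simp_all add: s distrib_left mderiv_add algebra_simps)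
  then show ?thesis
    by (induction p rule: mpoly_single_induct) (simp_all add: distrib_right mderiv_add algebra_simps)
qed

lemma mderiv_mconst: "mderiv i (mconst c) = 0"
  by (simp add: mconst_def mderiv_single)

lemma mderiv_mvar: "mderiv i (mvar j) = (if i = j then 1 else 0)"
proof -
  have "mderiv i (mvar j) = (if i = j then mconst 1 else 0)"
    by (simp add: mvar_def mderiv_single lookup_single mconst_def when_def)
  then show ?thesis by simp
qed

text \<open>The derivation takes values in another ring through \<phi>; this covers both the
  embedding \<open>in_z\<close> and the map to a residue field.\<close>

lemma derivation_chain_rule:
  fixes D :: "'v::finite mpoly \<Rightarrow> 'a::comm_ring_1"
  assumes \<phi>: "ring_map \<phi>" and c: "\<And>c. D (mconst c) = 0"
    and add: "\<And>p q. D (p + q) = D p + D q" and mult: "\<And>p q. D (p * q) = D p * \<phi> q + \<phi> p * D q"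
  shows "D p = (\<Sum>i\<in>UNIV. \<phi> (mderiv i p) * D (mvar i))"
proof (induction p rule: mpoly_induct)
  case (var i)
  have "(\<Sum>j\<in>UNIV. \<phi> (mderiv j (mvar i)) * D (mvar j)) = (\<Sum>j\<in>UNIV. if j = i then D (mvar j) else 0)"
    by (intro sum.cong) (auto simp: mderiv_mvar ring_mapD[OF \<phi>])
  then show ?case by simp
next
  case (mult p q)
  then show ?case
    by (simp add: assms mderiv_mult ring_mapD[OF \<phi>] distrib_right sum.distrib sum_distrib_left sum_distrib_right algebra_simps)
qed (simp_all add: assms mderiv_add mderiv_mconst ring_mapD[OF \<phi>] distrib_right sum.distrib)

lemma mpoly_tm_exists:
  fixes p :: "'v mpoly"
  assumes "ring_map \<phi>" "ring_map \<psi>"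
  shows "\<exists>t. (\<forall>x. tm_eval \<phi> x t = msubst \<phi> x p) \<and> (\<forall>x. tm_eval \<psi> x t = msubst \<psi> x p)"
proof (induction p rule: mpoly_induct)
  case (const c)
  show ?case using assms by (intro exI[of _ "Cn c"]) (simp add: ring_mapD)
next
  case (var i)
  show ?case using assms by (intro exI[of _ "Vr i"]) (simp add: ring_mapD)
next
  case (add p q)
  then obtain s t where "\<forall>x. tm_eval \<phi> x s = msubst \<phi> x p" "\<forall>x. tm_eval \<psi> x s = msubst \<psi> x p"
    "\<forall>x. tm_eval \<phi> x t = msubst \<phi> x q" "\<forall>x. tm_eval \<psi> x t = msubst \<psi> x q" by blast
  then show ?case by (intro exI[of _ "Ad s t"]) (simp add: ring_mapD(3)[OF ring_map_msubst] assms)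
next
  case (mult p q)
  then obtain s t where "\<forall>x. tm_eval \<phi> x s = msubst \<phi> x p" "\<forall>x. tm_eval \<psi> x s = msubst \<psi> x p"
    "\<forall>x. tm_eval \<phi> x t = msubst \<phi> x q" "\<forall>x. tm_eval \<psi> x t = msubst \<psi> x q" by blast
  then show ?case by (intro exI[of _ "Ml s t"]) (simp add: ring_mapD(4)[OF ring_map_msubst] assms)
qed

text \<open>The images of the variables form a point over the real closed field, and \<phi> is
  evaluation at it; \<open>sign_transfer\<close> moves this point to the reals.\<close>

lemma artin_lang:
  fixes \<phi> :: "'v::finite mpoly \<Rightarrow> 'a::rcf"
  assumes \<phi>: "ring_map \<phi>" and "finite F"
  shows "\<exists>x. \<forall>p\<in>F. sg (meval x p) = sg (\<phi> p)"
proof -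
  define \<iota> where "\<iota> = (\<lambda>c. \<phi> (mconst c))"
  have \<iota>: "ring_map \<iota>" unfolding \<iota>_def using \<phi> ring_map_mconst by (rule ring_map_comp)
  have "\<forall>p :: 'v mpoly. \<exists>t. (\<forall>x. tm_eval \<iota> x t = msubst \<iota> x p) \<and> (\<forall>x. tm_eval (\<lambda>c. c) x t = meval x p)"
    using mpoly_tm_exists[OF \<iota> ring_map_id] by blast
  from choice[OF this] obtain t :: "'v mpoly \<Rightarrow> 'v tm" where
    t: "\<And>p x. tm_eval \<iota> x (t p) = msubst \<iota> x p" "\<And>p x. tm_eval (\<lambda>c. c) x (t p) = meval x p"
    by blast
  have "finite (t ` F)" using assms by simp
  from sign_transfer[OF this, of \<iota> "\<lambda>i. \<phi> (mvar i)"] ring_mapD[OF \<iota>]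
  obtain y where "\<forall>s\<in>t ` F. sg (tm_eval \<iota> (\<lambda>i. \<phi> (mvar i)) s) = sg (tm_eval (\<lambda>c. c) y s)" by blast
  then have "\<forall>p\<in>F. sg (msubst \<iota> (\<lambda>i. \<phi> (mvar i)) p) = sg (meval y p)" by (simp add: t)
  moreover have "msubst \<iota> (\<lambda>i. \<phi> (mvar i)) p = \<phi> p" for p
    using ring_map_eq_msubst[OF \<phi>, of p] by (simp add: \<iota>_def)
  ultimately show ?thesis by auto
qed

subsection \<open>Maximal cones in fields\<close>

text \<open>Squares of differences belong to \<open>T\<close>: so \<open>T\<close> is a preordering of the field \<open>T - T\<close>.\<close>

definition field_cone :: "'a::field set \<Rightarrow> bool" where
  "field_cone T \<longleftrightarrow> (\<forall>s\<in>T. \<forall>t\<in>T. s + t \<in> T \<and> s * t \<in> T \<and> (s - t) * (s - t) \<in> T) \<and>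
     (\<forall>s\<in>T. inverse s \<in> T) \<and> 1 \<in> T \<and> - 1 \<notin> T"

text \<open>The competitors \<open>S\<close> range over the whole ambient field and may generate a
  larger subfield than \<open>T\<close>. In an algebraically closed ambient field maximality
  therefore encodes a total order on \<open>T - T\<close> and real closedness at once.\<close>

definition maximal_cone :: "'a::field set \<Rightarrow> bool" where
  "maximal_cone T \<longleftrightarrow> field_cone T \<and> (\<forall>S. field_cone S \<longrightarrow> T \<subseteq> S \<longrightarrow> S = T)"

lemma field_coneD:
  assumes "field_cone T"
  shows "s \<in> T \<Longrightarrow> t \<in> T \<Longrightarrow> s + t \<in> T" "s \<in> T \<Longrightarrow> t \<in> T \<Longrightarrow> s * t \<in> T"
    "s \<in> T \<Longrightarrow> t \<in> T \<Longrightarrow> (s - t) * (s - t) \<in> T" "s \<in> T \<Longrightarrow> inverse s \<in> T" "1 \<in> T" "-1 \<notin> T" "0 \<in> T"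
proof -
  show r: "s \<in> T \<Longrightarrow> t \<in> T \<Longrightarrow> s + t \<in> T" "s \<in> T \<Longrightarrow> t \<in> T \<Longrightarrow> s * t \<in> T"
    "s \<in> T \<Longrightarrow> t \<in> T \<Longrightarrow> (s - t) * (s - t) \<in> T" "s \<in> T \<Longrightarrow> inverse s \<in> T" "1 \<in> T" "-1 \<notin> T" for s t
    using assms unfolding field_cone_def by blast+
  show "0 \<in> T" using r(3)[OF r(5) r(5)] by simp
qed

lemma maximal_cone_exists:
  assumes "field_cone T"
  shows "\<exists>S. maximal_cone S \<and> T \<subseteq> S"
proof -
  let ?A = "{S. field_cone S \<and> T \<subseteq> S}"
  have "\<exists>U\<in>?A. \<forall>S\<in>C. S \<subseteq> U" if C: "subset.chain ?A C" for C
  proof (cases "C = {}")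
    case False
    have CA: "C \<subseteq> ?A" and chain: "\<And>U V. U \<in> C \<Longrightarrow> V \<in> C \<Longrightarrow> U \<subseteq> V \<or> V \<subseteq> U"
      using C by (simp_all add: subset_chain_def)
    have CD: "field_cone S" "T \<subseteq> S" if "S \<in> C" for S using subsetD[OF CA that] by simp_all
    have two: "\<exists>S\<in>C. s \<in> S \<and> t \<in> S" if s: "s \<in> \<Union>C" and t: "t \<in> \<Union>C" for s t
    proof -
      obtain S S' where "S \<in> C" "S' \<in> C" "s \<in> S" "t \<in> S'" using s t by blast
      note S = this
      have "S \<subseteq> S' \<or> S' \<subseteq> S" using chain S(1,2) by blast
      then show ?thesis using S by blast
    qed
    have "field_cone (\<Union>C)" unfolding field_cone_def
    proof (intro conjI ballI)
      fix s t assume st: "s \<in> \<Union>C" "t \<in> \<Union>C"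
      then obtain S where S: "S \<in> C" "s \<in> S" "t \<in> S" using two by blast
      note D = field_coneD[OF CD(1)[OF S(1)]]
      show "s + t \<in> \<Union>C" using D(1)[OF S(2,3)] S(1) by blast
      show "s * t \<in> \<Union>C" using D(2)[OF S(2,3)] S(1) by blast
      show "(s - t) * (s - t) \<in> \<Union>C" using D(3)[OF S(2,3)] S(1) by blast
    next
      fix s assume "s \<in> \<Union>C"
      then show "inverse s \<in> \<Union>C" using field_coneD(4)[OF CD(1)] by blast
    next
      obtain S where "S \<in> C" using False by blast
      then show "1 \<in> \<Union>C" using field_coneD(5)[OF CD(1)] by blast
      show "- 1 \<notin> \<Union>C" using field_coneD(6)[OF CD(1)] by blast
    qed
    moreover have "T \<subseteq> \<Union>C" using False CD(2) by blast
    ultimately show ?thesis by blast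
  qed (use assms in blast)
  from subset_Zorn[OF this] obtain S where "S \<in> ?A" "\<forall>U\<in>?A. S \<subseteq> U \<longrightarrow> U = S" by blast
  then have "field_cone S" "T \<subseteq> S" "\<And>U. field_cone U \<Longrightarrow> S \<subseteq> U \<Longrightarrow> U = S" by blast+
  then show ?thesis unfolding maximal_cone_def by blast
qed

lemma field_cone_antisym:
  assumes T: "field_cone T" and "x \<in> T" "- x \<in> T"
  shows "x = 0"
proof (rule ccontr)
  assume "x \<noteq> 0"
  then have 1: "(- x) * inverse x = - 1" by simp
  have 2: "(- x) * inverse x \<in> T" using field_coneD(2)[OF T assms(3) field_coneD(4)[OF T assms(2)]] .
  show False using 1 2 field_coneD(6)[OF T] by simp
qed

text \<open>If neither difference belongs to \<open>T\<close>, adjoin \<open>a = s - t\<close>: the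
  set \<open>T + T a\<close> is again a cone, since \<open>- 1 = x + y a\<close> would give
  \<open>- a = (1 + x) / y\<close> in \<open>T\<close>. This contradicts maximality.\<close>

lemma maximal_cone_total:
  assumes max: "maximal_cone T" and st: "s \<in> T" "t \<in> T"
  shows "s - t \<in> T \<or> t - s \<in> T"
proof (rule ccontr)
  assume c: "\<not> (s - t \<in> T \<or> t - s \<in> T)"
  have T: "field_cone T" using max by (simp add: maximal_cone_def)
  note D = field_coneD[OF T]
  define a where "a = s - t"
  have aa: "a * a \<in> T" using D(3)[OF st] by (simp add: a_def)
  have a: "a \<notin> T" "- a \<notin> T" using c by (auto simp: a_def)
  have diff: "\<exists>u\<in>T. \<exists>v\<in>T. x + y * a = u - v" if "x \<in> T" "y \<in> T" for x y
  proof -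
    have "x + y * s \<in> T" "y * t \<in> T" using D(1)[OF that(1) D(2)[OF that(2) st(1)]] D(2)[OF that(2) st(2)] by auto
    moreover have "x + y * a = (x + y * s) - y * t" by (simp add: a_def algebra_simps)
    ultimately show ?thesis by blast
  qed
  define S where "S = {x + y * a | x y. x \<in> T \<and> y \<in> T}"
  have S_I: "x + y * a \<in> S" if "x \<in> T" "y \<in> T" for x y using that by (auto simp: S_def)
  have sq: "z * z \<in> T" if "u \<in> T" "v \<in> T" "z = u - v" for z u v using D(3)[OF that(1,2)] that by simp
  have S_diff: "\<exists>u\<in>T. \<exists>v\<in>T. x = u - v" if "x \<in> S" for x using that diff by (auto simp: S_def)
  have TS: "T \<subseteq> S" using S_I[of _ 0] D(7) by fastforce
  have mult: "x * y \<in> S" if x: "x \<in> S" and y: "y \<in> S" for x y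
  proof -
    obtain x1 x2 y1 y2 where xy: "x = x1 + x2 * a" "y = y1 + y2 * a" and m: "x1 \<in> T" "x2 \<in> T" "y1 \<in> T" "y2 \<in> T"
      using x y unfolding S_def by blast
    have "x * y = (x1 * y1 + x2 * y2 * (a * a)) + (x1 * y2 + x2 * y1) * a" by (simp add: xy algebra_simps)
    then show ?thesis using S_I[of "x1 * y1 + x2 * y2 * (a * a)" "x1 * y2 + x2 * y1"] D m aa by simp
  qed
  have "field_cone S" unfolding field_cone_def
  proof (intro conjI ballI)
    fix x y assume xy: "x \<in> S" "y \<in> S"
    show "x + y \<in> S"
    proof -
      obtain x1 x2 y1 y2 where xy: "x = x1 + x2 * a" "y = y1 + y2 * a" and m: "x1 \<in> T" "x2 \<in> T" "y1 \<in> T" "y2 \<in> T"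
        using xy unfolding S_def by blast
      have "x + y = (x1 + y1) + (x2 + y2) * a" by (simp add: xy algebra_simps)
      then show ?thesis using S_I[of "x1 + y1" "x2 + y2"] D m by simp
    qed
    show "x * y \<in> S" using mult xy .
    obtain u v where uv: "u \<in> T" "v \<in> T" "x = u - v" using S_diff xy by blast
    obtain u' v' where uv': "u' \<in> T" "v' \<in> T" "y = u' - v'" using S_diff xy by blast
    have "(x - y) * (x - y) \<in> T"
      by (rule sq[of "u + v'" "v + u'"]) (use D uv uv' in auto)
    then show "(x - y) * (x - y) \<in> S" using TS by blast
  next
    fix x assume x: "x \<in> S"
    obtain u v where uv: "u \<in> T" "v \<in> T" "x = u - v" using S_diff x by blast
    have "inverse (x * x) \<in> T" using sq[OF uv] D(4) by blast
    then have "x * inverse (x * x) \<in> S" using mult[OF x] TS by blast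
    then show "inverse x \<in> S" by (cases "x = 0") (auto simp: field_simps)
  next
    show "1 \<in> S" using TS D(5) by blast
    show "- 1 \<notin> S"
    proof
      assume "- 1 \<in> S"
      then obtain x y where xy: "x \<in> T" "y \<in> T" "- 1 = x + y * a" by (auto simp: S_def)
      have "y \<noteq> 0" using xy D(6) by auto
      have "1 + (x + y * a) = 0" unfolding xy(3)[symmetric] by simp
      then have "(1 + x) + y * a = 0" by (simp only: add.assoc)
      then have e: "y * (- a) = 1 + x" by (simp only: add_eq_0_iff2 mult_minus_right)
      have "- a = (1 + x) * inverse y" unfolding e[symmetric] using \<open>y \<noteq> 0\<close> by simp
      moreover have "(1 + x) * inverse y \<in> T" by (intro D xy)
      ultimately show False using a(2) by simp
    qed
  qed
  then have "S = T" using max TS by (simp add: maximal_cone_def)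
  moreover have "a \<in> S" using S_I[of 0 1] D by simp
  ultimately show False using a by simp
qed

subsection \<open>Real points of a real prime ideal\<close>

definition prime_ideal_set :: "'a::comm_ring_1 set \<Rightarrow> bool" where
  "prime_ideal_set I \<longleftrightarrow> 0 \<in> I \<and> (\<forall>a\<in>I. \<forall>b\<in>I. a + b \<in> I) \<and> (\<forall>a\<in>I. \<forall>b. a * b \<in> I) \<and>
     1 \<notin> I \<and> (\<forall>a b. a * b \<in> I \<longrightarrow> a \<in> I \<or> b \<in> I)"

definition preordering :: "'a::comm_ring_1 set \<Rightarrow> bool" where
  "preordering T \<longleftrightarrow> (\<forall>a\<in>T. \<forall>b\<in>T. a + b \<in> T \<and> a * b \<in> T) \<and> (\<forall>a. a * a \<in> T)"

text \<open>For \<open>T\<close> the sums of squares this is the usual notion of a real ideal. For a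
  prime ideal and a larger preordering it is what makes the residue field orderable with
  \<open>T\<close> nonnegative.\<close>

definition real_over :: "'a::comm_ring_1 set \<Rightarrow> 'a set \<Rightarrow> bool" where
  "real_over I T \<longleftrightarrow> (\<forall>t\<in>T. \<forall>s. t + s * s \<in> I \<longrightarrow> s \<in> I)"

lemma prime_ideal_setD:
  assumes "prime_ideal_set I"
  shows "0 \<in> I" "a \<in> I \<Longrightarrow> b \<in> I \<Longrightarrow> a + b \<in> I" "a \<in> I \<Longrightarrow> a * b \<in> I" "a \<in> I \<Longrightarrow> b * a \<in> I"
    "1 \<notin> I" "a * b \<in> I \<Longrightarrow> a \<in> I \<or> b \<in> I" "a \<in> I \<Longrightarrow> - a \<in> I" "a \<in> I \<Longrightarrow> b \<in> I \<Longrightarrow> a - b \<in> I"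
proof -
  show r: "0 \<in> I" "a \<in> I \<Longrightarrow> b \<in> I \<Longrightarrow> a + b \<in> I" "a \<in> I \<Longrightarrow> a * b \<in> I" "1 \<notin> I" "a * b \<in> I \<Longrightarrow> a \<in> I \<or> b \<in> I"
    for a b using assms by (auto simp: prime_ideal_set_def)
  show "a \<in> I \<Longrightarrow> b * a \<in> I" using r(3)[of a b] by (simp add: mult.commute)
  show m: "a \<in> I \<Longrightarrow> - a \<in> I" for a using r(3)[of a "-1"] by simp
  show "a \<in> I \<Longrightarrow> b \<in> I \<Longrightarrow> a - b \<in> I" using r(2)[of a "-b"] m by simp
qed

lemma preorderingD:
  assumes "preordering T"
  shows "a \<in> T \<Longrightarrow> b \<in> T \<Longrightarrow> a + b \<in> T" "a \<in> T \<Longrightarrow> b \<in> T \<Longrightarrow> a * b \<in> T" "a * a \<in> T" "0 \<in> T" "1 \<in> T"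
proof -
  show r: "a \<in> T \<Longrightarrow> b \<in> T \<Longrightarrow> a + b \<in> T" "a \<in> T \<Longrightarrow> b \<in> T \<Longrightarrow> a * b \<in> T" "a * a \<in> T" for a b
    using assms by (auto simp: preordering_def)
  show "0 \<in> T" "1 \<in> T" using r(3)[of 0] r(3)[of 1] by auto
qed

text \<open>Finite parts of \<open>T\<close> and \<open>I\<close> are what a transfer of finitely
  many signs can satisfy at one real point; the point may depend on them.\<close>

definition has_points :: "'v mpoly set \<Rightarrow> 'v mpoly set \<Rightarrow> bool" where
  "has_points I T \<longleftrightarrow> (\<forall>G H d. finite G \<longrightarrow> G \<subseteq> T \<longrightarrow> finite H \<longrightarrow> H \<subseteq> I \<longrightarrow> d \<notin> I \<longrightarrow>
     (\<exists>x. (\<forall>p\<in>G. meval x p \<ge> 0) \<and> (\<forall>p\<in>H. meval x p = 0) \<and> meval x d \<noteq> 0))"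

definition real_poly_at :: "real poly \<Rightarrow> 'v mpoly \<Rightarrow> 'v mpoly" where
  "real_poly_at w f = poly (map_poly mconst w) f"

text \<open>The premise says that f is transcendental over the reals modulo \<open>I\<close>.
  \<open>D\<close> is a polynomial vector field, namely d/df on the residue field after clearing
  denominators; hence its value on f is nonzero rather than 1.\<close>

definition has_derivations :: "'v mpoly set \<Rightarrow> bool" where
  "has_derivations I \<longleftrightarrow> (\<forall>f. (\<forall>w. real_poly_at w f \<in> I \<longrightarrow> w = 0) \<longrightarrow>
     (\<exists>D. (\<forall>p\<in>I. (\<Sum>i\<in>UNIV. D i * mderiv i p) \<in> I) \<and> (\<Sum>i\<in>UNIV. D i * mderiv i f) \<notin> I))"

definition admissible :: "'v mpoly set \<times> 'v mpoly set \<Rightarrow> bool" where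
  "admissible = (\<lambda>(I, T). prime_ideal_set I \<and> preordering T \<and> real_over I T)"

definition well_behaved :: "'v mpoly set \<times> 'v mpoly set \<Rightarrow> bool" where
  "well_behaved = (\<lambda>(I, T). has_points I T \<and> has_derivations I)"

text \<open>A counterexample to \<open>admissible \<Longrightarrow> well_behaved\<close>, if there is one. Fixing it by choice
  allows one to define its residue field and a real closure as types.\<close>

definition witness :: "'v mpoly set \<times> 'v mpoly set" where
  "witness = (SOME w. admissible w \<and> ((\<exists>v :: 'v mpoly set \<times> 'v mpoly set. admissible v \<and> \<not> well_behaved v) \<longrightarrow> \<not> well_behaved w))"

text \<open>The choice of \<open>witness\<close> needs an admissible pair even if there is no
  counterexample: evaluation at the origin supplies one.\<close>

lemma admissible_exists: "\<exists>w :: 'v mpoly set \<times> 'v mpoly set. admissible w"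
proof
  let ?e = "meval (\<lambda>v :: 'v. 0)"
  show "admissible ({p. ?e p = 0}, {p. 0 \<le> ?e p})"
    by (auto simp: admissible_def prime_ideal_set_def preordering_def real_over_def add_nonneg_eq_0_iff)
qed

lemma witness:
  shows "admissible (witness :: 'v mpoly set \<times> 'v mpoly set)"
    "well_behaved (witness :: 'v mpoly set \<times> 'v mpoly set) \<Longrightarrow> admissible v \<Longrightarrow> well_behaved (v :: 'v mpoly set \<times> 'v mpoly set)"
proof -
  let ?P = "\<lambda>w :: 'v mpoly set \<times> 'v mpoly set. admissible w \<and> ((\<exists>v :: 'v mpoly set \<times> 'v mpoly set. admissible v \<and> \<not> well_behaved v) \<longrightarrow> \<not> well_behaved w)"
  have "\<exists>w. ?P w" using admissible_exists by blast
  then have "?P witness" unfolding witness_def by (rule someI_ex)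
  then have w: "admissible (witness :: 'v mpoly set \<times> 'v mpoly set)"
    and i: "(\<exists>v :: 'v mpoly set \<times> 'v mpoly set. admissible v \<and> \<not> well_behaved v) \<longrightarrow>
      \<not> well_behaved (witness :: 'v mpoly set \<times> 'v mpoly set)"
    by (rule conjunct1, rule conjunct2)
  show "admissible (witness :: 'v mpoly set \<times> 'v mpoly set)" by (rule w)
  assume wb: "well_behaved (witness :: 'v mpoly set \<times> 'v mpoly set)" and v: "admissible v"
  show "well_behaved v"
  proof (rule ccontr)
    assume "\<not> well_behaved v"
    with v have "\<exists>v :: 'v mpoly set \<times> 'v mpoly set. admissible v \<and> \<not> well_behaved v" by blast
    with i wb show False by blast
  qed
qed

definition wit_ideal :: "'v mpoly set" where "wit_ideal = fst witness"
definition wit_cone :: "'v mpoly set" where "wit_cone = snd witness"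

lemma wit: "prime_ideal_set (wit_ideal :: 'v mpoly set)" "preordering (wit_cone :: 'v mpoly set)"
    "real_over wit_ideal (wit_cone :: 'v mpoly set)"
  using witness(1)[where 'v = 'v] unfolding admissible_def wit_ideal_def wit_cone_def case_prod_beta
  by simp_all

lemmas witI = prime_ideal_setD[OF wit(1)]

\<comment> \<open>The residue field of the witness\<close>
quotient_type 'v coord = "('v \<Rightarrow>\<^sub>0 nat) \<Rightarrow>\<^sub>0 real" / "\<lambda>p q. p - q \<in> wit_ideal"
proof (rule equivpI)
  show "reflp (\<lambda>p q :: 'v mpoly. p - q \<in> wit_ideal)" by (simp add: reflp_def witI)
  show "symp (\<lambda>p q :: 'v mpoly. p - q \<in> wit_ideal)" unfolding symp_def using witI(7) by (metis minus_diff_eq)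
  show "transp (\<lambda>p q :: 'v mpoly. p - q \<in> wit_ideal)" unfolding transp_def
  proof (intro allI impI)
    fix p q r :: "'v mpoly" assume "p - q \<in> wit_ideal" "q - r \<in> wit_ideal"
    then have "(p - q) + (q - r) \<in> wit_ideal" by (rule witI)
    then show "p - r \<in> wit_ideal" by simp
  qed
qed

instantiation coord :: (type) idom
begin

lift_definition zero_coord :: "'a coord" is 0 .
lift_definition one_coord :: "'a coord" is 1 .
lift_definition plus_coord :: "'a coord \<Rightarrow> 'a coord \<Rightarrow> 'a coord" is "(+)"
  subgoal for p q p' q' using witI(2)[of "p - q" "p' - q'"] by (simp add: algebra_simps)
  done
lift_definition minus_coord :: "'a coord \<Rightarrow> 'a coord \<Rightarrow> 'a coord" is "(-)"
  subgoal for p q p' q' using witI(8)[of "p - q" "p' - q'"] by (simp add: algebra_simps)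
  done
lift_definition uminus_coord :: "'a coord \<Rightarrow> 'a coord" is "uminus"
  subgoal for p q using witI(7)[of "p - q"] by (simp add: algebra_simps)
  done
lift_definition times_coord :: "'a coord \<Rightarrow> 'a coord \<Rightarrow> 'a coord" is "(*)"
  subgoal for p q p' q' using witI(2)[OF witI(3)[of "p - q" p'] witI(4)[of "p' - q'" q]] by (simp add: algebra_simps)
  done

instance
proof
  fix a b c :: "'a coord"
  show "a + b + c = a + (b + c)" by transfer (simp add: witI(1) algebra_simps)
  show "a + b = b + a" by transfer (simp add: witI(1) algebra_simps)
  show "0 + a = a" by transfer (simp add: witI(1))
  show "- a + a = 0" by transfer (simp add: witI(1))
  show "a - b = a + - b" by transfer (simp add: witI(1))
  show "a * b * c = a * (b * c)" by transfer (simp add: witI(1) algebra_simps)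
  show "a * b = b * a" by transfer (simp add: witI(1) algebra_simps)
  show "1 * a = a" by transfer (simp add: witI(1))
  show "(a + b) * c = a * c + b * c" by transfer (simp add: witI(1) algebra_simps)
  show "0 * a = 0" by (induct a rule: coord.abs_induct) (simp add: zero_coord.abs_eq times_coord.abs_eq)
  show "a * 0 = 0" by (induct a rule: coord.abs_induct) (simp add: zero_coord.abs_eq times_coord.abs_eq)
  show "a * (b + c) = a * b + a * c"
    by (induct a rule: coord.abs_induct, induct b rule: coord.abs_induct, induct c rule: coord.abs_induct)
       (simp add: plus_coord.abs_eq times_coord.abs_eq distrib_left)
  have "0 - 1 \<notin> (wit_ideal :: 'a mpoly set)" using witI(7)[of "0 - 1"] witI(5) by auto
  then show "(0 :: 'a coord) \<noteq> 1" by transfer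
  have z: "abs_coord p = 0 \<longleftrightarrow> p \<in> wit_ideal" for p :: "'a mpoly"
    by (simp add: zero_coord.abs_eq coord.abs_eq_iff)
  show "a \<noteq> 0 \<Longrightarrow> b \<noteq> 0 \<Longrightarrow> a * b \<noteq> 0"
    by (induct a rule: coord.abs_induct, induct b rule: coord.abs_induct)
       (use witI(6) in \<open>auto simp: times_coord.abs_eq z\<close>)
qed

end

lemma ring_map_abs_coord: "ring_map abs_coord"
  by (simp add: ring_map_def one_coord.abs_eq plus_coord.abs_eq times_coord.abs_eq)

lemma abs_coord_eq_0_iff: "abs_coord p = 0 \<longleftrightarrow> p \<in> wit_ideal"
  by (simp add: zero_coord.abs_eq coord.abs_eq_iff)

type_synonym 'v residue = "'v coord fract"

definition to_residue :: "'v mpoly \<Rightarrow> 'v residue" where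
  "to_residue p = Fract (abs_coord p) 1"

lemma ring_map_to_residue: "ring_map to_residue"
  unfolding ring_map_def to_residue_def One_fract_def
  by (auto simp only: add_fract mult_fract ring_mapD(2-4)[OF ring_map_abs_coord]
    mult_1_right mult_1_left one_neq_zero not_False_eq_True)

lemma to_residue_eq_0_iff: "to_residue p = 0 \<longleftrightarrow> p \<in> wit_ideal"
  unfolding to_residue_def Zero_fract_def
  by (simp only: eq_fract one_neq_zero not_False_eq_True mult_1_right mult_zero_left abs_coord_eq_0_iff)

lemma residue_cases:
  obtains p q where "q \<notin> wit_ideal" "(x :: 'v residue) = to_residue p / to_residue q"
proof -
  obtain a b where ab: "x = Fract a b" "b \<noteq> 0" by (cases x) auto
  have "\<exists>p. c = abs_coord p" for c by (induct c rule: coord.abs_induct) blast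
  then obtain p q where pq: "a = abs_coord p" "b = abs_coord q" by metis
  show ?thesis
  proof (rule that)
    show "q \<notin> wit_ideal" using ab(2) by (simp add: pq abs_coord_eq_0_iff)
    show "x = to_residue p / to_residue q" by (simp add: ab(1) pq to_residue_def)
  qed
qed

text \<open>The algebraic closure is the ambient field from which a real closure is cut out by a
  maximal cone.\<close>

definition to_ac_residue :: "'v mpoly \<Rightarrow> 'v residue alg_closure" where
  "to_ac_residue p = to_ac (to_residue p)"

lemma ring_map_to_ac_residue: "ring_map to_ac_residue"
  unfolding ring_map_def to_ac_residue_def
  by (simp only: ring_mapD(2-4)[OF ring_map_to_residue] to_ac_1 to_ac_add to_ac_mult simp_thms)

lemmas acr = ring_mapD[OF ring_map_to_ac_residue]

lemma to_ac_residue_eq_0_iff: "to_ac_residue p = 0 \<longleftrightarrow> p \<in> wit_ideal"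
  unfolding to_ac_residue_def to_ac_eq_0_iff to_residue_eq_0_iff ..

text \<open>The preordering induced by \<open>wit_cone\<close> on the residue field: square
  denominators do not affect signs. A representation of - 1 would put \<open>t + s * s\<close> into
  the ideal, which \<open>real_over\<close> forbids for s outside it.\<close>

definition initial_cone :: "'v residue alg_closure set" where
  "initial_cone = {to_ac_residue t / to_ac_residue (s * s) | t s. t \<in> wit_cone \<and> s \<notin> wit_ideal}"

lemma field_cone_initial: "field_cone initial_cone"
proof -
  note T = preorderingD[OF wit(2)]
  have I: "to_ac_residue t / to_ac_residue (s * s) \<in> initial_cone" if "t \<in> wit_cone" "s \<notin> wit_ideal" for t s :: "'a mpoly"
    using that by (auto simp: initial_cone_def)
  show ?thesis unfolding field_cone_def
  proof (intro conjI ballI)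
    fix x y :: "'a residue alg_closure" assume "x \<in> initial_cone" "y \<in> initial_cone"
    then obtain t s t' s' where x: "x = to_ac_residue t / to_ac_residue (s * s)" "t \<in> wit_cone" "s \<notin> wit_ideal"
      and y: "y = to_ac_residue t' / to_ac_residue (s' * s')" "t' \<in> wit_cone" "s' \<notin> wit_ideal"
      by (auto simp: initial_cone_def)
    have ne: "to_ac_residue s \<noteq> 0" "to_ac_residue s' \<noteq> 0" using x y by (auto simp: to_ac_residue_eq_0_iff)
    have ss: "s * s' \<notin> wit_ideal" "(s * s') * (s * s') \<notin> wit_ideal" using x y witI(6) by blast+
    have "x + y = to_ac_residue (t * (s' * s') + t' * (s * s)) / to_ac_residue ((s * s') * (s * s'))"
      using ne by (simp add: x y acr field_simps)
    then show "x + y \<in> initial_cone" using I[OF _ ss(1)] T x y by metis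
    have "x * y = to_ac_residue (t * t') / to_ac_residue ((s * s') * (s * s'))"
      using ne by (simp add: x y acr field_simps)
    then show "x * y \<in> initial_cone" using I[OF _ ss(1)] T x y by metis
    let ?d = "t * (s' * s') - t' * (s * s)"
    have "x - y = to_ac_residue ?d / to_ac_residue ((s * s') * (s * s'))"
      using ne by (simp add: x y acr field_simps)
    then have "(x - y) * (x - y) = to_ac_residue (?d * ?d) / to_ac_residue (((s * s') * (s * s')) * ((s * s') * (s * s')))"
      by (simp add: acr)
    then show "(x - y) * (x - y) \<in> initial_cone" using I[OF _ ss(2), of "?d * ?d"] T by metis
  next
    fix x :: "'a residue alg_closure" assume "x \<in> initial_cone"
    then obtain t s where x: "x = to_ac_residue t / to_ac_residue (s * s)" "t \<in> wit_cone" "s \<notin> wit_ideal"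
      by (auto simp: initial_cone_def)
    show "inverse x \<in> initial_cone"
    proof (cases "t \<in> wit_ideal")
      case True
      then have "inverse x = x" using x by (simp add: to_ac_residue_eq_0_iff[THEN iffD2])
      then show ?thesis using \<open>x \<in> initial_cone\<close> by simp
    next
      case False
      then have "to_ac_residue t \<noteq> 0" "to_ac_residue s \<noteq> 0" using x(3) by (simp_all add: to_ac_residue_eq_0_iff)
      then have "inverse x = to_ac_residue (t * (s * s)) / to_ac_residue (t * t)"
        unfolding x(1) acr by (simp add: field_simps)
      then show ?thesis using I[OF _ False, of "t * (s * s)"] T x by metis
    qed
  next
    have "1 = to_ac_residue 1 / to_ac_residue (1 * 1 :: 'a mpoly)" by (simp add: acr)
    then show "1 \<in> (initial_cone :: 'a residue alg_closure set)" using I[OF T(5) witI(5)] by simp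
    show "- 1 \<notin> (initial_cone :: 'a residue alg_closure set)"
    proof
      assume "- 1 \<in> (initial_cone :: 'a residue alg_closure set)"
      then obtain t s :: "'a mpoly" where x: "- 1 = to_ac_residue t / to_ac_residue (s * s)" "t \<in> wit_cone" "s \<notin> wit_ideal"
        by (auto simp: initial_cone_def)
      have "to_ac_residue s \<noteq> 0" using x(3) by (simp add: to_ac_residue_eq_0_iff)
      then have "- (to_ac_residue s * to_ac_residue s) = to_ac_residue t" using x(1) by (simp add: acr field_simps)
      then have "to_ac_residue (t + s * s) = 0" unfolding acr by (metis add.left_inverse)
      then have "t + s * s \<in> wit_ideal" by (simp add: to_ac_residue_eq_0_iff)
      then show False using x wit(3) by (auto simp: real_over_def)
    qed
  qed
qed

section \<open>The real closure of the residue field as an ordered field\<close>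

definition wit_order :: "'v residue alg_closure set" where
  "wit_order = (SOME S. maximal_cone S \<and> initial_cone \<subseteq> S)"

lemma wit_order: "maximal_cone wit_order" "initial_cone \<subseteq> wit_order"
  using someI_ex[OF maximal_cone_exists[OF field_cone_initial]] unfolding wit_order_def by auto

lemma field_cone_wit_order: "field_cone wit_order"
  by (rule conjunct1[OF wit_order(1)[unfolded maximal_cone_def]])

lemmas wo = field_coneD[OF field_cone_wit_order]


text \<open>By totality this union is the set of all differences of cone elements, hence a subfield
  with \<open>wit_order\<close> as its nonnegative part.\<close>

typedef 'v rclosure = "{x :: 'v residue alg_closure. x \<in> wit_order \<or> - x \<in> wit_order}"
  using wo(5) by blast

setup_lifting type_definition_rclosure

lemma wit_order_diff: "x \<in> wit_order \<Longrightarrow> y \<in> wit_order \<Longrightarrow> x - y \<in> wit_order \<or> y - x \<in> wit_order"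
  by (rule maximal_cone_total[OF wit_order(1)])

lemma wit_order_add_closed:
  assumes "x \<in> wit_order \<or> - x \<in> wit_order" "y \<in> wit_order \<or> - y \<in> wit_order"
  shows "x + y \<in> wit_order \<or> - (x + y) \<in> wit_order"
proof -
  consider "x \<in> wit_order" "y \<in> wit_order" | "x \<in> wit_order" "- y \<in> wit_order"
    | "- x \<in> wit_order" "y \<in> wit_order" | "- x \<in> wit_order" "- y \<in> wit_order" using assms by blast
  then show ?thesis
  proof cases
    case 1 then show ?thesis using wo(1) by blast
  next
    case 2
    have "x - - y = x + y" "- y - x = - (x + y)" by (simp, simp only: minus_add diff_conv_add_uminus)
    then show ?thesis using wit_order_diff[OF 2] by metis
  next
    case 3
    have "y - - x = x + y" "- x - y = - (x + y)" by (simp_all add: add.commute)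
    then show ?thesis using wit_order_diff[OF 3(2,1)] by metis
  next
    case 4
    have "- x + - y = - (x + y)" by simp
    then show ?thesis using wo(1)[OF 4] by metis
  qed
qed

lemma wit_order_mult_closed:
  assumes "x \<in> wit_order \<or> - x \<in> wit_order" "y \<in> wit_order \<or> - y \<in> wit_order"
  shows "x * y \<in> wit_order \<or> - (x * y) \<in> wit_order"
  using assms wo(2)[of x y] wo(2)[of x "- y"] wo(2)[of "- x" y] wo(2)[of "- x" "- y"] by auto

lemma wit_order_inverse_closed:
  assumes "x \<in> wit_order \<or> - x \<in> wit_order"
  shows "inverse x \<in> wit_order \<or> - inverse x \<in> wit_order"
  using assms wo(4)[of x] wo(4)[of "- x"] by auto

instantiation rclosure :: (type) linordered_field
begin

lift_definition zero_rclosure :: "'a rclosure" is 0 using wo(7) by blast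
lift_definition one_rclosure :: "'a rclosure" is 1 using wo(5) by blast
lift_definition plus_rclosure :: "'a rclosure \<Rightarrow> 'a rclosure \<Rightarrow> 'a rclosure" is "(+)"
  by (rule wit_order_add_closed)
lift_definition uminus_rclosure :: "'a rclosure \<Rightarrow> 'a rclosure" is uminus by auto
lift_definition minus_rclosure :: "'a rclosure \<Rightarrow> 'a rclosure \<Rightarrow> 'a rclosure" is "(-)"
  subgoal for x y using wit_order_add_closed[of x "- y"] by auto
  done
lift_definition times_rclosure :: "'a rclosure \<Rightarrow> 'a rclosure \<Rightarrow> 'a rclosure" is "(*)"
  by (rule wit_order_mult_closed)
lift_definition inverse_rclosure :: "'a rclosure \<Rightarrow> 'a rclosure" is inverse
  by (rule wit_order_inverse_closed)
lift_definition divide_rclosure :: "'a rclosure \<Rightarrow> 'a rclosure \<Rightarrow> 'a rclosure" is "(/)"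
  unfolding divide_inverse by (intro wit_order_mult_closed wit_order_inverse_closed)
lift_definition less_eq_rclosure :: "'a rclosure \<Rightarrow> 'a rclosure \<Rightarrow> bool" is "\<lambda>x y. y - x \<in> wit_order" .
definition less_rclosure :: "'a rclosure \<Rightarrow> 'a rclosure \<Rightarrow> bool" where
  "less_rclosure x y \<longleftrightarrow> x \<le> y \<and> \<not> y \<le> x"
definition abs_rclosure :: "'a rclosure \<Rightarrow> 'a rclosure" where
  "abs_rclosure x = (if x < 0 then - x else x)"
definition sgn_rclosure :: "'a rclosure \<Rightarrow> 'a rclosure" where
  "sgn_rclosure x = (if x = 0 then 0 else if 0 < x then 1 else - 1)"

instance
proof
  fix x y z :: "'a rclosure"
  show "x + y + z = x + (y + z)" by transfer (simp add: add.assoc)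
  show "x + y = y + x" by transfer (simp add: add.commute)
  show "0 + x = x" by transfer simp
  show "- x + x = 0" by transfer simp
  show "x - y = x + - y" by transfer simp
  show "x * y * z = x * (y * z)" by transfer (simp add: mult.assoc)
  show "x * y = y * x" by transfer (simp add: mult.commute)
  show "1 * x = x" by transfer simp
  show "(x + y) * z = x * z + y * z" by transfer (simp add: distrib_right)
  show "(0 :: 'a rclosure) \<noteq> 1" by transfer simp
  show "x \<noteq> 0 \<Longrightarrow> inverse x * x = 1" by transfer simp
  show "x div y = x * inverse y" by transfer (simp add: divide_inverse)
  show "inverse (0 :: 'a rclosure) = 0" by transfer simp
  have refl: "x \<le> x" for x :: "'a rclosure" by transfer (simp add: wo(7))
  have anti': "x = y" if "x \<le> y" "y \<le> x" for x y :: "'a rclosure" using that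
    by transfer (metis field_cone_antisym[OF field_cone_wit_order] eq_iff_diff_eq_0 minus_diff_eq)
  show "x \<le> x" by (rule refl)
  show "x \<le> y \<Longrightarrow> y \<le> z \<Longrightarrow> x \<le> z"
    by transfer (use wo(1) in \<open>force simp: algebra_simps dest: wo(1)\<close>)
  show "x \<le> y \<Longrightarrow> y \<le> x \<Longrightarrow> x = y" by (rule anti')
  show "x < y \<longleftrightarrow> x \<le> y \<and> \<not> y \<le> x" by (simp add: less_rclosure_def)
  show total: "x \<le> y \<or> y \<le> x"
  proof (transfer)
    fix x y :: "'a residue alg_closure"
    assume "x \<in> wit_order \<or> - x \<in> wit_order" "y \<in> wit_order \<or> - y \<in> wit_order"
    then have "y + - x \<in> wit_order \<or> - (y + - x) \<in> wit_order"
      by (intro wit_order_add_closed) auto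
    then show "y - x \<in> wit_order \<or> x - y \<in> wit_order" by simp
  qed
  show "x \<le> y \<Longrightarrow> z + x \<le> z + y" by transfer simp
  show "x < y \<Longrightarrow> 0 < z \<Longrightarrow> z * x < z * y"
  proof -
    assume h: "x < y" "0 < z"
    have "x \<le> y" "0 \<le> z" using h by (auto simp: less_rclosure_def)
    then have le: "z * x \<le> z * y" by transfer (use wo(2) in \<open>force simp: algebra_simps dest: wo(2)\<close>)
    have "z * x \<noteq> z * y"
    proof
      assume "z * x = z * y"
      moreover have "z \<noteq> 0" "x \<noteq> y" using h refl by (auto simp: less_rclosure_def)
      ultimately show False by transfer simp
    qed
    then show "z * x < z * y" using le anti' less_rclosure_def by blast
  qed
  show "x + y - x = y" by transfer simp
  show "x - y - z = x - (y + z)" by transfer (simp add: algebra_simps)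
  show "0 * x = 0" by transfer simp
  show "x * 0 = 0" by transfer simp
  show "\<bar>x\<bar> = (if x < 0 then - x else x)" by (simp add: abs_rclosure_def)
  show "sgn x = (if x = 0 then 0 else if 0 < x then 1 else - 1)" by (simp add: sgn_rclosure_def)
qed

end

section \<open>Real closedness of the constructed field\<close>

lemma ring_map_map_poly:
  assumes "ring_map \<phi>"
  shows "ring_map (map_poly \<phi>)"
  unfolding ring_map_def
proof (intro conjI allI)
  note r = ring_mapD[OF assms]
  show "map_poly \<phi> 1 = 1" by (intro poly_eqI) (simp add: coeff_map_poly r coeff_1)
  show "map_poly \<phi> (p + q) = map_poly \<phi> p + map_poly \<phi> q" for p q
    by (intro poly_eqI) (simp add: coeff_map_poly r)
  show "map_poly \<phi> (p * q) = map_poly \<phi> p * map_poly \<phi> q" for p q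
    by (intro poly_eqI) (simp add: coeff_map_poly r coeff_mult ring_map_sum[OF assms])
qed

lemma ring_map_poly: "ring_map (\<lambda>p. poly p \<alpha>)"
  by (simp add: ring_map_def)

lemma ring_map_poly_map_poly: "ring_map \<phi> \<Longrightarrow> ring_map (\<lambda>p. poly (map_poly \<phi> p) \<alpha>)"
  by (rule ring_map_comp[OF ring_map_poly ring_map_map_poly])

text \<open>A nonzero combination of least degree divides both polynomials. Irreducibility is
  phrased by degrees because that is what a counterexample of minimal degree provides.\<close>

lemma bezout_poly:
  fixes p q :: "'a::field poly"
  assumes "p \<noteq> 0" and irr: "\<And>u v. p = u * v \<Longrightarrow> degree u = 0 \<or> degree v = 0" and nd: "\<not> p dvd q"
  shows "\<exists>u v. u * q + v * p = 1"
proof -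
  define J where "J = {u * q + v * p | u v. True}"
  have JI: "u * q + v * p \<in> J" for u v by (auto simp: J_def)
  have "q \<in> J" "p \<in> J" using JI[of 1 0] JI[of 0 1] by auto
  have "q \<noteq> 0" using nd by auto
  then obtain d where d: "d \<in> J" "d \<noteq> 0" and least: "\<And>x. x \<in> J \<Longrightarrow> x \<noteq> 0 \<Longrightarrow> degree d \<le> degree x"
    using ex_has_least_nat[of "\<lambda>x. x \<in> J \<and> x \<noteq> 0" q degree] \<open>q \<in> J\<close> by blast
  obtain u v where uv: "d = u * q + v * p" using d(1) by (auto simp: J_def)
  have dvd: "d dvd x" if x: "x \<in> J" for x
  proof (rule ccontr)
    assume "\<not> d dvd x"
    then have ne: "x mod d \<noteq> 0" by (simp add: dvd_eq_mod_eq_0)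
    obtain u' v' where x: "x = u' * q + v' * p" using x by (auto simp: J_def)
    have "x mod d = x - x div d * d" by (simp add: minus_div_mult_eq_mod)
    also have "\<dots> = (u' - x div d * u) * q + (v' - x div d * v) * p"
      unfolding uv x by (simp add: algebra_simps)
    finally have "x mod d \<in> J" using JI by simp
    then show False using least[OF _ ne] degree_mod_less'[OF d(2) ne] by simp
  qed
  obtain e where e: "p = d * e" using dvd[OF \<open>p \<in> J\<close>] by (auto simp: dvd_def)
  show ?thesis
  proof (cases "degree d = 0")
    case True
    then obtain k where k: "d = [:k:]" by (rule degree_eq_zeroE)
    then have "k \<noteq> 0" using d(2) by auto
    have "smult (inverse k) u * q + smult (inverse k) v * p = smult (inverse k) d"
      by (simp add: uv smult_add_right)
    also have "\<dots> = 1" using k \<open>k \<noteq> 0\<close> by (simp add: one_pCons)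
    finally show ?thesis by blast
  next
    case False
    then have "degree e = 0" using irr[OF e] by simp
    then obtain k where k: "e = [:k:]" by (rule degree_eq_zeroE)
    then have "k \<noteq> 0" using e assms(1) by auto
    then have "d = p * [:inverse k:]" using e k by simp
    then have "p dvd d" by (rule dvdI)
    then show ?thesis using dvd[OF \<open>q \<in> J\<close>] nd dvd_trans by blast
  qed
qed

text \<open>The weights are kept explicit because nonnegative elements of the field are not yet
  known to be squares.\<close>

inductive_set weighted_squares :: "'a::linordered_field poly set" where
  zero: "0 \<in> weighted_squares"
| step: "0 \<le> a \<Longrightarrow> s \<in> weighted_squares \<Longrightarrow> smult a (q * q) + s \<in> weighted_squares"

lemma weighted_squares_add: "s \<in> weighted_squares \<Longrightarrow> t \<in> weighted_squares \<Longrightarrow> s + t \<in> weighted_squares"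
  by (induction s rule: weighted_squares.induct) (auto simp: add.assoc intro: weighted_squares.step)

lemma weighted_squares_one: "0 \<le> a \<Longrightarrow> smult a (q * q) \<in> weighted_squares"
  using weighted_squares.step[OF _ weighted_squares.zero, of a q] by simp

lemma weighted_squares_scale: "s \<in> weighted_squares \<Longrightarrow> 0 \<le> a \<Longrightarrow> smult a (q * q) * s \<in> weighted_squares"
proof (induction s rule: weighted_squares.induct)
  case (step b s r)
  have "smult a (q * q) * (smult b (r * r) + s) = smult (a * b) ((q * r) * (q * r)) + smult a (q * q) * s"
    by (simp add: algebra_simps)
  then show ?case using step by (metis mult_nonneg_nonneg weighted_squares.step)
qed (simp add: weighted_squares.zero)

lemma weighted_squares_mult: "s \<in> weighted_squares \<Longrightarrow> t \<in> weighted_squares \<Longrightarrow> s * t \<in> weighted_squares"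
  by (induction s rule: weighted_squares.induct)
     (auto simp: distrib_right intro: weighted_squares_add weighted_squares_scale weighted_squares.zero
       simp del: mult_smult_left)

text \<open>Each square \<open>q * q\<close> is replaced by that of \<open>q mod p\<close>. This
  keeps pointwise nonnegativity and bounds the degree, so that in \<open>1 + s' = p * r\<close> the
  cofactor r has smaller degree than p.\<close>

lemma weighted_squares_reduce:
  fixes p :: "'a::linordered_field poly"
  assumes "s \<in> weighted_squares" "0 < degree p"
  shows "\<exists>s'. p dvd s - s' \<and> (\<forall>x. 0 \<le> poly s' x) \<and> degree s' \<le> 2 * (degree p - 1)"
  using assms(1)
proof (induction s rule: weighted_squares.induct)
  case zero
  show ?case by (intro exI[of _ 0]) simp
next
  case (step a s q)
  then obtain s' where s': "p dvd s - s'" "\<forall>x. 0 \<le> poly s' x" "degree s' \<le> 2 * (degree p - 1)" by blast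
  define r where "r = q mod p"
  have deg: "degree r \<le> degree p - 1"
  proof (cases "r = 0")
    case False
    then show ?thesis using degree_mod_less[of p q] assms(2) by (fastforce simp: r_def)
  qed simp
  have "p dvd q - r" by (simp add: r_def minus_mod_eq_mult_div)
  then have "p dvd (q - r) * smult a (q + r)" by (rule dvd_mult2)
  then have "p dvd (q - r) * smult a (q + r) + (s - s')" using s'(1) by (rule dvd_add)
  moreover have "(q - r) * smult a (q + r) + (s - s') = smult a (q * q) + s - (smult a (r * r) + s')"
    by (simp add: algebra_simps smult_add_right smult_diff_right)
  moreover have "degree (smult a (r * r) + s') \<le> 2 * (degree p - 1)"
  proof (rule degree_add_le)
    have "degree (smult a (r * r)) \<le> degree (r * r)" by (rule degree_smult_le)
    also have "\<dots> \<le> degree r + degree r" by (rule degree_mult_le)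
    finally show "degree (smult a (r * r)) \<le> 2 * (degree p - 1)" using deg by simp
  qed (rule s')
  moreover have "\<forall>x. 0 \<le> poly (smult a (r * r) + s') x" using s'(2) step(1) by simp
  ultimately show ?case by metis
qed

lemmas Rep_rclosure_simps = zero_rclosure.rep_eq one_rclosure.rep_eq plus_rclosure.rep_eq times_rclosure.rep_eq

lemma ring_map_Rep_rclosure: "ring_map Rep_rclosure"
  by (simp add: ring_map_def Rep_rclosure_simps)

lemma nonneg_rclosure_iff: "0 \<le> x \<longleftrightarrow> Rep_rclosure x \<in> wit_order"
  by (simp add: less_eq_rclosure.rep_eq zero_rclosure.rep_eq)

lemma Rep_rclosure_eq_0_iff: "Rep_rclosure x = 0 \<longleftrightarrow> x = 0"
  by (metis Rep_rclosure_inject zero_rclosure.rep_eq)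

text \<open>A minimal counterexample \<open>p\<close> is irreducible. Adjoin a root: if the cone of weighted squares of the
  extension contained \<open>- 1\<close>, then \<open>1 + s = p r\<close> with \<open>s \<ge> 0\<close> and \<open>r\<close> a smaller counterexample. So by
  maximality the root already lies in the real closure.\<close>

theorem rclosure_root_between:
  fixes p :: "'v rclosure poly"
  assumes "a < b" "poly p a * poly p b < 0"
  shows "\<exists>c>a. c < b \<and> poly p c = 0"
  using assms
proof (induction "degree p" arbitrary: p rule: less_induct)
  case less
  show ?case
  proof (rule ccontr)
    assume nr: "\<not> ?thesis"
    have p0: "p \<noteq> 0" using less.prems by auto
    have dp: "0 < degree p"
    proof (rule ccontr)
      assume "\<not> 0 < degree p"
      then obtain k where "p = [:k:]" by (auto elim: degree_eq_zeroE)
      then show False using less.prems by (simp add: not_square_less_zero)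
    qed
    \<comment> \<open>In a proper factorization one factor changes sign between a and b; it has
      smaller degree, so by induction it has a root there.\<close>
    have irr: "degree u = 0 \<or> degree v = 0" if uv: "p = u * v" for u v
    proof (rule ccontr)
      assume "\<not> ?thesis"
      moreover have "degree p = degree u + degree v" using p0 uv by (auto intro: degree_mult_eq)
      ultimately have "degree u < degree p" "degree v < degree p" by auto
      moreover have "poly u a * poly u b < 0 \<or> poly v a * poly v b < 0"
      proof (rule ccontr)
        assume "\<not> ?thesis"
        then have "0 \<le> (poly u a * poly u b) * (poly v a * poly v b)" by (simp add: not_less)
        then show False using less.prems(2) by (simp add: uv algebra_simps)
      qed
      ultimately obtain c where "a < c" "c < b" "poly u c = 0 \<or> poly v c = 0"
        using less.hyps less.prems(1) by blast
      then show False using nr uv by auto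
    qed
    have "degree (map_poly Rep_rclosure p) = degree p"
      by (rule degree_map_poly) (simp_all add: Rep_rclosure_eq_0_iff)
    then obtain \<alpha> where \<alpha>: "poly (map_poly Rep_rclosure p) \<alpha> = 0"
      using alg_closed_imp_poly_has_root[of "map_poly Rep_rclosure p"] dp by auto
    define E where "E = (\<lambda>q. poly (map_poly Rep_rclosure q) \<alpha>)"
    have E: "ring_map E" unfolding E_def by (rule ring_map_poly_map_poly[OF ring_map_Rep_rclosure])
    note ED = ring_mapD[OF E]
    have Ep: "E p = 0" using \<alpha> by (simp add: E_def)
    have ker: "p dvd q" if "E q = 0" for q
    proof (rule ccontr)
      assume "\<not> p dvd q"
      then obtain u v where "u * q + v * p = 1" using bezout_poly[OF p0 irr] by blast
      then have "E (u * q + v * p) = 1" by (simp add: ED)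
      then show False using that Ep by (simp add: ED)
    qed
    have inv: "\<exists>u. E u = inverse (E q)" for q
    proof (cases "E q = 0")
      case False
      then have "\<not> p dvd q" using Ep by (auto simp: dvd_def ED)
      then obtain u v where "u * q + v * p = 1" using bezout_poly[OF p0 irr] by blast
      then have "E (u * q + v * p) = 1" by (simp add: ED)
      then have "E u * E q = 1" using Ep by (simp add: ED)
      then show ?thesis using False by (intro exI[of _ u]) (simp add: field_simps)
    qed (intro exI[of _ 0], simp add: ED)
    define S where "S = E ` weighted_squares"
    have SI: "E s \<in> S" if "s \<in> weighted_squares" for s using that by (auto simp: S_def)
    have sq: "q * q \<in> weighted_squares" for q :: "'v rclosure poly"
      using weighted_squares_one[of 1 q] by simp
    have not_minus_one: "- 1 \<notin> S"
    proof
      assume "- 1 \<in> S"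
      then obtain s where s: "s \<in> weighted_squares" "E s = - 1" by (auto simp: S_def)
      obtain s' where s': "p dvd s - s'" "\<And>x. 0 \<le> poly s' x" "degree s' \<le> 2 * (degree p - 1)"
        using weighted_squares_reduce[OF s(1) dp] by blast
      have "E (1 + s) = 0" using s by (simp add: ED)
      then have "p dvd 1 + s" by (rule ker)
      from dvd_diff[OF this s'(1)] have "p dvd 1 + s'" by simp
      then obtain r where r: "1 + s' = p * r" by (auto simp: dvd_def)
      have pos: "0 < poly (1 + s') x" for x using s'(2)[of x] by (simp add: add_pos_nonneg)
      have "1 + s' \<noteq> 0" using pos by (metis less_irrefl poly_0)
      then have r0: "r \<noteq> 0" using r by auto
      have "degree p + degree r = degree (1 + s')" using r p0 r0 by (simp add: degree_mult_eq)
      also have "\<dots> \<le> 2 * (degree p - 1)" using s'(3) by (intro degree_add_le) auto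
      finally have "degree r < degree p" using dp by linarith
      \<comment> \<open>The product \<open>p * r\<close> is positive at both ends, so r changes sign
        together with p.\<close>
      moreover have "poly r a * poly r b < 0"
      proof -
        have "0 < (poly p a * poly r a) * (poly p b * poly r b)"
          using pos[of a] pos[of b] unfolding r poly_mult by (rule mult_pos_pos)
        then have "0 < (poly p a * poly p b) * (poly r a * poly r b)" by (simp add: algebra_simps)
        then show ?thesis using less.prems(2) zero_less_mult_pos less_asym
          unfolding zero_less_mult_iff[of "poly p a * poly p b"] by blast
      qed
      ultimately obtain c where "poly r c = 0" using less.hyps less.prems(1) by blast
      then show False using pos[of c] by (simp add: r del: poly_add)
    qed
    have "field_cone S" unfolding field_cone_def
    proof (intro conjI ballI)
      fix x y assume "x \<in> S" "y \<in> S"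
      then obtain s t where st: "s \<in> weighted_squares" "x = E s" "t \<in> weighted_squares" "y = E t"
        by (auto simp: S_def)
      show "x + y \<in> S" "x * y \<in> S" "(x - y) * (x - y) \<in> S"
        using SI[OF weighted_squares_add[OF st(1,3)]] SI[OF weighted_squares_mult[OF st(1,3)]] SI[OF sq[of "s - t"]]
        by (simp_all add: st ED)
    next
      fix x assume "x \<in> S"
      then obtain s where s: "s \<in> weighted_squares" "x = E s" by (auto simp: S_def)
      obtain u where u: "E u = inverse (E s)" using inv by blast
      have "E (s * (u * u)) = inverse x" by (cases "x = 0") (simp_all add: ED u s)
      then show "inverse x \<in> S" using SI[OF weighted_squares_mult[OF s(1) sq]] by metis
    next
      show "1 \<in> S" using SI[OF sq[of 1]] by (simp add: ED)
      show "- 1 \<notin> S" by (rule not_minus_one)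
    qed
    moreover have "wit_order \<subseteq> S"
    proof
      fix t :: "'v residue alg_closure" assume t: "t \<in> wit_order"
      define c where "c = Abs_rclosure t"
      have c: "Rep_rclosure c = t" unfolding c_def using t by (intro Abs_rclosure_inverse) auto
      then have "0 \<le> c" using t by (simp add: nonneg_rclosure_iff)
      then have "smult c (1 * 1) \<in> weighted_squares" by (rule weighted_squares_one)
      moreover have "E (smult c (1 * 1)) = t" by (simp add: E_def one_pCons map_poly_pCons c zero_rclosure.rep_eq)
      ultimately show "t \<in> S" using SI by metis
    qed
    ultimately have S: "S = wit_order" using wit_order(1) by (auto simp: maximal_cone_def)
    let ?x = "[:0, 1:] :: 'v rclosure poly"
    have "E ?x = \<alpha>" by (simp add: E_def map_poly_pCons Rep_rclosure_simps)
    \<comment> \<open>x = ((x + 1)/2)^2 - ((x - 1)/2)^2 writes the adjoined root as a difference of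
      two cone elements, which places it in the real closure.\<close>
    define u where "u = smult (1/4) ((?x + 1) * (?x + 1))"
    define v where "v = smult (1/4) ((?x - 1) * (?x - 1))"
    have "u - v = ?x" by (simp add: u_def v_def algebra_simps smult_diff_right smult_add_right one_pCons)
    moreover have "u \<in> weighted_squares" "v \<in> weighted_squares" unfolding u_def v_def
      by (rule weighted_squares_one, simp)+
    ultimately have "E u \<in> wit_order" "E v \<in> wit_order" "E u - E v = \<alpha>"
      using SI \<open>E ?x = \<alpha>\<close> by (auto simp: S simp flip: ED)
    then have "\<alpha> \<in> wit_order \<or> - \<alpha> \<in> wit_order" using wit_order_diff[of "E u" "E v"] by auto
    then obtain c where c: "Rep_rclosure c = \<alpha>" using Abs_rclosure_inverse by blast
    have "E [:- c, 1:] = 0"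
      by (simp add: E_def map_poly_pCons Rep_rclosure_simps uminus_rclosure.rep_eq c)
    then have "p dvd [:- c, 1:]" by (rule ker)
    then have "degree p \<le> degree [:- c, 1:]" by (rule dvd_imp_degree_le) simp
    then have "degree p = 1" using dp by simp
    from \<open>p dvd [:- c, 1:]\<close> obtain e where e: "[:- c, 1:] = p * e" by (auto simp: dvd_def)
    have "e \<noteq> 0" using e by auto
    then have "degree [:- c, 1:] = degree p + degree e" unfolding e using p0 by (simp add: degree_mult_eq)
    then have "degree e = 0" using \<open>degree p = 1\<close> by simp
    then obtain k where k: "e = [:k:]" by (rule degree_eq_zeroE)
    have "k \<noteq> 0" using \<open>e \<noteq> 0\<close> k by auto
    have pk: "x - c = poly p x * k" for x
      using arg_cong[OF e, of "\<lambda>q. poly q x"] by (simp add: k)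
    have "(a - c) * (b - c) = (poly p a * poly p b) * (k * k)" unfolding pk by (simp add: algebra_simps)
    also have "\<dots> < 0"
    proof (rule mult_neg_pos[OF less.prems(2)])
      show "0 < k * k" using \<open>k \<noteq> 0\<close> by (auto simp: zero_less_mult_iff)
    qed
    finally have "a < c" "c < b" using less.prems(1) by (auto simp: mult_less_0_iff)
    moreover have "poly p c = 0" using pk[of c] \<open>k \<noteq> 0\<close> by simp
    ultimately show False using nr by blast
  qed
qed

instance rclosure :: (type) rcf
proof
  fix a b :: "'a rclosure" and n :: nat and f :: "nat \<Rightarrow> 'a rclosure"
  assume h: "a < b" "(\<Sum>k\<le>n. f k * a ^ k) < 0" "0 < (\<Sum>k\<le>n. f k * b ^ k)"
  define p where "p = (\<Sum>k\<le>n. monom (f k) k)"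
  have p: "poly p x = (\<Sum>k\<le>n. f k * x ^ k)" for x by (simp add: p_def poly_sum poly_monom)
  show "\<exists>c>a. c < b \<and> (\<Sum>k\<le>n. f k * c ^ k) = 0"
    using rclosure_root_between[of a b p] h unfolding p by (simp add: mult_neg_pos)
qed

definition to_rclosure :: "'v mpoly \<Rightarrow> 'v rclosure" where
  "to_rclosure p = Abs_rclosure (to_ac_residue p)"

lemma to_ac_residue_in_order: "t \<in> wit_cone \<Longrightarrow> to_ac_residue t \<in> wit_order"
proof -
  assume t: "t \<in> wit_cone"
  have "to_ac_residue t / to_ac_residue (1 * 1) \<in> initial_cone"
    using t witI(5) unfolding initial_cone_def by blast
  then show ?thesis using wit_order(2) by (auto simp: acr)
qed

lemma Rep_to_rclosure: "Rep_rclosure (to_rclosure p) = to_ac_residue p"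
  unfolding to_rclosure_def
proof (rule Abs_rclosure_inverse)
  \<comment> \<open>Again p = ((p + 1)/2)^2 - ((p - 1)/2)^2: squares lie in \<open>wit_cone\<close>,
    and a difference of cone elements belongs to the typedef.\<close>
  define c :: "'a mpoly" where "c = mconst (1/2)"
  have c: "c * c + c * c + c * c + c * c = 1"
    by (simp add: c_def flip: mconst_mult mconst_add)
  have "(c * (p + 1)) * (c * (p + 1)) - (c * (p - 1)) * (c * (p - 1)) = (c * c + c * c + c * c + c * c) * p"
    by (simp add: algebra_simps)
  then have p: "(c * (p + 1)) * (c * (p + 1)) - (c * (p - 1)) * (c * (p - 1)) = p" by (simp only: c mult_1_left)
  have "to_ac_residue ((c * (p + 1)) * (c * (p + 1))) \<in> wit_order" "to_ac_residue ((c * (p - 1)) * (c * (p - 1))) \<in> wit_order"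
    by (rule to_ac_residue_in_order, rule preorderingD(3)[OF wit(2)])+
  from wit_order_diff[OF this] have "to_ac_residue p \<in> wit_order \<or> to_ac_residue (- p) \<in> wit_order"
    unfolding acr(6)[symmetric] p using p by (metis minus_diff_eq)
  then show "to_ac_residue p \<in> {x. x \<in> wit_order \<or> - x \<in> wit_order}" by (simp add: acr)
qed

lemma ring_map_to_rclosure: "ring_map to_rclosure"
  unfolding ring_map_def Rep_rclosure_inject[symmetric] Rep_rclosure_simps Rep_to_rclosure acr by simp

lemma to_rclosure_eq_0_iff: "to_rclosure p = 0 \<longleftrightarrow> p \<in> wit_ideal"
  unfolding Rep_rclosure_inject[symmetric] Rep_rclosure_simps Rep_to_rclosure to_ac_residue_eq_0_iff ..

lemma to_rclosure_nonneg: "t \<in> wit_cone \<Longrightarrow> 0 \<le> to_rclosure t"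
  unfolding nonneg_rclosure_iff Rep_to_rclosure by (rule to_ac_residue_in_order)

lemma has_points_witness: "has_points wit_ideal (wit_cone :: 'v::finite mpoly set)"
  unfolding has_points_def
proof (intro allI impI)
  fix G H :: "'v mpoly set" and d :: "'v mpoly"
  assume h: "finite G" "G \<subseteq> wit_cone" "finite H" "H \<subseteq> wit_ideal" "d \<notin> wit_ideal"
  then have "finite (insert d (G \<union> H))" by simp
  from artin_lang[OF ring_map_to_rclosure this]
  obtain x where x: "\<And>p. p \<in> insert d (G \<union> H) \<Longrightarrow> sg (meval x p) = sg (to_rclosure p)" by blast
  have "0 \<le> meval x p" if "p \<in> G" for p
    using x[of p] to_rclosure_nonneg[of p] that h(2) by (auto simp: sg_def split: if_splits)
  moreover have "meval x p = 0" if "p \<in> H" for p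
    using x[of p] to_rclosure_eq_0_iff[of p] that h(4) by (auto simp: sg_def split: if_splits)
  moreover have "meval x d \<noteq> 0"
    using x[of d] to_rclosure_eq_0_iff[of d] h(5) by (auto simp: sg_def split: if_splits)
  ultimately show "\<exists>x. (\<forall>p\<in>G. 0 \<le> meval x p) \<and> (\<forall>p\<in>H. meval x p = 0) \<and> meval x d \<noteq> 0" by blast
qed

subsection \<open>Extension of derivations\<close>

text \<open>Dual numbers \<open>a + b \<epsilon>\<close> with \<open>\<epsilon>\<^sup>2 = 0\<close>: a derivation \<open>d\<close> is the same thing as a subring
  \<open>{a + d a \<epsilon>}\<close>.\<close>

datatype 'a dual = Dual (dre: 'a) (dim: 'a)

instantiation dual :: (comm_ring_1) comm_ring_1
begin

definition "0 = Dual 0 0"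
definition "1 = Dual 1 0"
definition "x + y = Dual (dre x + dre y) (dim x + dim y)"
definition "x - y = Dual (dre x - dre y) (dim x - dim y)"
definition "- x = Dual (- dre x) (- dim x)"
definition "x * y = Dual (dre x * dre y) (dre x * dim y + dim x * dre y)"

instance
  by standard (simp_all add: zero_dual_def one_dual_def plus_dual_def minus_dual_def uminus_dual_def
    times_dual_def algebra_simps)

end

lemmas dual_defs = zero_dual_def one_dual_def plus_dual_def minus_dual_def uminus_dual_def times_dual_def

lemma ring_map_dre: "ring_map dre"
  by (simp add: ring_map_def dual_defs)

text \<open>The last clause is single-valuedness: two values at one point differ by an element over
  0. As a set of pairs, a partial derivation can be enlarged by Zorn's lemma.\<close>

definition derivation_graph :: "'a::field dual set \<Rightarrow> bool" where
  "derivation_graph G \<longleftrightarrow> 1 \<in> G \<and> (\<forall>x\<in>G. \<forall>y\<in>G. x + y \<in> G \<and> x * y \<in> G) \<and> (\<forall>x\<in>G. - x \<in> G) \<and>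
     (\<forall>w. Dual 0 w \<in> G \<longrightarrow> w = 0)"

lemma derivation_graphD:
  assumes "derivation_graph G"
  shows "1 \<in> G" "x \<in> G \<Longrightarrow> y \<in> G \<Longrightarrow> x + y \<in> G" "x \<in> G \<Longrightarrow> y \<in> G \<Longrightarrow> x * y \<in> G"
    "x \<in> G \<Longrightarrow> - x \<in> G" "Dual 0 w \<in> G \<Longrightarrow> w = 0" "0 \<in> G" "x \<in> G \<Longrightarrow> y \<in> G \<Longrightarrow> x - y \<in> G"
    "x \<in> G \<Longrightarrow> x ^ n \<in> G" "of_nat n \<in> G" "x \<in> G \<Longrightarrow> dre x = 0 \<Longrightarrow> x = 0"
proof -
  have r: "1 \<in> G" "\<And>x y. x \<in> G \<Longrightarrow> y \<in> G \<Longrightarrow> x + y \<in> G" "\<And>x y. x \<in> G \<Longrightarrow> y \<in> G \<Longrightarrow> x * y \<in> G"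
    "\<And>x. x \<in> G \<Longrightarrow> - x \<in> G" "\<And>w. Dual 0 w \<in> G \<Longrightarrow> w = 0"
    using assms by (simp_all add: derivation_graph_def)
  show "1 \<in> G" by (rule r)
  show "x \<in> G \<Longrightarrow> y \<in> G \<Longrightarrow> x + y \<in> G" by (rule r)
  show "x \<in> G \<Longrightarrow> y \<in> G \<Longrightarrow> x * y \<in> G" by (rule r)
  show "x \<in> G \<Longrightarrow> - x \<in> G" by (rule r)
  show "Dual 0 w \<in> G \<Longrightarrow> w = 0" by (rule r)
  show z: "0 \<in> G" using r(2)[OF r(1) r(4)[OF r(1)]] by simp
  show "x \<in> G \<Longrightarrow> y \<in> G \<Longrightarrow> x - y \<in> G" using r(2)[of x "- y"] r(4)[of y] by simp
  show "x \<in> G \<Longrightarrow> x ^ n \<in> G" by (induction n) (auto intro: r)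
  show "of_nat n \<in> G" by (induction n) (auto intro: r z)
  show "x \<in> G \<Longrightarrow> dre x = 0 \<Longrightarrow> x = 0" using r(5)[of "dim x"] by (cases x) (auto simp: zero_dual_def)
qed

lemma derivation_graph_sum:
  assumes "derivation_graph G" "\<And>i. i \<in> A \<Longrightarrow> f i \<in> G"
  shows "sum f A \<in> G"
  using assms(2) by (induction A rule: infinite_finite_induct) (simp_all add: derivation_graphD(2,6)[OF assms(1)])

lemma maximal_derivation_graph:
  assumes "derivation_graph G"
  shows "\<exists>M. derivation_graph M \<and> G \<subseteq> M \<and> (\<forall>N. derivation_graph N \<longrightarrow> M \<subseteq> N \<longrightarrow> N = M)"
proof -
  let ?A = "{N. derivation_graph N \<and> G \<subseteq> N}"
  have "\<exists>U\<in>?A. \<forall>N\<in>C. N \<subseteq> U" if C: "subset.chain ?A C" for C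
  proof (cases "C = {}")
    case False
    have CA: "C \<subseteq> ?A" and chain: "\<And>U V. U \<in> C \<Longrightarrow> V \<in> C \<Longrightarrow> U \<subseteq> V \<or> V \<subseteq> U"
      using C by (simp_all add: subset_chain_def)
    have CD: "derivation_graph N" "G \<subseteq> N" if "N \<in> C" for N using subsetD[OF CA that] by simp_all
    have two: "\<exists>N\<in>C. s \<in> N \<and> t \<in> N" if s: "s \<in> \<Union>C" and t: "t \<in> \<Union>C" for s t
    proof -
      obtain N N' where "N \<in> C" "N' \<in> C" "s \<in> N" "t \<in> N'" using s t by blast
      note N = this
      have "N \<subseteq> N' \<or> N' \<subseteq> N" using chain N(1,2) by blast
      then show ?thesis using N by blast
    qed
    obtain N where N: "N \<in> C" using False by blast
    have "derivation_graph (\<Union>C)" unfolding derivation_graph_def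
    proof (intro conjI ballI allI impI)
      show "1 \<in> \<Union>C" using N derivation_graphD(1)[OF CD(1)] by blast
    next
      fix s t assume st: "s \<in> \<Union>C" "t \<in> \<Union>C"
      then obtain N where N: "N \<in> C" "s \<in> N" "t \<in> N" using two by blast
      note D = derivation_graphD[OF CD(1)[OF N(1)]]
      show "s + t \<in> \<Union>C" using D(2)[OF N(2,3)] N(1) by blast
      show "s * t \<in> \<Union>C" using D(3)[OF N(2,3)] N(1) by blast
    next
      fix s assume "s \<in> \<Union>C"
      then show "- s \<in> \<Union>C" using derivation_graphD(4)[OF CD(1)] by blast
    next
      fix w assume "Dual 0 w \<in> \<Union>C"
      then show "w = 0" using derivation_graphD(5)[OF CD(1)] by blast
    qed
    moreover have "G \<subseteq> \<Union>C" using N CD(2) by blast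
    ultimately show ?thesis by blast
  qed (use assms in blast)
  from subset_Zorn[OF this] obtain M where "M \<in> ?A" "\<forall>U\<in>?A. M \<subseteq> U \<longrightarrow> U = M" by blast
  then have "derivation_graph M" "G \<subseteq> M" "\<And>U. derivation_graph U \<Longrightarrow> M \<subseteq> U \<Longrightarrow> U = M" by blast+
  then show ?thesis by blast
qed

text \<open>Dual numbers have zero divisors, so the divisor has to be monic; the coefficients of the
  remainder stay in the subring \<open>G\<close>.\<close>

lemma monic_division:
  fixes p q :: "'a::comm_ring_1 poly"
  assumes G: "\<And>x y. x \<in> G \<Longrightarrow> y \<in> G \<Longrightarrow> x * y \<in> G" "\<And>x y. x \<in> G \<Longrightarrow> y \<in> G \<Longrightarrow> x - y \<in> G" "0 \<in> G"
    and p: "\<And>i. coeff p i \<in> G" "lead_coeff p = 1" "0 < degree p" and q: "\<And>i. coeff q i \<in> G"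
  shows "\<exists>s r. q = p * s + r \<and> (\<forall>i. coeff r i \<in> G) \<and> degree r < degree p"
  using q
proof (induction "degree q" arbitrary: q rule: less_induct)
  case less
  show ?case
  proof (cases "degree q < degree p")
    case True
    then show ?thesis using less.prems by (intro exI[of _ 0] exI[of _ q]) auto
  next
    case False
    define t where "t = monom (lead_coeff q) (degree q - degree p)"
    define q' where "q' = q - p * t"
    have ct: "coeff (p * t) i = (if i < degree q - degree p then 0 else lead_coeff q * coeff p (i - (degree q - degree p)))" for i
      by (simp add: t_def mult.commute[of p] coeff_monom_mult)
    have "coeff q' i \<in> G" for i using less.prems G p(1) by (simp add: q'_def ct)
    moreover have "degree q' < degree q"
    proof -
      have "degree q' \<le> degree q - 1"
      proof (rule degree_le, intro allI impI)
        fix k assume "degree q - 1 < k"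
        then have k: "degree q \<le> k" by simp
        show "coeff q' k = 0"
        proof (cases "k = degree q")
          case True
          then show ?thesis using False p(2) by (simp add: q'_def ct)
        next
          case F2: False
          then have "coeff q k = 0" "coeff p (k - (degree q - degree p)) = 0"
            using k False by (auto intro!: coeff_eq_0)
          then show ?thesis by (simp add: q'_def ct)
        qed
      qed
      then show ?thesis using False p(3) by linarith
    qed
    ultimately obtain s r where "q' = p * s + r" "\<forall>i. coeff r i \<in> G" "degree r < degree p"
      using less.hyps by blast
    then have "q = p * (s + t) + r" "\<forall>i. coeff r i \<in> G" "degree r < degree p"
      by (simp_all add: q'_def algebra_simps)
    then show ?thesis by blast
  qed
qed

text \<open>The statement is made for arbitrary commutative rings since it is applied over the dual
  numbers, where \<open>\<epsilon>\<^sup>2 = 0\<close>.\<close>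

lemma formal_derivative_exists:
  fixes p :: "'a::comm_ring_1 poly"
  shows "\<exists>p'. \<forall>n. coeff p' n = of_nat (Suc n) * coeff p (Suc n)"
proof (induction p)
  case 0
  show ?case by (intro exI[of _ 0]) simp
next
  case (pCons a p)
  then obtain p' where "\<forall>n. coeff p' n = of_nat (Suc n) * coeff p (Suc n)" by blast
  then have "coeff (p + pCons 0 p') n = of_nat (Suc n) * coeff (pCons a p) (Suc n)" for n
    by (cases n) (simp_all add: algebra_simps)
  then show ?case by blast
qed

text \<open>Taylor expansion to first order in \<epsilon>: the increment sees only the real parts of
  the coefficients.\<close>

lemma poly_Dual:
  fixes p :: "'a::field dual poly"
  shows "poly p (Dual \<alpha> u) = poly p (Dual \<alpha> 0) + Dual 0 (u * poly (pderiv (map_poly dre p)) \<alpha>)"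
proof (induction p)
  case (pCons a p)
  have re: "dre (poly p (Dual \<alpha> 0)) = poly (map_poly dre p) \<alpha>" for p
  proof (induction p)
    case (pCons a p)
    then show ?case by (simp add: map_poly_pCons dual_defs)
  qed (simp add: dual_defs)
  have "poly (pCons a p) (Dual \<alpha> u) = a + Dual \<alpha> u * (poly p (Dual \<alpha> 0) + Dual 0 (u * poly (pderiv (map_poly dre p)) \<alpha>))"
    using pCons by simp
  also have "\<dots> = poly (pCons a p) (Dual \<alpha> 0) + Dual 0 (u * poly (pderiv (map_poly dre (pCons a p))) \<alpha>)"
    by (simp add: map_poly_pCons pderiv_pCons dual_defs re algebra_simps)
  finally show ?case .
qed (simp add: dual_defs)

text \<open>A maximal graph is closed under inverses because the localization \<open>N\<close> of
  \<open>M\<close> at g is again a graph: multiplying an element over 0 by a power of g brings it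
  back into \<open>M\<close>.\<close>

lemma derivation_graph_inverse:
  assumes M: "derivation_graph M" and max: "\<And>N. derivation_graph N \<Longrightarrow> M \<subseteq> N \<Longrightarrow> N = M"
    and g: "g \<in> M" "dre g \<noteq> 0"
  shows "\<exists>h\<in>M. g * h = 1"
proof -
  note D = derivation_graphD[OF M]
  \<comment> \<open>The \<epsilon>-part is the quotient rule - g' / g^2.\<close>
  define h where "h = Dual (inverse (dre g)) (- dim g * inverse (dre g) * inverse (dre g))"
  have gh: "g * h = 1" using g(2) by (simp add: h_def dual_defs)
  have ghn: "g ^ n * h ^ n = 1" for n using gh by (metis power_mult_distrib power_one)
  define N where "N = {p * h ^ n | p n. p \<in> M}"
  have NI: "p * h ^ n \<in> N" if "p \<in> M" for p n using that by (auto simp: N_def)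
  have "derivation_graph N" unfolding derivation_graph_def
  proof (intro conjI ballI allI impI)
    show "1 \<in> N" using NI[OF D(1), of 0] by simp
  next
    fix x y assume "x \<in> N" "y \<in> N"
    then obtain p m q n where x: "x = p * h ^ m" "p \<in> M" and y: "y = q * h ^ n" "q \<in> M" by (auto simp: N_def)
    have "x + y = p * h ^ m * (g ^ n * h ^ n) + q * h ^ n * (g ^ m * h ^ m)" by (simp add: x y ghn)
    also have "\<dots> = (p * g ^ n + q * g ^ m) * h ^ (m + n)" by (simp add: algebra_simps power_add)
    finally show "x + y \<in> N" using NI D x y g(1) by metis
    have "x * y = (p * q) * h ^ (m + n)" by (simp add: x y algebra_simps power_add)
    then show "x * y \<in> N" using NI D x y by metis
  next
    fix x assume "x \<in> N"
    then obtain p m where x: "x = p * h ^ m" "p \<in> M" by (auto simp: N_def)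
    then have "- x = (- p) * h ^ m" by simp
    then show "- x \<in> N" using NI D x by metis
  next
    fix w assume "Dual 0 w \<in> N"
    then obtain p m where x: "Dual 0 w = p * h ^ m" "p \<in> M" by (auto simp: N_def)
    then have "Dual 0 w * g ^ m = p * (g ^ m * h ^ m)" by (simp add: algebra_simps)
    then have p: "Dual 0 w * g ^ m = p" by (simp add: ghn)
    have "Dual 0 w * g ^ m = Dual 0 (w * dre g ^ m)"
      by (simp add: times_dual_def ring_mapD(7)[OF ring_map_dre])
    then have "w * dre g ^ m = 0" using D(5) x(2) p by metis
    then show "w = 0" using g(2) by simp
  qed
  moreover have "M \<subseteq> N" using NI[of _ 0] by fastforce
  ultimately have "N = M" by (rule max)
  moreover have "h \<in> N" using NI[OF D(1), of 1] by simp
  ultimately show ?thesis using gh by blast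
qed

text \<open>If \<open>\<alpha>\<close> is algebraic over the domain of \<open>M\<close>, the minimal polynomial dictates the value at \<open>\<alpha>\<close>; otherwise
  every value is possible.\<close>

lemma derivation_graph_total:
  fixes M :: "'a::field dual set"
  assumes M: "derivation_graph M" and max: "\<And>N. derivation_graph N \<Longrightarrow> M \<subseteq> N \<Longrightarrow> N = M"
    and char0: "\<And>n. n \<noteq> 0 \<Longrightarrow> of_nat n \<noteq> (0 :: 'a)"
  shows "\<exists>u. Dual \<alpha> u \<in> M"
proof -
  note D = derivation_graphD[OF M]
  let ?over = "\<lambda>q. \<forall>i. coeff q i \<in> M"
  have re: "dre (poly q (Dual \<alpha> u)) = poly (map_poly dre q) \<alpha>" for q u
  proof (induction q)
    case (pCons a p)
    then show ?case by (simp add: map_poly_pCons dual_defs)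
  qed (simp add: dual_defs)
  have dre0: "dre 0 = (0 :: 'a)" by (simp add: zero_dual_def)
  have inj: "q = 0" if "?over q" "map_poly dre q = 0" for q
  proof (rule poly_eqI)
    fix i
    have "coeff (map_poly dre q) i = 0" using that(2) by simp
    then have "dre (coeff q i) = 0" by (simp add: coeff_map_poly dre0)
    then show "coeff q i = coeff 0 i" using D(10) that(1) by simp
  qed
  \<comment> \<open>The wanted u is a value at \<alpha> for which adjoining
    \<open>Dual \<alpha> u\<close> keeps the graph single-valued.\<close>
  have "\<exists>u. \<forall>q. ?over q \<longrightarrow> (\<forall>w. poly q (Dual \<alpha> u) = Dual 0 w \<longrightarrow> w = 0)"
  proof (cases "\<exists>q. ?over q \<and> q \<noteq> 0 \<and> poly (map_poly dre q) \<alpha> = 0")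
    case False
    have "w = 0" if "?over q" "poly q (Dual \<alpha> 0) = Dual 0 w" for q w
    proof -
      have "poly (map_poly dre q) \<alpha> = 0" using re[of q 0] that(2) by simp
      then have "q = 0" using False that(1) by blast
      then show ?thesis using that(2) by (simp add: zero_dual_def)
    qed
    then show ?thesis by blast
  next
    case True
    then obtain p0 where p0: "?over p0" "p0 \<noteq> 0" "poly (map_poly dre p0) \<alpha> = 0"
      and least: "\<And>q. ?over q \<Longrightarrow> q \<noteq> 0 \<Longrightarrow> poly (map_poly dre q) \<alpha> = 0 \<Longrightarrow> degree p0 \<le> degree q"
      using ex_has_least_nat[of "\<lambda>q. ?over q \<and> q \<noteq> 0 \<and> poly (map_poly dre q) \<alpha> = 0" _ degree] by metis
    have "lead_coeff p0 \<in> M" "lead_coeff p0 \<noteq> 0" using p0 by auto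
    then have "dre (lead_coeff p0) \<noteq> 0" using D(10) by blast
    then obtain h where h: "h \<in> M" "lead_coeff p0 * h = 1"
      using derivation_graph_inverse[OF M max \<open>lead_coeff p0 \<in> M\<close>] by blast
    define p where "p = smult h p0"
    have "degree p \<le> degree p0" unfolding p_def by (rule degree_smult_le)
    moreover have cm: "coeff p (degree p0) = 1" using h by (simp add: p_def mult.commute)
    ultimately have deg: "degree p = degree p0" by (metis le_antisym le_degree zero_neq_one)
    have over: "coeff p i \<in> M" for i using p0 h D(3) by (simp add: p_def)
    have monic: "lead_coeff p = 1" using cm deg by simp
    have root: "poly (map_poly dre p) \<alpha> = 0"
    proof -
      have "map_poly dre p = smult (dre h) (map_poly dre p0)"
        by (intro poly_eqI) (simp add: p_def coeff_map_poly dre0 ring_mapD[OF ring_map_dre])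
      then show ?thesis using p0 by simp
    qed
    have small: "r = 0" if "?over r" "degree r < degree p" "poly (map_poly dre r) \<alpha> = 0" for r
      using least[of r] that deg by fastforce
    have dp: "0 < degree p"
    proof (rule ccontr)
      assume "\<not> 0 < degree p"
      then obtain k where "p = [:k:]" by (auto elim: degree_eq_zeroE)
      then have "p = 1" using monic by (simp add: one_pCons)
      then show False using root by (simp add: ring_mapD[OF ring_map_dre])
    qed
    define f where "f = poly (pderiv (map_poly dre p)) \<alpha>"
    obtain p' where p': "\<And>n. coeff p' n = of_nat (Suc n) * coeff p (Suc n)"
      using formal_derivative_exists by blast
    have dnat: "dre (of_nat k) = (of_nat k :: 'a)" for k by (induction k) (simp_all add: dual_defs)
    have pd: "map_poly dre p' = pderiv (map_poly dre p)"
      by (intro poly_eqI)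
         (simp add: coeff_map_poly coeff_pderiv p' dre0 ring_mapD(4)[OF ring_map_dre] dnat del: of_nat_Suc)
    \<comment> \<open>Separability: the derivative of a monic polynomial of minimal degree is
      nonzero in characteristic 0 and has smaller degree, so it cannot vanish at \<alpha>.\<close>
    have f: "f \<noteq> 0"
    proof
      assume "f = 0"
      then have r: "poly (map_poly dre p') \<alpha> = 0" by (simp add: f_def pd)
      have o: "?over p'"
      proof
        fix i
        show "coeff p' i \<in> M" unfolding p' by (rule D(3)[OF D(9) over])
      qed
      obtain n where n: "degree p = Suc n" using dp by (cases "degree p") auto
      have "degree p' \<le> n"
        by (rule degree_le) (auto simp: p' coeff_eq_0 n)
      then have "degree p' < degree p" using n by simp
      then have "p' = 0" using small o r by blast
      then have "coeff p' n = 0" by simp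
      then have "of_nat (Suc n) = (0 :: 'a dual)" using monic n by (simp add: p' del: of_nat_Suc)
      then have "dre (of_nat (Suc n) :: 'a dual) = 0" by (simp only: dre0)
      then show False using char0[of "Suc n"] unfolding dnat by simp
    qed
    \<comment> \<open>The solution of the equation that makes the \<epsilon>-part of p at
      \<open>Dual \<alpha> u\<close> vanish, by \<open>poly_Dual\<close>.\<close>
    define u where "u = - dim (poly p (Dual \<alpha> 0)) / f"
    have "dim (poly p (Dual \<alpha> 0)) + u * f = 0" using f by (simp add: u_def)
    moreover have "dre (poly p (Dual \<alpha> 0)) = 0" using re root by simp
    ultimately have p_zero: "poly p (Dual \<alpha> u) = 0"
      unfolding poly_Dual[of p \<alpha> u] f_def[symmetric] by (simp add: dual_defs)
    have "w = 0" if q: "?over q" "poly q (Dual \<alpha> u) = Dual 0 w" for q w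
    proof -
      obtain s r where sr: "q = p * s + r" "?over r" "degree r < degree p"
        using monic_division[of M p q] D(3,7,6) over monic dp q(1) by blast
      have qr: "poly q (Dual \<alpha> u) = poly r (Dual \<alpha> u)" using p_zero by (simp add: sr(1))
      then have "dre (poly r (Dual \<alpha> u)) = 0" using q(2) by (metis dual.sel(1))
      then have "poly (map_poly dre r) \<alpha> = 0" using re[of r u] by simp
      then have "r = 0" using small sr by blast
      then show ?thesis using qr q(2) by (simp add: zero_dual_def)
    qed
    then show ?thesis by blast
  qed
  then obtain u where u: "\<And>q w. ?over q \<Longrightarrow> poly q (Dual \<alpha> u) = Dual 0 w \<Longrightarrow> w = 0" by blast
  define N where "N = (\<lambda>q. poly q (Dual \<alpha> u)) ` {q. ?over q}"
  have NI: "poly q (Dual \<alpha> u) \<in> N" if "?over q" for q using that by (auto simp: N_def)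
  have "derivation_graph N" unfolding derivation_graph_def
  proof (intro conjI ballI allI impI)
    have "?over 1" using D(1,6) by (simp add: coeff_1)
    from NI[OF this] show "1 \<in> N" by simp
  next
    fix x y assume "x \<in> N" "y \<in> N"
    then obtain p q where pq: "?over p" "x = poly p (Dual \<alpha> u)" "?over q" "y = poly q (Dual \<alpha> u)" by (auto simp: N_def)
    have "?over (p + q)" using pq D(2) by simp
    from NI[OF this] show "x + y \<in> N" by (simp add: pq)
    have "?over (p * q)" using pq by (auto simp: coeff_mult intro!: derivation_graph_sum[OF M] D(3))
    from NI[OF this] show "x * y \<in> N" by (simp add: pq)
  next
    fix x assume "x \<in> N"
    then obtain p where p: "?over p" "x = poly p (Dual \<alpha> u)" by (auto simp: N_def)
    have "?over (- p)" using p D(4) by simp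
    from NI[OF this] show "- x \<in> N" by (simp add: p)
  next
    fix w assume "Dual 0 w \<in> N"
    then obtain q where "?over q" "poly q (Dual \<alpha> u) = Dual 0 w" by (auto simp: N_def)
    then show "w = 0" by (rule u)
  qed
  moreover have "M \<subseteq> N"
  proof
    fix c assume "c \<in> M"
    then have "?over [:c:]" using D(6) by (simp add: coeff_pCons split: nat.split)
    from NI[OF this] show "c \<in> N" by simp
  qed
  ultimately have "N = M" by (rule max)
  moreover have "?over [:0, 1:]" using D(1,6) by (simp add: coeff_pCons split: nat.split)
  from NI[OF this] have "Dual \<alpha> u \<in> N" by simp
  ultimately show ?thesis by blast
qed

theorem derivation_extension:
  fixes G :: "'a::field dual set"
  assumes G: "derivation_graph G" and char0: "\<And>n. n \<noteq> 0 \<Longrightarrow> of_nat n \<noteq> (0 :: 'a)"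
  shows "\<exists>d. (\<forall>x y. d (x + y) = d x + d y) \<and> (\<forall>x y. d (x * y) = d x * y + x * d y) \<and>
    (\<forall>x y. Dual x y \<in> G \<longrightarrow> d x = y)"
proof -
  obtain M where M: "derivation_graph M" "G \<subseteq> M" "\<And>N. derivation_graph N \<Longrightarrow> M \<subseteq> N \<Longrightarrow> N = M"
    using maximal_derivation_graph[OF G] by blast
  note D = derivation_graphD[OF M(1)]
  have "\<forall>x. \<exists>u. Dual x u \<in> M" using derivation_graph_total[OF M(1,3) char0] by blast
  then obtain d where d: "\<And>x. Dual x (d x) \<in> M" by metis
  have uniq: "u = v" if "Dual x u \<in> M" "Dual x v \<in> M" for x u v
  proof -
    have "Dual x u - Dual x v = Dual 0 (u - v)" by (simp add: minus_dual_def)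
    then have "u - v = 0" using D(5,7) that by metis
    then show ?thesis by simp
  qed
  have "d (x + y) = d x + d y" for x y
    using uniq[OF d] D(2)[OF d[of x] d[of y]] by (simp add: plus_dual_def)
  moreover have "d (x * y) = d x * y + x * d y" for x y
    using uniq[OF d] D(3)[OF d[of x] d[of y]] by (simp add: times_dual_def add.commute)
  moreover have "d x = y" if "Dual x y \<in> G" for x y using uniq[OF d] M(2) that by blast
  ultimately show ?thesis by blast
qed

lemma ring_map_real_poly_at: "ring_map (\<lambda>w. real_poly_at w f)"
  unfolding real_poly_at_def by (rule ring_map_poly_map_poly[OF ring_map_mconst])

lemma real_poly_at_simps: "real_poly_at [:c:] f = mconst c" "real_poly_at [:0, 1:] f = f"
  by (simp_all add: real_poly_at_def map_poly_pCons)

lemma mconst_notin_prime: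
  assumes "prime_ideal_set I" "c \<noteq> 0"
  shows "mconst c \<notin> I"
proof
  assume "mconst c \<in> I"
  then have "mconst c * mconst (inverse c) \<in> I" by (rule prime_ideal_setD(3)[OF assms(1)])
  then show False using assms(2) prime_ideal_setD(5)[OF assms(1)] by (simp flip: mconst_mult)
qed

text \<open>On the subring of real polynomials in f, formal differentiation is well defined modulo
  the ideal because f is transcendental. It extends to the residue field, where only its values at
  the variables matter.\<close>

lemma has_derivations_witness: "has_derivations (wit_ideal :: 'v::finite mpoly set)"
  unfolding has_derivations_def
proof (intro allI impI)
  fix f :: "'v mpoly"
  assume tr: "\<forall>w. real_poly_at w f \<in> wit_ideal \<longrightarrow> w = 0"
  note R = ring_mapD[OF ring_map_to_residue[where 'a = 'v]]
  define E where "E w = to_residue (real_poly_at w f)" for w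
  have E: "ring_map E" unfolding E_def by (rule ring_map_comp[OF ring_map_to_residue ring_map_real_poly_at])
  note ED = ring_mapD[OF E]
  define G where "G = {Dual (E w) (E (pderiv w)) | w. True}"
  have GI: "Dual (E w) (E (pderiv w)) \<in> G" for w by (auto simp: G_def)
  have "derivation_graph G" unfolding derivation_graph_def
  proof (intro conjI ballI allI impI)
    show "1 \<in> G" using GI[of 1] by (simp add: ED one_dual_def)
  next
    fix x y assume "x \<in> G" "y \<in> G"
    then obtain v w where x: "x = Dual (E v) (E (pderiv v))" and y: "y = Dual (E w) (E (pderiv w))"
      by (auto simp: G_def)
    show "x + y \<in> G" using GI[of "v + w"] by (simp add: x y ED pderiv_add plus_dual_def)
    have "x * y = Dual (E (v * w)) (E (pderiv (v * w)))"
      by (simp add: x y ED pderiv_mult times_dual_def algebra_simps)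
    then show "x * y \<in> G" using GI by simp
  next
    fix x assume "x \<in> G"
    then obtain v where x: "x = Dual (E v) (E (pderiv v))" by (auto simp: G_def)
    show "- x \<in> G" using GI[of "- v"] by (simp add: x ED pderiv_minus uminus_dual_def)
  next
    fix y assume "Dual 0 y \<in> G"
    then obtain w where w: "E w = 0" "y = E (pderiv w)" by (auto simp: G_def)
    then have "w = 0" using tr by (simp add: E_def to_residue_eq_0_iff)
    then show "y = 0" using w by (simp add: ED)
  qed
  moreover have "of_nat n \<noteq> (0 :: 'v residue)" if "n \<noteq> 0" for n
  proof
    assume "of_nat n = (0 :: 'v residue)"
    moreover have "to_residue (of_nat k) = (of_nat k :: 'v residue)" for k by (induction k) (simp_all add: R)
    moreover have "(of_nat k :: 'v mpoly) = mconst (of_nat k)" for k by (induction k) (simp_all add: mconst_add)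
    ultimately have "mconst (of_nat n) \<in> (wit_ideal :: 'v mpoly set)" by (metis to_residue_eq_0_iff)
    moreover have "mconst (of_nat n) \<notin> (wit_ideal :: 'v mpoly set)"
      by (rule mconst_notin_prime[OF wit(1)]) (use that in simp)
    ultimately show False by blast
  qed
  ultimately obtain d where d: "\<And>x y. d (x + y) = d x + d y" "\<And>x y. d (x * y) = d x * y + x * d y"
    "\<And>x y. Dual x y \<in> G \<Longrightarrow> d x = y"
    using derivation_extension[of G] by blast
  have dE: "d (E w) = E (pderiv w)" for w using d(3) GI by blast
  define \<delta> where "\<delta> p = d (to_residue p)" for p :: "'v mpoly"
  have "\<delta> (mconst c) = 0" for c
    using dE[of "[:c:]"] by (simp add: \<delta>_def E_def real_poly_at_simps pderiv_pCons ED[unfolded E_def])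
  then have chain: "\<delta> p = (\<Sum>i\<in>UNIV. to_residue (mderiv i p) * \<delta> (mvar i))" for p
    by (intro derivation_chain_rule[OF ring_map_to_residue]) (simp_all add: \<delta>_def R d)
  have "E (pderiv [:0, 1:]) = 1" using ED(2) by (simp add: pderiv_pCons one_pCons)
  then have \<delta>f: "\<delta> f = 1" using dE[of "[:0, 1:]"] by (simp add: \<delta>_def E_def real_poly_at_simps)
  have "\<forall>i. \<exists>n q. q \<notin> wit_ideal \<and> \<delta> (mvar i) = to_residue n / to_residue q"
    using residue_cases by metis
  then obtain n q where nq: "\<And>i. q i \<notin> wit_ideal" "\<And>i. \<delta> (mvar i) = to_residue (n i) / to_residue (q i)" by metis
  \<comment> \<open>A common denominator of the derivatives of the variables; it is not in the
    ideal, so multiplying by it loses nothing.\<close>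
  define Q where "Q = (\<Prod>i\<in>UNIV. q i)"
  define D where "D i = n i * (\<Prod>j\<in>UNIV - {i}. q j)" for i
  have q0: "to_residue (q i) \<noteq> 0" for i using nq(1) by (simp add: to_residue_eq_0_iff)
  have Q: "to_residue Q = (\<Prod>i\<in>UNIV. to_residue (q i))" by (simp add: Q_def ring_map_prod[OF ring_map_to_residue])
  then have Q0: "to_residue Q \<noteq> 0" using q0 by simp
  have DQ: "to_residue (D i) = to_residue Q * \<delta> (mvar i)" for i
  proof -
    have "to_residue Q = to_residue (q i) * (\<Prod>j\<in>UNIV - {i}. to_residue (q j))"
      unfolding Q by (rule prod.remove) auto
    then show ?thesis using q0[of i]
      by (simp add: D_def R nq(2) ring_map_prod[OF ring_map_to_residue])
  qed
  have key: "to_residue (\<Sum>i\<in>UNIV. D i * mderiv i p) = to_residue Q * \<delta> p" for p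
  proof -
    have "to_residue (\<Sum>i\<in>UNIV. D i * mderiv i p) = (\<Sum>i\<in>UNIV. to_residue Q * \<delta> (mvar i) * to_residue (mderiv i p))"
      by (simp add: ring_map_sum[OF ring_map_to_residue] R DQ)
    also have "\<dots> = to_residue Q * \<delta> p" unfolding chain[of p] sum_distrib_left by (intro sum.cong) (auto simp: ac_simps)
    finally show ?thesis .
  qed
  have "d 0 + d 0 = d 0 + 0" using d(1)[of 0 0] by (simp only: add_0_right)
  then have "d 0 = 0" by (rule add_left_imp_eq)
  then have \<delta>0: "\<delta> p = 0" if "p \<in> wit_ideal" for p
    using that to_residue_eq_0_iff[of p] by (simp add: \<delta>_def)
  have "(\<Sum>i\<in>UNIV. D i * mderiv i p) \<in> wit_ideal" if "p \<in> wit_ideal" for p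
  proof -
    have "to_residue (\<Sum>i\<in>UNIV. D i * mderiv i p) = 0" unfolding key \<delta>0[OF that] by simp
    then show ?thesis by (simp add: to_residue_eq_0_iff)
  qed
  moreover have "(\<Sum>i\<in>UNIV. D i * mderiv i f) \<notin> wit_ideal"
    unfolding to_residue_eq_0_iff[symmetric] key using Q0 \<delta>f by simp
  ultimately show "\<exists>D. (\<forall>p\<in>wit_ideal. (\<Sum>i\<in>UNIV. D i * mderiv i p) \<in> wit_ideal) \<and>
     (\<Sum>i\<in>UNIV. D i * mderiv i f) \<notin> wit_ideal" by blast
qed

text \<open>Back from the fixed types to arbitrary parameters: if any admissible pair failed,
  \<open>witness\<close> would fail too.\<close>

theorem real_prime_well_behaved:
  fixes I :: "'v::finite mpoly set"
  assumes "prime_ideal_set I" "preordering T" "real_over I T"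
  shows "has_points I T" "has_derivations I"
proof -
  have "well_behaved (witness :: 'v mpoly set \<times> 'v mpoly set)"
    using has_points_witness[where 'v = 'v] has_derivations_witness[where 'v = 'v]
    unfolding well_behaved_def wit_ideal_def wit_cone_def case_prod_beta by blast
  moreover have "admissible (I, T)" using assms by (simp add: admissible_def)
  ultimately have "well_behaved (I, T)" by (rule witness(2))
  then show "has_points I T" "has_derivations I" by (simp_all add: well_behaved_def)
qed

subsection \<open>Cones with prime support\<close>

text \<open>Separating the multipliers \<open>S\<close> from the cone \<open>Q\<close> treats
  preorderings and quadratic modules alike; \<open>Q\<close> itself need not be closed under
  products.\<close>

definition cone_module :: "'a::comm_ring_1 set \<Rightarrow> 'a set \<Rightarrow> bool" where
  "cone_module S Q \<longleftrightarrow> (\<forall>a\<in>Q. \<forall>b\<in>Q. a + b \<in> Q) \<and> (\<forall>s\<in>S. \<forall>a\<in>Q. s * a \<in> Q) \<and> 1 \<in> Q"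

definition cone_support :: "'a::comm_ring_1 set \<Rightarrow> 'a set" where
  "cone_support Q = {a. a \<in> Q \<and> - a \<in> Q}"

lemma cone_moduleD:
  assumes "preordering S" "cone_module S Q"
  shows "a \<in> Q \<Longrightarrow> b \<in> Q \<Longrightarrow> a + b \<in> Q" "s \<in> S \<Longrightarrow> a \<in> Q \<Longrightarrow> s * a \<in> Q" "1 \<in> Q"
    "s \<in> S \<Longrightarrow> s \<in> Q" "0 \<in> Q" "a * a \<in> Q"
proof -
  have r: "\<And>a b. a \<in> Q \<Longrightarrow> b \<in> Q \<Longrightarrow> a + b \<in> Q" "\<And>s a. s \<in> S \<Longrightarrow> a \<in> Q \<Longrightarrow> s * a \<in> Q" "1 \<in> Q"
    using assms(2) by (simp_all add: cone_module_def)
  have s: "s \<in> Q" if "s \<in> S" for s using r(2)[OF that r(3)] by simp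
  show "a \<in> Q \<Longrightarrow> b \<in> Q \<Longrightarrow> a + b \<in> Q" "s \<in> S \<Longrightarrow> a \<in> Q \<Longrightarrow> s * a \<in> Q" "1 \<in> Q" "s \<in> S \<Longrightarrow> s \<in> Q"
    by (fact r s)+
  show "0 \<in> Q" "a * a \<in> Q" using s preorderingD[OF assms(1)] by blast+
qed

lemma cone_support_ideal:
  fixes Q :: "'a::comm_ring_1 set"
  assumes S: "preordering S" and Q: "cone_module S Q" and h: "(h :: 'a) + h = 1"
  shows "0 \<in> cone_support Q" "a \<in> cone_support Q \<Longrightarrow> b \<in> cone_support Q \<Longrightarrow> a + b \<in> cone_support Q"
    "a \<in> cone_support Q \<Longrightarrow> - a \<in> cone_support Q" "a \<in> cone_support Q \<Longrightarrow> a * b \<in> cone_support Q"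
proof -
  note D = cone_moduleD[OF S Q]
  show "0 \<in> cone_support Q" using D(5) by (simp add: cone_support_def)
  have add: "a + b \<in> cone_support Q" if "a \<in> cone_support Q" "b \<in> cone_support Q" for a b
  proof -
    have "- (a + b) = - a + - b" by simp
    then show ?thesis using D(1)[of a b] D(1)[of "- a" "- b"] that unfolding cone_support_def by simp
  qed
  have neg: "- a \<in> cone_support Q" if "a \<in> cone_support Q" for a using that by (simp add: cone_support_def)
  have sq: "x * x * a \<in> cone_support Q" if "a \<in> cone_support Q" for a x
    using D(2)[OF preorderingD(3)[OF S, of x], of a] D(2)[OF preorderingD(3)[OF S, of x], of "- a"] that
    unfolding cone_support_def by simp
  show "a \<in> cone_support Q \<Longrightarrow> b \<in> cone_support Q \<Longrightarrow> a + b \<in> cone_support Q" by (rule add)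
  show "a \<in> cone_support Q \<Longrightarrow> - a \<in> cone_support Q" by (rule neg)
  show "a * b \<in> cone_support Q" if a: "a \<in> cone_support Q"
  proof -
    \<comment> \<open>With h = 1/2, b = x^2 - y^2. Only squares are known to multiply
      \<open>Q\<close> into itself, so a general b is reached through such a difference.\<close>
    define x where "x = h * (b + 1)"
    define y where "y = h * (b - 1)"
    have hb: "h * b + h * b = b" using h by (metis distrib_right mult_1_left)
    have "x + y = b" "x - y = 1" using h hb by (simp_all add: x_def y_def algebra_simps)
    then have "(x + y) * (x - y) = b" by simp
    then have "x * x - y * y = b" by (simp add: algebra_simps)
    then have "a * b = x * x * a + - (y * y * a)" by (simp add: algebra_simps flip: \<open>x * x - y * y = b\<close>)
    then show ?thesis using add[OF sq[OF a] neg[OF sq[OF a]]] by simp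
  qed
qed

lemma maximal_cone_module:
  assumes M: "cone_module S M" and W: "\<forall>w\<in>W. - (w * w) \<notin> M"
  shows "\<exists>Q. cone_module S Q \<and> M \<subseteq> Q \<and> (\<forall>w\<in>W. - (w * w) \<notin> Q) \<and>
    (\<forall>N. cone_module S N \<longrightarrow> Q \<subseteq> N \<longrightarrow> (\<forall>w\<in>W. - (w * w) \<notin> N) \<longrightarrow> N = Q)"
proof -
  let ?A = "{N. cone_module S N \<and> M \<subseteq> N \<and> (\<forall>w\<in>W. - (w * w) \<notin> N)}"
  have "\<exists>U\<in>?A. \<forall>N\<in>C. N \<subseteq> U" if C: "subset.chain ?A C" for C
  proof (cases "C = {}")
    case False
    have CA: "C \<subseteq> ?A" and chain: "\<And>U V. U \<in> C \<Longrightarrow> V \<in> C \<Longrightarrow> U \<subseteq> V \<or> V \<subseteq> U"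
      using C by (simp_all add: subset_chain_def)
    have CD: "cone_module S N" "M \<subseteq> N" "\<forall>w\<in>W. - (w * w) \<notin> N" if "N \<in> C" for N
      using subsetD[OF CA that] by simp_all
    have two: "\<exists>N\<in>C. s \<in> N \<and> t \<in> N" if s: "s \<in> \<Union>C" and t: "t \<in> \<Union>C" for s t
    proof -
      obtain N N' where "N \<in> C" "N' \<in> C" "s \<in> N" "t \<in> N'" using s t by blast
      note N = this
      have "N \<subseteq> N' \<or> N' \<subseteq> N" using chain N(1,2) by blast
      then show ?thesis using N by blast
    qed
    obtain N where N: "N \<in> C" using False by blast
    have "cone_module S (\<Union>C)" unfolding cone_module_def
    proof (intro conjI ballI)
      fix s t assume st: "s \<in> \<Union>C" "t \<in> \<Union>C"
      then obtain N where N: "N \<in> C" "s \<in> N" "t \<in> N" using two by blast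
      then have "s + t \<in> N" using CD(1)[OF N(1)] by (simp add: cone_module_def)
      then show "s + t \<in> \<Union>C" using N(1) by blast
    next
      fix s t assume s: "s \<in> S" and "t \<in> \<Union>C"
      then obtain N where N: "N \<in> C" "t \<in> N" by blast
      then have "s * t \<in> N" using CD(1)[OF N(1)] s by (simp add: cone_module_def)
      then show "s * t \<in> \<Union>C" using N(1) by blast
    next
      have "1 \<in> N" using CD(1)[OF N] by (simp add: cone_module_def)
      then show "1 \<in> \<Union>C" using N by blast
    qed
    moreover have "M \<subseteq> \<Union>C" using N CD(2) by blast
    moreover have "\<forall>w\<in>W. - (w * w) \<notin> \<Union>C" using CD(3) by blast
    ultimately show ?thesis by blast
  qed (use assms in blast)
  from subset_Zorn[OF this] obtain Q where "Q \<in> ?A" "\<forall>U\<in>?A. Q \<subseteq> U \<longrightarrow> U = Q" by blast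
  note Q = this
  have q: "cone_module S Q" "M \<subseteq> Q" "\<forall>w\<in>W. - (w * w) \<notin> Q" using Q(1) by simp_all
  have "N = Q" if "cone_module S N" "Q \<subseteq> N" "\<forall>w\<in>W. - (w * w) \<notin> N" for N
  proof -
    have "N \<in> ?A" using that q(2) by auto
    then show ?thesis using Q(2) that(2) by blast
  qed
  then show ?thesis using q by (intro exI[of _ Q]) simp
qed

text \<open>As squares lie in \<open>Q\<close>, the condition on \<open>- (w * w)\<close> says that
  \<open>w * w\<close> avoids the support. Totality and primality of a maximal \<open>Q\<close>
  follow by combining the obstructions \<open>ext\<close> to adjoining further elements, as in the
  usual argument for an ideal maximal with respect to avoiding a multiplicative set.\<close>

theorem prime_support_exists:
  fixes M :: "'a::comm_ring_1 set"
  assumes S: "preordering S" and M: "cone_module S M" and h: "(h :: 'a) + h = 1"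
    and W1: "1 \<in> W" and Wm': "\<forall>v\<in>W. \<forall>w\<in>W. v * w \<in> W" and W: "\<forall>w\<in>W. - (w * w) \<notin> M"
  shows "\<exists>Q. cone_module S Q \<and> M \<subseteq> Q \<and> (\<forall>a. a \<in> Q \<or> - a \<in> Q) \<and> prime_ideal_set (cone_support Q) \<and>
    real_over (cone_support Q) S \<and> cone_support Q \<inter> W = {}"
proof -
  have Wm: "v * w \<in> W" if "v \<in> W" "w \<in> W" for v w using Wm' that by blast
  from maximal_cone_module[OF M W]
  obtain Q where Q': "cone_module S Q \<and> M \<subseteq> Q \<and> (\<forall>w\<in>W. - (w * w) \<notin> Q) \<and>
    (\<forall>N. cone_module S N \<longrightarrow> Q \<subseteq> N \<longrightarrow> (\<forall>w\<in>W. - (w * w) \<notin> N) \<longrightarrow> N = Q)"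
    by (elim exE)
  have Q: "cone_module S Q" "M \<subseteq> Q" and QW: "\<And>w. w \<in> W \<Longrightarrow> - (w * w) \<notin> Q"
    and max: "\<And>N. cone_module S N \<Longrightarrow> Q \<subseteq> N \<Longrightarrow> (\<forall>w\<in>W. - (w * w) \<notin> N) \<Longrightarrow> N = Q"
    using Q' by simp_all
  note D = cone_moduleD[OF S Q(1)]
  note P = preorderingD[OF S]
  let ?I = "cone_support Q"
  note I = cone_support_ideal[OF S Q(1) h]
  have IQ: "a \<in> Q" "- a \<in> Q" if "a \<in> ?I" for a using that by (simp_all add: cone_support_def)
  have II: "a \<in> ?I" if "a \<in> Q" "- a \<in> Q" for a using that by (simp add: cone_support_def)
  \<comment> \<open>The module \<open>Q + S a\<close> is strictly larger than \<open>Q\<close>, so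
    by maximality it contains a forbidden element.\<close>
  have ext: "\<exists>w q s. w \<in> W \<and> q \<in> Q \<and> s \<in> S \<and> - (w * w) = q + s * a" if a: "a \<notin> Q" for a
  proof (rule ccontr)
    assume c: "\<not> ?thesis"
    define N where "N = {q + s * a | q s. q \<in> Q \<and> s \<in> S}"
    have NI: "q + s * a \<in> N" if "q \<in> Q" "s \<in> S" for q s using that by (auto simp: N_def)
    have "cone_module S N" unfolding cone_module_def
    proof (intro conjI ballI)
      fix x y assume "x \<in> N" "y \<in> N"
      then obtain q s q' s' where x: "x = q + s * a" "y = q' + s' * a" "q \<in> Q" "s \<in> S" "q' \<in> Q" "s' \<in> S"
        unfolding N_def by blast
      have e: "x + y = (q + q') + (s + s') * a" by (simp add: x algebra_simps)
      show "x + y \<in> N" unfolding e by (intro NI D(1) P(1) x)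
    next
      fix t x assume t: "t \<in> S" and "x \<in> N"
      then obtain q s where x: "x = q + s * a" "q \<in> Q" "s \<in> S" unfolding N_def by blast
      have e: "t * x = t * q + t * s * a" by (simp add: x algebra_simps)
      show "t * x \<in> N" unfolding e by (intro NI D(2) P(2) x t)
    next
      show "1 \<in> N" using NI[OF D(3) P(4)] by simp
    qed
    moreover have "Q \<subseteq> N"
    proof
      fix q assume "q \<in> Q"
      then show "q \<in> N" using NI[of q 0] P(4) by simp
    qed
    moreover have "\<forall>w\<in>W. - (w * w) \<notin> N"
    proof
      fix w assume "w \<in> W"
      then show "- (w * w) \<notin> N" using c unfolding N_def by blast
    qed
    ultimately have "N = Q" by (rule max)
    moreover have "a \<in> N" using NI[OF D(5) P(5)] by simp
    ultimately show False using a by simp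
  qed
  \<comment> \<open>Eliminating a from the two obstructions puts \<open>s * (w' * w')\<close> into
    the support. Its product with a may then be added freely, which turns the first obstruction,
    multiplied by \<open>w' * w'\<close>, into a forbidden element of \<open>Q\<close>.\<close>
  have total: "a \<in> Q \<or> - a \<in> Q" for a
  proof (rule ccontr)
    assume "\<not> ?thesis"
    then have "a \<notin> Q" "- a \<notin> Q" by simp_all
    obtain w q s where 1: "w \<in> W" "q \<in> Q" "s \<in> S" "- (w * w) = q + s * a" using ext[OF \<open>a \<notin> Q\<close>] by blast
    obtain w' q' s' where 2: "w' \<in> W" "q' \<in> Q" "s' \<in> S" "- (w' * w') = q' + s' * - a" using ext[OF \<open>- a \<notin> Q\<close>] by blast
    have e: "s' * (- (w * w)) + s * (- (w' * w')) = s' * q + s * q'"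
      unfolding 1(4) 2(4) by (simp add: algebra_simps)
    have e': "- (s * (w' * w')) = s' * q + s * q' + s' * (w * w)" unfolding e[symmetric] by simp
    have "- (s * (w' * w')) \<in> Q" unfolding e' by (intro D(1) D(2) 1 2 D(6))
    moreover have "s * (w' * w') \<in> Q" by (intro D(2) 1 D(6))
    ultimately have "s * (w' * w') \<in> ?I" by (simp add: II)
    then have i: "s * (w' * w') * a \<in> Q" using IQ(1)[OF I(4)] by simp
    have "- ((w * w') * (w * w')) = (w' * w') * (- (w * w))" by (simp add: algebra_simps)
    also have "\<dots> = (w' * w') * q + s * (w' * w') * a" unfolding 1(4) by (simp add: algebra_simps)
    also have "\<dots> \<in> Q" using D(1)[OF D(2)[OF P(3) 1(2)] i] .
    finally show False using QW[OF Wm[OF 1(1) 2(1)]] by simp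
  qed
  \<comment> \<open>From \<open>w * w + q = - (s * b)\<close> the square of the left side is in the
    support; adding 2 w^2 q + q^2 to its negative leaves \<open>- w^4\<close>.\<close>
  have radical: "a \<in> ?I" if aa: "a * a \<in> ?I" for a
  proof -
    have "b \<in> Q" if bb: "b * b \<in> ?I" for b
    proof (rule ccontr)
      assume "b \<notin> Q"
      then obtain w q s where 1: "w \<in> W" "q \<in> Q" "s \<in> S" "- (w * w) = q + s * b" using ext by blast
      have "w * w + (q + s * b) = 0" unfolding 1(4)[symmetric] by simp
      then have "(w * w + q) + s * b = 0" by (simp only: add.assoc)
      then have "w * w + q = - (s * b)" by (simp only: eq_neg_iff_add_eq_0)
      then have "(w * w + q) * (w * w + q) = b * b * (s * s)" by (simp add: algebra_simps)
      then have "- ((w * w + q) * (w * w + q)) \<in> Q" using IQ(2)[OF I(4)[OF bb]] by simp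
      then have "- ((w * w + q) * (w * w + q)) + ((w * w) * q + ((w * w) * q + q * q)) \<in> Q"
        by (intro D(1) D(2) 1 P(3) D(6))
      moreover have "- ((w * w + q) * (w * w + q)) + ((w * w) * q + ((w * w) * q + q * q)) = - ((w * w) * (w * w))"
        by (simp add: algebra_simps)
      ultimately show False using QW[OF Wm[OF 1(1) 1(1)]] by simp
    qed
    from this[OF aa] this[of "- a"] aa show ?thesis by (simp add: II)
  qed
  \<comment> \<open>Obstructions are taken for \<open>- a^2\<close> and \<open>- b^2\<close>; the
    cross term contains \<open>(a * b)^2\<close> and disappears in the support.\<close>
  have prime: "a \<in> ?I \<or> b \<in> ?I" if ab: "a * b \<in> ?I" for a b
  proof (rule ccontr)
    assume "\<not> ?thesis"
    then have "a * a \<notin> ?I" "b * b \<notin> ?I" using radical by blast+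
    then have "- (a * a) \<notin> Q" "- (b * b) \<notin> Q" using II D(6) by blast+
    obtain w q s where 1: "w \<in> W" "q \<in> Q" "s \<in> S" "- (w * w) = q + s * - (a * a)"
      using ext[OF \<open>- (a * a) \<notin> Q\<close>] by blast
    obtain w' q' s' where 2: "w' \<in> W" "q' \<in> Q" "s' \<in> S" "- (w' * w') = q' + s' * - (b * b)"
      using ext[OF \<open>- (b * b) \<notin> Q\<close>] by blast
    have "- (a * b * (a * b * s)) \<in> Q" using IQ(2)[OF I(4)[OF ab]] by blast
    then have "(b * b) * q + - (a * b * (a * b * s)) \<in> Q" by (intro D(1) D(2) P(3) 1)
    moreover have "(b * b) * q + - (a * b * (a * b * s)) = (b * b) * (- (w * w))"
      unfolding 1(4) by (simp add: algebra_simps)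
    ultimately have bw: "(b * b) * (- (w * w)) \<in> Q" by metis
    have "(w * w) * q' + s' * ((b * b) * (- (w * w))) \<in> Q" by (intro D(1) D(2) P(3) 2 bw)
    moreover have "(w * w) * q' + s' * ((b * b) * (- (w * w))) = (w * w) * (- (w' * w'))"
      unfolding 2(4) by (simp add: algebra_simps)
    moreover have "(w * w) * (- (w' * w')) = - ((w * w') * (w * w'))" by (simp add: algebra_simps)
    ultimately have "- ((w * w') * (w * w')) \<in> Q" by metis
    then show False using QW[OF Wm[OF 1(1) 2(1)]] by simp
  qed
  have "1 \<notin> ?I"
  proof
    assume "1 \<in> ?I"
    then have "- 1 \<in> Q" by (rule IQ)
    then show False using QW[OF W1] by simp
  qed
  then have pI: "prime_ideal_set ?I" unfolding prime_ideal_set_def using I prime by blast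
  have "real_over ?I S" unfolding real_over_def
  proof (intro ballI allI impI)
    fix t s assume t: "t \<in> S" "t + s * s \<in> ?I"
    have "t + - (t + s * s) \<in> Q" using D(1)[OF D(4)[OF t(1)] IQ(2)[OF t(2)]] .
    then have "- (s * s) \<in> Q" by simp
    then have "s * s \<in> ?I" using D(6) II by blast
    then show "s \<in> ?I" by (rule radical)
  qed
  moreover have "?I \<inter> W = {}"
  proof -
    have "w \<notin> ?I" if "w \<in> W" for w
      using QW[OF that] IQ(2)[OF I(4)[of w w]] by blast
    then show ?thesis by blast
  qed
  ultimately show ?thesis using Q total pI by blast
qed

text \<open>A relation w(f) of least degree has a complex root, hence a real linear or quadratic
  factor, and primality puts that factor into \<open>I\<close> as well. Realness excludes the
  quadratic case.\<close>

lemma real_prime_algebraic_is_constant: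
  fixes f :: "'v mpoly"
  assumes I: "prime_ideal_set I" and T: "preordering T" and re: "real_over I T"
    and w: "w \<noteq> 0" "real_poly_at w f \<in> I"
  shows "\<exists>c. f - mconst c \<in> I"
proof -
  note R = ring_mapD[OF ring_map_real_poly_at[of f]]
  note ID = prime_ideal_setD[OF I]
  obtain w where w: "w \<noteq> 0" "real_poly_at w f \<in> I"
    and least: "\<And>v. v \<noteq> 0 \<Longrightarrow> real_poly_at v f \<in> I \<Longrightarrow> degree w \<le> degree v"
    using ex_has_least_nat[of "\<lambda>w. w \<noteq> 0 \<and> real_poly_at w f \<in> I" w degree] w by blast
  have factor: "real_poly_at u f \<in> I" if uv: "w = u * v" "0 < degree u" for u v
  proof -
    have "v \<noteq> 0" "u \<noteq> 0" using uv w by auto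
    then have "degree v < degree w" using uv by (simp add: degree_mult_eq)
    then have "real_poly_at v f \<notin> I" using least[OF \<open>v \<noteq> 0\<close>] by fastforce
    moreover have "real_poly_at u f * real_poly_at v f \<in> I" using w(2) by (simp add: uv R)
    ultimately show ?thesis using ID(6) by blast
  qed
  have "degree w \<noteq> 0"
  proof
    assume "degree w = 0"
    then obtain k where k: "w = [:k:]" by (rule degree_eq_zeroE)
    then have "k \<noteq> 0" "mconst k \<in> I" using w by (auto simp: real_poly_at_simps)
    then show False using mconst_notin_prime[OF I] by blast
  qed
  moreover have "degree (map_poly complex_of_real w) = degree w" by (rule degree_map_poly) auto
  ultimately obtain z where z: "poly (map_poly complex_of_real w) z = 0"
    using alg_closed_imp_poly_has_root[of "map_poly complex_of_real w"] by auto
  have of_real: "ring_map complex_of_real" by (simp add: ring_map_def)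
  have Z: "ring_map (\<lambda>p. poly (map_poly complex_of_real p) z)" by (rule ring_map_poly_map_poly[OF of_real])
  show ?thesis
  proof (cases "Im z = 0")
    case True
    then have "z = complex_of_real (Re z)" by (simp add: complex_eq_iff)
    moreover have "poly (map_poly complex_of_real p) (complex_of_real x) = complex_of_real (poly p x)" for p x
      by (induction p) (auto simp: map_poly_pCons)
    ultimately have "poly w (Re z) = 0" using z by (metis of_real_eq_0_iff)
    then obtain v where v: "w = [:- Re z, 1:] * v" by (auto simp: poly_eq_0_iff_dvd dvd_def)
    have "[:- Re z, 1:] = [:0, 1:] - [:Re z:]" by simp
    then have "real_poly_at [:- Re z, 1:] f = f - mconst (Re z)" by (simp only: R(6) real_poly_at_simps)
    then show ?thesis using factor[OF v] by auto
  next
    case False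
    define q where "q = [:- Re z, 1:] * [:- Re z, 1:] + [:Im z:] * [:Im z:]"
    have dq: "degree q = 2" by (simp add: q_def)
    have "poly (map_poly complex_of_real q) z = (z - Re z) * (z - Re z) + Im z * Im z"
      by (simp only: q_def ring_mapD[OF Z]) (simp add: map_poly_pCons)
    also have "\<dots> = 0" by (simp add: complex_eq_iff)
    finally have qz: "poly (map_poly complex_of_real q) z = 0" .
    define r where "r = w mod q"
    have "poly (map_poly complex_of_real (w div q * q + r)) z = 0" using z by (simp add: r_def)
    then have rz: "poly (map_poly complex_of_real r) z = 0" by (simp only: ring_mapD[OF Z] qz mult_zero_right add_0)
    have "q \<noteq> 0" using dq by auto
    then have "degree r < 2" using degree_mod_less[of q w] dq by (auto simp: r_def)
    then have "r = [:coeff r 0, coeff r 1:]"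
      by (intro poly_eqI) (auto simp: coeff_pCons coeff_eq_0 numeral_2_eq_2 split: nat.splits)
    then obtain a b where ab: "r = [:a, b:]" by blast
    have "complex_of_real a + z * complex_of_real b = 0" using rz by (simp add: ab map_poly_pCons)
    then have "Im z * b = 0" "a + Re z * b = 0" by (auto simp: complex_eq_iff)
    then have "r = 0" using False by (simp add: ab)
    then have "w = q * (w div q)" by (metis r_def mult_div_mod_eq add.right_neutral)
    then have "real_poly_at q f \<in> I" using factor dq by simp
    moreover have "real_poly_at q f = real_poly_at [:- Re z, 1:] f * real_poly_at [:- Re z, 1:] f + mconst (Im z) * mconst (Im z)"
      by (simp only: q_def R real_poly_at_simps)
    \<comment> \<open>The quadratic factor is a square plus the square of the nonzero constant
      \<open>Im z\<close>, so \<open>real_over\<close> would put that constant into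
      \<open>I\<close>.\<close>
    ultimately have "mconst (Im z) \<in> I" using re preorderingD(3)[OF T] unfolding real_over_def by metis
    then show ?thesis using mconst_notin_prime[OF I False] by blast
  qed
qed

subsection \<open>The Fritz John system\<close>

lemma ring_map_in_z: "ring_map in_z"
  unfolding in_z_def[abs_def] by (rule ring_map_msubst[OF ring_map_mconst])

lemma in_z_mconst: "in_z (mconst c) = mconst c"
  by (simp add: in_z_def)

lemma in_z_mvar: "in_z (mvar i) = mvar (Inl i)"
  by (simp add: in_z_def ring_map_mconst)

lemma mderiv_in_z:
  fixes p :: "'n::finite mpoly"
  shows "mderiv v (in_z p :: ('n, 'm) zvar mpoly) = (\<Sum>i\<in>UNIV. in_z (mderiv i p) * mderiv v (mvar (Inl i)))"
proof -
  note R = ring_mapD[OF ring_map_in_z[where 'a = 'n and 'b = 'm]]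
  have "mderiv v (in_z p :: ('n, 'm) zvar mpoly) = (\<Sum>i\<in>UNIV. in_z (mderiv i p) * mderiv v (in_z (mvar i)))"
    by (rule derivation_chain_rule[OF ring_map_in_z])
       (simp_all add: in_z_mconst mderiv_mconst R mderiv_add mderiv_mult)
  then show ?thesis by (simp add: in_z_mvar)
qed

text \<open>On a real prime ideal containing the Fritz John system, any derivation that preserves the ideal
  kills \<open>\<lambda>\<^sub>0\<^sup>2 f\<close>: so \<open>f\<close> is algebraic, hence constant.\<close>

lemma FJ_constant:
  fixes f :: "'n::finite mpoly" and g :: "'m::finite \<Rightarrow> 'n mpoly" and I :: "('n, 'm) zvar mpoly set"
  assumes I: "prime_ideal_set I" and T: "preordering T" and re: "real_over I T"
    and h: "\<And>t. h_FJ_plus f g t \<in> I" and l0: "lam None \<notin> I"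
  shows "\<exists>c. in_z f - mconst c \<in> I"
proof (cases "\<exists>w. w \<noteq> 0 \<and> real_poly_at w (in_z f) \<in> I")
  case True
  then show ?thesis using real_prime_algebraic_is_constant[OF I T re] by blast
next
  case False
  note ID = prime_ideal_setD[OF I]
  have isum: "sum F A \<in> I" if "\<And>i. i \<in> A \<Longrightarrow> F i \<in> I" for F :: "'k \<Rightarrow> ('n, 'm) zvar mpoly" and A
    using that by (induction A rule: infinite_finite_induct) (simp_all add: ID)
  have "\<forall>w. real_poly_at w (in_z f) \<in> I \<longrightarrow> w = 0" using False by blast
  from real_prime_well_behaved(2)[OF I T re, unfolded has_derivations_def, THEN spec, THEN mp, OF this]
  obtain D where D': "(\<forall>p\<in>I. (\<Sum>i\<in>UNIV. D i * mderiv i p) \<in> I) \<and> (\<Sum>i\<in>UNIV. D i * mderiv i (in_z f)) \<notin> I"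
    by (elim exE)
  have D: "\<And>p. p \<in> I \<Longrightarrow> (\<Sum>i\<in>UNIV. D i * mderiv i p) \<in> I"
    and Df: "(\<Sum>i\<in>UNIV. D i * mderiv i (in_z f)) \<notin> I"
    using D' by simp_all
  have dz: "(\<Sum>v\<in>UNIV. D v * mderiv v (in_z p)) = (\<Sum>i\<in>UNIV. in_z (mderiv i p) * D (Inl i))" for p
  proof -
    have "(\<Sum>v\<in>UNIV. D v * mderiv v (in_z p)) =
      (\<Sum>v\<in>UNIV. \<Sum>i\<in>UNIV. in_z (mderiv i p) * (D v * mderiv v (mvar (Inl i))))"
      by (simp add: mderiv_in_z sum_distrib_left ac_simps)
    also have "\<dots> = (\<Sum>i\<in>UNIV. \<Sum>v\<in>UNIV. in_z (mderiv i p) * (D v * mderiv v (mvar (Inl i))))"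
      by (rule sum.swap)
    also have "\<dots> = (\<Sum>i\<in>UNIV. in_z (mderiv i p) * (\<Sum>v\<in>UNIV. D v * mderiv v (mvar (Inl i))))"
      by (simp add: sum_distrib_left)
    also have "\<dots> = (\<Sum>i\<in>UNIV. in_z (mderiv i p) * D (Inl i))"
    proof (rule sum.cong)
      fix i :: 'n
      have "(\<Sum>v\<in>UNIV. D v * mderiv v (mvar (Inl i))) = (\<Sum>v\<in>UNIV. if v = Inl i then D v else 0)"
        by (intro sum.cong) (auto simp: mderiv_mvar)
      then show "in_z (mderiv i p) * (\<Sum>v\<in>UNIV. D v * mderiv v (mvar (Inl i))) = in_z (mderiv i p) * D (Inl i)" by simp
    qed simp
    finally show ?thesis .
  qed
  \<comment> \<open>Complementarity and primality leave two cases: the multiplier is in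
    \<open>I\<close>, or \<open>g j\<close> is and then so is its derivative along
    \<open>D\<close>.\<close>
  have each: "lam (Some j) ^ 2 * (\<Sum>i\<in>UNIV. in_z (mderiv i (g j)) * D (Inl i)) \<in> I" for j
  proof -
    have "lam (Some j) * (lam (Some j) * in_z (g j)) \<in> I"
      using h[of "Inr (Some j)"] by (simp add: power2_eq_square mult.assoc)
    then have "lam (Some j) \<in> I \<or> in_z (g j) \<in> I" using ID(6) by blast
    then show ?thesis
    proof
      assume "lam (Some j) \<in> I"
      then show ?thesis unfolding power2_eq_square mult.assoc by (rule ID(3))
    next
      assume "in_z (g j) \<in> I"
      from D[OF this] show ?thesis unfolding dz by (rule ID(4))
    qed
  qed
  \<comment> \<open>Pairing the gradient equations with the x-components of \<open>D\<close> gives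
    \<lambda>_0^2 times the derivative of f minus the terms handled by \<open>each\<close>.\<close>
  let ?A = "\<lambda>i. h_FJ_plus f g (Inl i) * D (Inl i)"
  have "(\<Sum>i\<in>UNIV. ?A i) + (\<Sum>j\<in>UNIV. lam (Some j) ^ 2 * (\<Sum>i\<in>UNIV. in_z (mderiv i (g j)) * D (Inl i))) \<in> I"
    by (intro ID(2) isum ID(3) h each)
  moreover have "(\<Sum>i\<in>UNIV. ?A i) + (\<Sum>j\<in>UNIV. lam (Some j) ^ 2 * (\<Sum>i\<in>UNIV. in_z (mderiv i (g j)) * D (Inl i)))
    = lam None ^ 2 * (\<Sum>i\<in>UNIV. in_z (mderiv i f) * D (Inl i))"
  proof -
    have "(\<Sum>i\<in>UNIV. ?A i) = lam None ^ 2 * (\<Sum>i\<in>UNIV. in_z (mderiv i f) * D (Inl i)) -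
      (\<Sum>i\<in>UNIV. \<Sum>j\<in>UNIV. lam (Some j) ^ 2 * (in_z (mderiv i (g j)) * D (Inl i)))"
      by (simp add: left_diff_distrib right_diff_distrib sum_subtractf sum_distrib_left sum_distrib_right ac_simps)
    also have "(\<Sum>i\<in>UNIV. \<Sum>j\<in>UNIV. lam (Some j) ^ 2 * (in_z (mderiv i (g j)) * D (Inl i))) =
      (\<Sum>j\<in>UNIV. \<Sum>i\<in>UNIV. lam (Some j) ^ 2 * (in_z (mderiv i (g j)) * D (Inl i)))"
      by (rule sum.swap)
    also have "\<dots> = (\<Sum>j\<in>UNIV. lam (Some j) ^ 2 * (\<Sum>i\<in>UNIV. in_z (mderiv i (g j)) * D (Inl i)))"
      by (simp add: sum_distrib_left)
    finally show ?thesis by simp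
  qed
  ultimately have "lam None * (lam None * (\<Sum>i\<in>UNIV. in_z (mderiv i f) * D (Inl i))) \<in> I"
    by (simp add: power2_eq_square mult.assoc)
  then have "(\<Sum>i\<in>UNIV. in_z (mderiv i f) * D (Inl i)) \<in> I" using ID(6) l0 by blast
  then show ?thesis using Df unfolding dz by blast
qed

lemma meval_in_z: "meval \<zeta> (in_z p :: ('n::finite, 'm) zvar mpoly) = peval p (\<chi> i. \<zeta> (Inl i))"
proof -
  have "meval \<zeta> (in_z p :: ('n, 'm) zvar mpoly) = meval (\<lambda>i. \<zeta> (Inl i)) p"
    by (rule ring_map_eqI[OF ring_map_comp[OF ring_map_meval ring_map_in_z] ring_map_meval])
       (simp_all add: in_z_mconst in_z_mvar)
  moreover have "(($) (\<chi> i. \<zeta> (Inl i))) = (\<lambda>i. \<zeta> (Inl i))" by auto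
  ultimately show ?thesis by (simp add: peval_eq_meval)
qed

lemma peval_simps [simp]:
  "peval (mconst c) x = c" "peval (p + q) x = peval p x + peval q x" "peval (p * q) x = peval p x * peval q x"
  "peval (mvar i) x = x $ i" "peval 0 x = 0" "peval 1 x = 1"
  by (simp_all add: peval_eq_meval)

section \<open>Gradients and concavity\<close>

definition mgrad :: "'n::finite mpoly \<Rightarrow> real ^ 'n \<Rightarrow> real ^ 'n" where
  "mgrad p x = (\<chi> i. peval (mderiv i p) x)"

lemma has_derivative_peval: "(peval p has_derivative (\<lambda>v. mgrad p x \<bullet> v)) (at x)"
proof (induction p rule: mpoly_induct)
  case (const c)
  have "peval (mconst c) = (\<lambda>_. c)" by (auto simp: fun_eq_iff)
  moreover have "mgrad (mconst c) x = 0" by (simp add: mgrad_def mderiv_mconst vec_eq_iff)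
  ultimately show ?case by simp
next
  case (var i)
  have "peval (mvar i) = (\<lambda>x. x $ i)" by (auto simp: fun_eq_iff)
  moreover have "mgrad (mvar i) x = axis i 1" by (simp add: mgrad_def mderiv_mvar vec_eq_iff axis_def)
  ultimately show ?case
    by (simp add: inner_axis' bounded_linear_imp_has_derivative bounded_linear_vec_nth)
next
  case (add p q)
  have "peval (p + q) = (\<lambda>x. peval p x + peval q x)" by (auto simp: fun_eq_iff)
  moreover have "mgrad (p + q) x = mgrad p x + mgrad q x" by (simp add: mgrad_def mderiv_add vec_eq_iff)
  ultimately show ?case using has_derivative_add[OF add] by (simp add: inner_add_left)
next
  case (mult p q)
  have "peval (p * q) = (\<lambda>x. peval p x * peval q x)" by (auto simp: fun_eq_iff)
  moreover have "mgrad (p * q) x = peval q x *\<^sub>R mgrad p x + peval p x *\<^sub>R mgrad q x"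
    by (simp add: mgrad_def mderiv_mult vec_eq_iff)
  ultimately show ?case using has_derivative_mult[OF mult] by (simp add: inner_add_left algebra_simps)
qed

lemma DERIV_peval_line:
  "((\<lambda>t. peval p (x + t *\<^sub>R v)) has_real_derivative mgrad p x \<bullet> v) (at 0)"
proof -
  have "((\<lambda>t. x + t *\<^sub>R v) has_derivative (\<lambda>t. t *\<^sub>R v)) (at (0::real))"
    by (auto intro!: derivative_eq_intros)
  then have "((\<lambda>t. peval p (x + t *\<^sub>R v)) has_derivative (\<lambda>t. mgrad p x \<bullet> (t *\<^sub>R v))) (at 0)"
    using has_derivative_compose[of "\<lambda>t. x + t *\<^sub>R v" "\<lambda>t. t *\<^sub>R v" 0 UNIV "peval p" "\<lambda>v. mgrad p x \<bullet> v"]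
      has_derivative_peval[of p x] by simp
  then show ?thesis by (simp add: has_field_derivative_def mult_commute_abs)
qed

lemma concave_below_tangent:
  assumes "concave_on UNIV (peval p)"
  shows "peval p y \<le> peval p x + mgrad p x \<bullet> (y - x)"
proof -
  let ?\<phi> = "\<lambda>t. peval p (x + t *\<^sub>R (y - x))"
  have "((\<lambda>t. (?\<phi> (0 + t) - ?\<phi> 0) / t) \<longlongrightarrow> mgrad p x \<bullet> (y - x)) (at 0)"
    using DERIV_peval_line[of p x "y - x"] unfolding DERIV_def .
  then have lim: "((\<lambda>t. (?\<phi> (0 + t) - ?\<phi> 0) / t) \<longlongrightarrow> mgrad p x \<bullet> (y - x)) (at_right 0)"
    by (rule tendsto_within_subset) simp
  have "eventually (\<lambda>t. t \<in> {0<..<1}) (at_right (0::real))"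
    by (rule eventually_at_right_real) simp
  then have "eventually (\<lambda>t. peval p y - peval p x \<le> (?\<phi> (0 + t) - ?\<phi> 0) / t) (at_right 0)"
  proof eventually_elim
    case (elim t)
    have "(1 - t) * peval p x + t * peval p y \<le> peval p ((1 - t) *\<^sub>R x + t *\<^sub>R y)"
      using concave_onD[OF assms, of t x y] elim by simp
    moreover have "(1 - t) *\<^sub>R x + t *\<^sub>R y = x + t *\<^sub>R (y - x)" by (simp add: algebra_simps)
    ultimately have "t * (peval p y - peval p x) \<le> ?\<phi> t - ?\<phi> 0" by (simp add: algebra_simps)
    then show ?case using elim by (simp add: pos_le_divide_eq mult.commute)
  qed
  then have "peval p y - peval p x \<le> mgrad p x \<bullet> (y - x)"
    by (rule tendsto_lowerbound[OF lim]) simp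
  then show ?thesis by simp
qed

lemma convex_feasible:
  assumes "\<And>j. concave_on UNIV (peval (g j))"
  shows "convex (feasible g)"
  unfolding convex_alt
proof (intro ballI allI impI)
  fix x y and u :: real
  assume h: "x \<in> feasible g" "y \<in> feasible g" "0 \<le> u \<and> u \<le> 1"
  have "0 \<le> peval (g j) ((1 - u) *\<^sub>R x + u *\<^sub>R y)" for j
  proof -
    have "0 \<le> (1 - u) * peval (g j) x + u * peval (g j) y"
      using h by (auto simp: feasible_def intro!: add_nonneg_nonneg mult_nonneg_nonneg)
    also have "\<dots> \<le> peval (g j) ((1 - u) *\<^sub>R x + u *\<^sub>R y)"
      using concave_onD[OF assms[of j], of u x y] h(3) by simp
    finally show ?thesis .
  qed
  then show "(1 - u) *\<^sub>R x + u *\<^sub>R y \<in> feasible g" by (simp add: feasible_def)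
qed

section \<open>Total degree and vanishing on open sets\<close>

definition mon_deg :: "('v \<Rightarrow>\<^sub>0 nat) \<Rightarrow> nat" where
  "mon_deg a = (\<Sum>i\<in>Poly_Mapping.keys a. Poly_Mapping.lookup a i)"

lemma mon_deg_superset:
  "finite S \<Longrightarrow> Poly_Mapping.keys a \<subseteq> S \<Longrightarrow> mon_deg a = (\<Sum>i\<in>S. Poly_Mapping.lookup a i)"
  unfolding mon_deg_def by (intro sum.mono_neutral_left) (auto simp: in_keys_iff)

lemma mon_deg_add: "mon_deg (a + b) = mon_deg a + mon_deg b"
proof -
  let ?S = "Poly_Mapping.keys a \<union> Poly_Mapping.keys b"
  have "Poly_Mapping.keys (a + b) \<subseteq> ?S" by (rule Poly_Mapping.keys_add)
  then show ?thesis by (simp add: mon_deg_superset[of ?S] lookup_add sum.distrib)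
qed

lemma mdeg_le_iff: "mdeg p \<le> n \<longleftrightarrow> (\<forall>a\<in>Poly_Mapping.keys p. mon_deg a \<le> n)"
  by (simp add: mdeg_def mon_deg_def)

lemma mon_deg_le_mdeg: "a \<in> Poly_Mapping.keys p \<Longrightarrow> mon_deg a \<le> mdeg p"
  using mdeg_le_iff by blast

lemma mdeg_add_le: "mdeg p \<le> n \<Longrightarrow> mdeg q \<le> n \<Longrightarrow> mdeg (p + q) \<le> n"
  unfolding mdeg_le_iff using Poly_Mapping.keys_add[of p q] by blast

lemma mdeg_mult_le: "mdeg (p * q) \<le> mdeg p + mdeg q"
  unfolding mdeg_le_iff
proof
  fix c assume "c \<in> Poly_Mapping.keys (p * q)"
  then obtain a b where "c = a + b" "a \<in> Poly_Mapping.keys p" "b \<in> Poly_Mapping.keys q"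
    using keys_mult[of p q] by blast
  then show "mon_deg c \<le> mdeg p + mdeg q"
    by (simp add: mon_deg_add add_mono mon_deg_le_mdeg)
qed

lemma mdeg_mconst [simp]: "mdeg (mconst c) = 0"
proof -
  have "mdeg (mconst c :: 'a mpoly) \<le> 0"
    unfolding mdeg_le_iff by (auto simp: mconst_def mon_deg_def)
  then show ?thesis by simp
qed

lemma mdeg_mconst_mult_le: "mdeg (mconst c * p) \<le> mdeg p"
  using mdeg_mult_le[of "mconst c" p] by simp

lemma lookup_mderiv:
  assumes "Poly_Mapping.lookup a i \<noteq> 0"
  shows "Poly_Mapping.lookup (mderiv i p) (a - Poly_Mapping.single i 1) =
    Poly_Mapping.lookup p a * of_nat (Poly_Mapping.lookup a i)"
proof -
  let ?e = "Poly_Mapping.single i (1 :: nat)"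
  have inj: "b = a" if "b - ?e = a - ?e" "Poly_Mapping.lookup b i \<noteq> 0" for b
  proof (rule poly_mapping_eqI)
    fix k
    have "Poly_Mapping.lookup (b - ?e) k = Poly_Mapping.lookup (a - ?e) k" using that by simp
    then show "Poly_Mapping.lookup b k = Poly_Mapping.lookup a k"
      using that(2) assms by (cases "k = i") (auto simp: lookup_minus lookup_single)
  qed
  have "Poly_Mapping.lookup (mderiv i p) (a - ?e) = (\<Sum>b\<in>Poly_Mapping.keys p.
    (Poly_Mapping.lookup p b * of_nat (Poly_Mapping.lookup b i) when b - ?e = a - ?e))"
    by (simp add: mderiv_def lookup_sum lookup_single)
  also have "\<dots> = (\<Sum>b\<in>Poly_Mapping.keys p. if b = a then Poly_Mapping.lookup p b * of_nat (Poly_Mapping.lookup b i) else 0)"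
    using inj by (intro sum.cong) (auto simp: when_def)
  also have "\<dots> = Poly_Mapping.lookup p a * of_nat (Poly_Mapping.lookup a i)"
    by (simp add: in_keys_iff)
  finally show ?thesis .
qed

lemma mdeg_mderiv_less:
  assumes "0 < mdeg p"
  shows "mdeg (mderiv i p) < mdeg p"
proof -
  let ?e = "Poly_Mapping.single i (1 :: nat)"
  have "mdeg (mderiv i p) \<le> mdeg p - 1" unfolding mdeg_le_iff
  proof
    fix c assume c: "c \<in> Poly_Mapping.keys (mderiv i p)"
    have "Poly_Mapping.lookup (mderiv i p) c = (\<Sum>b\<in>Poly_Mapping.keys p.
      (Poly_Mapping.lookup p b * of_nat (Poly_Mapping.lookup b i) when b - ?e = c))"
      by (simp add: mderiv_def lookup_sum lookup_single)
    then have "(\<Sum>b\<in>Poly_Mapping.keys p. (Poly_Mapping.lookup p b * of_nat (Poly_Mapping.lookup b i) when b - ?e = c)) \<noteq> 0"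
      using c by (simp add: in_keys_iff)
    then obtain b where b: "b \<in> Poly_Mapping.keys p"
      "(Poly_Mapping.lookup p b * of_nat (Poly_Mapping.lookup b i) when b - ?e = c) \<noteq> 0"
      by (rule sum.not_neutral_contains_not_neutral)
    then have bc: "b - ?e = c" "Poly_Mapping.lookup b i \<noteq> 0" by (auto simp: when_def split: if_splits)
    have "b = c + ?e"
      by (rule poly_mapping_eqI) (use bc(2) in \<open>auto simp: lookup_add lookup_minus lookup_single when_def simp flip: bc(1)\<close>)
    then have "mon_deg b = mon_deg c + 1" by (simp add: mon_deg_add) (simp add: mon_deg_def)
    then show "mon_deg c \<le> mdeg p - 1" using mon_deg_le_mdeg[OF b(1)] by simp
  qed
  then show ?thesis using assms by linarith
qed

text \<open>All partial derivatives vanish on the open set and have smaller degree, so they are zero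
  by induction. A nonconstant monomial would survive in one of them.\<close>

lemma mpoly_zero_on_open:
  fixes p :: "'n::finite mpoly"
  assumes "open U" "U \<noteq> {}" "\<And>x. x \<in> U \<Longrightarrow> peval p x = 0"
  shows "p = 0"
  using assms(3)
proof (induction "mdeg p" arbitrary: p rule: less_induct)
  case less
  have d0: "peval (mderiv i p) x = 0" if x: "x \<in> U" for i x
  proof -
    have "((\<lambda>_. 0) has_derivative (\<lambda>v. mgrad p x \<bullet> v)) (at x)"
      using has_derivative_transform_within_open[OF has_derivative_peval assms(1) x, of p "\<lambda>_. 0"] less.prems by simp
    then have "(\<lambda>v. mgrad p x \<bullet> v) = (\<lambda>_. 0)"
      using has_derivative_unique[OF _ has_derivative_const] by blast
    then have "mgrad p x \<bullet> axis i 1 = 0" by metis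
    then show ?thesis by (simp add: mgrad_def inner_axis)
  qed
  have const: "p = mconst (Poly_Mapping.lookup p 0)" if c: "\<And>a. a \<in> Poly_Mapping.keys p \<Longrightarrow> a = 0"
    using c by (intro poly_mapping_eqI) (auto simp: mconst_def lookup_single when_def in_keys_iff)
  have "a = 0" if a: "a \<in> Poly_Mapping.keys p" for a
  proof (cases "mdeg p = 0")
    case True
    then have "mon_deg a = 0" using mon_deg_le_mdeg[OF a] by simp
    then have "Poly_Mapping.lookup a i = 0" for i
      by (cases "i \<in> Poly_Mapping.keys a") (auto simp: mon_deg_def in_keys_iff)
    then show ?thesis by (intro poly_mapping_eqI) simp
  next
    case False
    show ?thesis
    proof (rule ccontr)
      assume "a \<noteq> 0"
      then obtain i where i: "Poly_Mapping.lookup a i \<noteq> 0" by (metis lookup_zero poly_mapping_eqI)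
      have "mderiv i p = 0" using less.hyps[of "mderiv i p"] mdeg_mderiv_less[of p i] False d0 by simp
      then have "Poly_Mapping.lookup p a * of_nat (Poly_Mapping.lookup a i) = 0"
        using lookup_mderiv[OF i, of p] by simp
      then show False using i a by (simp add: in_keys_iff)
    qed
  qed
  then obtain c where "p = mconst c" using const by blast
  then show ?case using less.prems assms(2) by auto
qed

text \<open>If p vanished at a, reflecting a small ball at a and using midpoint concavity would make
  p vanish on the ball. The zero polynomial has to be excluded: it is concave and nonnegative, but
  nowhere positive.\<close>

lemma concave_positive_interior:
  assumes conc: "concave_on UNIV (peval p)" and "p \<noteq> 0" and U: "open U" "a \<in> U" and nn: "\<And>x. x \<in> U \<Longrightarrow> 0 \<le> peval p x"
  shows "0 < peval p a"
proof (rule ccontr)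
  assume "\<not> ?thesis"
  then have a0: "peval p a = 0" using nn[OF U(2)] by simp
  obtain e where e: "0 < e" "ball a e \<subseteq> U" using U open_contains_ball by blast
  have "peval p x = 0" if x: "x \<in> ball a e" for x
  proof -
    define y where "y = 2 *\<^sub>R a - x"
    have "dist a y = dist a x" by (simp add: y_def dist_norm norm_minus_commute scaleR_2)
    then have "x \<in> U" "y \<in> U" using e x by auto
    have "(1/2) * peval p x + (1/2) * peval p y \<le> peval p ((1/2) *\<^sub>R x + (1/2) *\<^sub>R y)"
      using concave_onD[OF conc, of "1/2" x y] by simp
    moreover have "(1/2) *\<^sub>R x + (1/2) *\<^sub>R y = a" by (simp add: y_def algebra_simps)
    ultimately show ?thesis using a0 nn[OF \<open>x \<in> U\<close>] nn[OF \<open>y \<in> U\<close>] by simp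
  qed
  then have "p = 0" using mpoly_zero_on_open[of "ball a e" p] e by auto
  then show False using \<open>p \<noteq> 0\<close> by simp
qed

lemma meval_h_FJ_plus:
  fixes f :: "'n::finite mpoly" and g :: "'m::finite \<Rightarrow> 'n mpoly" and \<zeta> :: "('n, 'm) zvar \<Rightarrow> real"
  defines "x \<equiv> \<chi> i. \<zeta> (Inl i)"
  shows "meval \<zeta> (h_FJ_plus f g (Inl i)) = (\<zeta> (Inr None))\<^sup>2 * mgrad f x $ i - (\<Sum>j\<in>UNIV. (\<zeta> (Inr (Some j)))\<^sup>2 * mgrad (g j) x $ i)"
    "meval \<zeta> (h_FJ_plus f g (Inr (Some j))) = (\<zeta> (Inr (Some j)))\<^sup>2 * peval (g j) x"
    "meval \<zeta> (h_FJ_plus f g (Inr None)) = 1 - (\<zeta> (Inr None))\<^sup>2 - (\<Sum>j\<in>UNIV. (\<zeta> (Inr (Some j)))\<^sup>2)"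
  by (simp_all add: lam_def meval_in_z mgrad_def x_def UNIV_option_conv sum.reindex)

text \<open>With \<lambda>_0 = 0 the concave function \<Sum> \<lambda>_j^2 g_j would have a critical
  point of value 0, hence be nonpositive everywhere, while it is positive at the Slater point a. The
  argument works at any real zero of the system, feasible or not.\<close>

lemma FJ_multiplier_nonzero:
  fixes f :: "'n::finite mpoly" and g :: "'m::finite \<Rightarrow> 'n mpoly" and \<zeta> :: "('n, 'm) zvar \<Rightarrow> real"
  assumes conc: "\<And>j. concave_on UNIV (peval (g j))" and slater: "\<And>j. 0 < peval (g j) a"
    and h: "\<And>t. meval \<zeta> (h_FJ_plus f g t) = 0"
  shows "\<zeta> (Inr None) \<noteq> 0"
proof
  assume z: "\<zeta> (Inr None) = 0"
  define x where "x = (\<chi> i. \<zeta> (Inl i))"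
  define l where "l j = (\<zeta> (Inr (Some j)))\<^sup>2" for j
  have l: "0 \<le> l j" for j by (simp add: l_def)
  have grad: "(\<Sum>j\<in>UNIV. l j * mgrad (g j) x $ i) = 0" for i
    using h[of "Inl i", unfolded meval_h_FJ_plus] z by (simp add: l_def x_def)
  have compl: "l j * peval (g j) x = 0" for j
    using h[of "Inr (Some j)", unfolded meval_h_FJ_plus] by (simp add: l_def x_def)
  have one: "(\<Sum>j\<in>UNIV. l j) = 1" using h[of "Inr None", unfolded meval_h_FJ_plus] z by (simp add: l_def)
  have "(\<Sum>j\<in>UNIV. l j * peval (g j) a) \<le> (\<Sum>j\<in>UNIV. l j * (peval (g j) x + mgrad (g j) x \<bullet> (a - x)))"
    by (intro sum_mono mult_left_mono concave_below_tangent conc l)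
  also have "\<dots> = (\<Sum>j\<in>UNIV. l j *\<^sub>R mgrad (g j) x) \<bullet> (a - x)"
    by (simp add: distrib_left compl inner_sum_left)
  also have "(\<Sum>j\<in>UNIV. l j *\<^sub>R mgrad (g j) x) = 0" using grad by (simp add: vec_eq_iff)
  finally have le: "(\<Sum>j\<in>UNIV. l j * peval (g j) a) \<le> 0" by simp
  have "0 \<le> l j * peval (g j) a" for j using l slater[of j] by simp
  then have "l j * peval (g j) a = 0" for j
    using le sum_nonneg_eq_0_iff[of UNIV "\<lambda>j. l j * peval (g j) a"] sum_nonneg[of UNIV "\<lambda>j. l j * peval (g j) a"] by auto
  then have "l j = 0" for j using slater[of j] by (metis less_irrefl mult_eq_0_iff)
  then show False using one by simp
qed

lemma DERIV_neg_eventually: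
  fixes \<phi> :: "real \<Rightarrow> real"
  assumes "(\<phi> has_real_derivative l) (at 0)" "l < 0"
  shows "eventually (\<lambda>t. \<phi> t < \<phi> 0) (at_right 0)"
  using DERIV_neg_dec_right[OF assms] by (auto simp: eventually_at_right_field)

text \<open>If 0 is not in the convex hull of \<nabla>f and the \<open>- \<nabla>g_j\<close> of the
  active constraints, a separating vector yields a direction that decreases f and increases all
  active constraints; inactive ones stay positive by continuity. So the multipliers are convex
  coefficients.\<close>

lemma Fritz_John_necessary:
  fixes f :: "'n::finite mpoly" and g :: "'m::finite \<Rightarrow> 'n mpoly"
  assumes x: "x \<in> feasible g" and min: "\<And>y. y \<in> feasible g \<Longrightarrow> peval f x \<le> peval f y"
  shows "\<exists>\<zeta> :: ('n, 'm) zvar \<Rightarrow> real. (\<forall>i. \<zeta> (Inl i) = x $ i) \<and> (\<forall>t. meval \<zeta> (h_FJ_plus f g t) = 0)"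
proof -
  define w :: "'m option \<Rightarrow> real ^ 'n" where
    "w = case_option (mgrad f x) (\<lambda>j. - mgrad (g j) x)"
  define K where "K = insert None (Some ` {j. peval (g j) x = 0})"
  have "0 \<in> convex hull (w ` K)"
  proof (rule ccontr)
    assume "0 \<notin> convex hull (w ` K)"
    moreover have "closed (convex hull (w ` K))"
      by (intro compact_imp_closed compact_convex_hull finite_imp_compact) simp
    ultimately obtain a b where ab: "0 < b" "\<And>v. v \<in> convex hull (w ` K) \<Longrightarrow> b < a \<bullet> v"
      using separating_hyperplane_closed_0[OF convex_convex_hull] by blast
    have pos: "0 < a \<bullet> w k" if "k \<in> K" for k
      using ab(1) ab(2)[of "w k"] that hull_inc[of "w k" "w ` K"] by force
    define d where "d = - a"
    have "eventually (\<lambda>t. peval f (x + t *\<^sub>R d) < peval f (x + 0 *\<^sub>R d)) (at_right 0)"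
      using pos[of None] by (intro DERIV_neg_eventually[OF DERIV_peval_line]) (simp add: K_def w_def d_def inner_commute)
    moreover have "eventually (\<lambda>t. 0 \<le> peval (g j) (x + t *\<^sub>R d)) (at_right 0)" for j
    proof (cases "peval (g j) x = 0")
      case True
      have "((\<lambda>t. - peval (g j) (x + t *\<^sub>R d)) has_real_derivative - (mgrad (g j) x \<bullet> d)) (at 0)"
        by (intro DERIV_minus DERIV_peval_line)
      moreover have "- (mgrad (g j) x \<bullet> d) < 0"
        using pos[of "Some j"] True by (simp add: K_def w_def d_def inner_commute)
      ultimately have "eventually (\<lambda>t. - peval (g j) (x + t *\<^sub>R d) < - peval (g j) (x + 0 *\<^sub>R d)) (at_right 0)"
        by (rule DERIV_neg_eventually)
      then show ?thesis by eventually_elim (use True in simp)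
    next
      case False
      then have "0 < peval (g j) (x + 0 *\<^sub>R d)" using x by (auto simp: feasible_def order_less_le)
      moreover have "isCont (\<lambda>t. peval (g j) (x + t *\<^sub>R d)) 0"
        using DERIV_peval_line by (rule DERIV_isCont)
      ultimately have "eventually (\<lambda>t. 0 < peval (g j) (x + t *\<^sub>R d)) (at 0)"
        by (intro order_tendstoD(1)[where a = 0]) (auto simp: isCont_def)
      then have "eventually (\<lambda>t. 0 < peval (g j) (x + t *\<^sub>R d)) (at_right 0)"
        by (simp add: eventually_at_split)
      then show ?thesis by eventually_elim simp
    qed
    then have "eventually (\<lambda>t. \<forall>j\<in>UNIV. 0 \<le> peval (g j) (x + t *\<^sub>R d)) (at_right 0)"
      by (intro eventually_ball_finite) auto
    ultimately have "eventually (\<lambda>t. False) (at_right (0::real))"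
    proof eventually_elim
      case (elim t)
      then have "x + t *\<^sub>R d \<in> feasible g" by (simp add: feasible_def)
      then show ?case using min elim(1) by fastforce
    qed
    then show False by simp
  qed
  then obtain u where u: "\<And>v. v \<in> w ` K \<Longrightarrow> 0 \<le> u v" "sum u (w ` K) = 1" "(\<Sum>v\<in>w ` K. u v *\<^sub>R v) = 0"
    using convex_hull_finite[of "w ` K"] by auto
  \<comment> \<open>Different constraints may have equal gradients, so one index is selected for
    each vector and carries its whole weight.\<close>
  define K' where "K' = inv_into K w ` (w ` K)"
  have inv: "inv_into K w v \<in> K" "w (inv_into K w v) = v" if "v \<in> w ` K" for v
    using that by (rule inv_into_into, rule f_inv_into_f)
  have K': "K' \<subseteq> K" "inj_on w K'" "w ` K' = w ` K"
  proof -
    show "K' \<subseteq> K" unfolding K'_def using inv(1) by blast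
    show "inj_on w K'" unfolding K'_def by (rule inj_onI) (metis (no_types, lifting) imageE inv(2))
    have "w ` K' = (\<lambda>v. v) ` (w ` K)" unfolding K'_def image_image[of w] by (rule image_cong) (use inv(2) in auto)
    then show "w ` K' = w ` K" by simp
  qed
  define c where "c k = (if k \<in> K' then u (w k) else 0)" for k
  have c: "0 \<le> c k" "k \<notin> K \<Longrightarrow> c k = 0" for k using u(1) K'(1) by (auto simp: c_def)
  have c1: "(\<Sum>k\<in>UNIV. c k) = 1"
  proof -
    have "(\<Sum>k\<in>UNIV. c k) = (\<Sum>k\<in>K'. u (w k))"
      unfolding c_def by (subst sum.If_cases) auto
    also have "\<dots> = sum u (w ` K')" using K'(2) by (simp add: sum.reindex)
    finally show ?thesis using u(2) K'(3) by simp
  qed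
  have c0: "(\<Sum>k\<in>UNIV. c k *\<^sub>R w k) = 0"
  proof -
    have "(\<Sum>k\<in>UNIV. c k *\<^sub>R w k) = (\<Sum>k\<in>UNIV. if k \<in> K' then u (w k) *\<^sub>R w k else 0)"
      by (intro sum.cong) (auto simp: c_def)
    also have "\<dots> = (\<Sum>k\<in>K'. u (w k) *\<^sub>R w k)" by (subst sum.If_cases) auto
    also have "\<dots> = (\<Sum>v\<in>w ` K'. u v *\<^sub>R v)" using K'(2) by (simp add: sum.reindex)
    finally show ?thesis using u(3) K'(3) by simp
  qed
  \<comment> \<open>Square roots, because the system contains the squares of the
    \<lambda>_k.\<close>
  define \<zeta> :: "('n, 'm) zvar \<Rightarrow> real" where "\<zeta> = case_sum (($) x) (\<lambda>k. sqrt (c k))"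
  have x': "(\<chi> i. \<zeta> (Inl i)) = x" by (simp add: \<zeta>_def vec_eq_iff)
  have sq: "(\<zeta> (Inr k))\<^sup>2 = c k" for k using c by (simp add: \<zeta>_def)
  have opt: "(\<Sum>k\<in>UNIV. F k) = F None + (\<Sum>j\<in>UNIV. F (Some j))" for F :: "'m option \<Rightarrow> 'k::comm_monoid_add"
    by (simp add: UNIV_option_conv sum.reindex)
  have "meval \<zeta> (h_FJ_plus f g t) = 0" for t
  proof (cases t)
    case (Inl i)
    have "(\<Sum>k\<in>UNIV. c k *\<^sub>R w k) $ i = 0" by (simp add: c0)
    then have "c None * mgrad f x $ i - (\<Sum>j\<in>UNIV. c (Some j) * mgrad (g j) x $ i) = 0"
      unfolding opt by (simp add: w_def sum_negf)
    then show ?thesis unfolding Inl meval_h_FJ_plus x' sq .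
  next
    case (Inr k)
    show ?thesis
    proof (cases k)
      case None
      have "1 - c None - (\<Sum>j\<in>UNIV. c (Some j)) = 0" using c1 unfolding opt by simp
      then show ?thesis unfolding Inr None meval_h_FJ_plus sq .
    next
      case (Some j)
      have "c (Some j) * peval (g j) x = 0"
        using c(2)[of "Some j"] by (cases "peval (g j) x = 0") (auto simp: K_def)
      then show ?thesis unfolding Inr Some meval_h_FJ_plus x' sq .
    qed
  qed
  then show ?thesis by (intro exI[of _ \<zeta>]) (simp add: \<zeta>_def)
qed

subsection \<open>Truncated cones\<close>

lemma mdeg_0_1 [simp]: "mdeg 0 = 0" "mdeg 1 = 0"
  using mdeg_mconst[of 0] mdeg_mconst[of 1] by (simp_all only: mconst_simps)

lemma SOS_0 [simp]: "0 \<in> SOS"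
  unfolding SOS_def by (intro CollectI exI[of _ "[]"]) simp

lemma SOS_square: "q * q \<in> SOS"
  unfolding SOS_def by (intro CollectI exI[of _ "[q]"]) (simp add: power2_eq_square)

lemma SOS_add: "p \<in> SOS \<Longrightarrow> q \<in> SOS \<Longrightarrow> p + q \<in> SOS"
proof -
  assume "p \<in> SOS" "q \<in> SOS"
  then obtain ps qs where "p = (\<Sum>r\<leftarrow>ps. r ^ 2)" "q = (\<Sum>r\<leftarrow>qs. r ^ 2)" by (auto simp: SOS_def)
  then have "p + q = (\<Sum>r\<leftarrow>ps @ qs. r ^ 2)" by simp
  then show ?thesis unfolding SOS_def by blast
qed

lemma SOS_square_mult: "p \<in> SOS \<Longrightarrow> q * q * p \<in> SOS"
proof -
  assume "p \<in> SOS"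
  then obtain ps where p: "p = (\<Sum>r\<leftarrow>ps. r ^ 2)" by (auto simp: SOS_def)
  have "q * q * (\<Sum>r\<leftarrow>rs. r ^ 2) = (\<Sum>r\<leftarrow>map ((*) q) rs. r ^ 2)" for rs
    by (induction rs) (simp_all add: distrib_left power2_eq_square ac_simps)
  then show ?thesis unfolding SOS_def p by blast
qed

lemma SOS_mconst_mult: "0 \<le> c \<Longrightarrow> p \<in> SOS \<Longrightarrow> mconst c * p \<in> SOS"
  using SOS_square_mult[of p "mconst (sqrt c)"] by (simp flip: mconst_mult)

lemma SOS_mconst: "0 \<le> c \<Longrightarrow> mconst c \<in> SOS"
  using SOS_mconst_mult[of c 1] SOS_square[of 1] by simp

lemma SOS_meval: "p \<in> SOS \<Longrightarrow> 0 \<le> meval x p"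
proof -
  assume "p \<in> SOS"
  then obtain ps where p: "p = (\<Sum>r\<leftarrow>ps. r ^ 2)" by (auto simp: SOS_def)
  have "0 \<le> meval x (\<Sum>r\<leftarrow>rs. r ^ 2)" for rs by (induction rs) simp_all
  then show ?thesis by (simp add: p)
qed

definition full_cone :: "'s set \<Rightarrow> ('s \<Rightarrow> 'v mpoly) \<Rightarrow> 'l set \<Rightarrow> ('l \<Rightarrow> 'v mpoly) \<Rightarrow> 'v mpoly set" where
  "full_cone J G T h = {\<sigma>0 + (\<Sum>j\<in>J. \<sigma> j * G j) + (\<Sum>t\<in>T. \<psi> t * h t) | \<sigma>0 \<sigma> \<psi>. \<sigma>0 \<in> SOS \<and> (\<forall>j\<in>J. \<sigma> j \<in> SOS)}"

definition trunc_cone :: "nat \<Rightarrow> 's set \<Rightarrow> ('s \<Rightarrow> 'v mpoly) \<Rightarrow> 'l set \<Rightarrow> ('l \<Rightarrow> 'v mpoly) \<Rightarrow> 'v mpoly set" where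
  "trunc_cone k J G T h = {q + r | q r. q \<in> Q_trunc k J G \<and> r \<in> I_trunc k T h}"

lemma trunc_coneI:
  assumes "\<sigma>0 \<in> SOS" "\<And>j. j \<in> J \<Longrightarrow> \<sigma> j \<in> SOS" "mdeg \<sigma>0 \<le> 2 * k" "\<And>j. j \<in> J \<Longrightarrow> mdeg (\<sigma> j * G j) \<le> 2 * k"
    "\<And>t. t \<in> T \<Longrightarrow> mdeg (\<psi> t * h t) \<le> 2 * k"
  shows "\<sigma>0 + (\<Sum>j\<in>J. \<sigma> j * G j) + (\<Sum>t\<in>T. \<psi> t * h t) \<in> trunc_cone k J G T h"
  unfolding trunc_cone_def Q_trunc_def I_trunc_def using assms by blast

lemma trunc_coneE:
  assumes "u \<in> trunc_cone k J G T h"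
  obtains \<sigma>0 \<sigma> \<psi> where "u = \<sigma>0 + (\<Sum>j\<in>J. \<sigma> j * G j) + (\<Sum>t\<in>T. \<psi> t * h t)"
    "\<sigma>0 \<in> SOS" "\<And>j. j \<in> J \<Longrightarrow> \<sigma> j \<in> SOS" "mdeg \<sigma>0 \<le> 2 * k" "\<And>j. j \<in> J \<Longrightarrow> mdeg (\<sigma> j * G j) \<le> 2 * k"
    "\<And>t. t \<in> T \<Longrightarrow> mdeg (\<psi> t * h t) \<le> 2 * k"
proof -
  obtain q r where u: "u = q + r" "q \<in> Q_trunc k J G" "r \<in> I_trunc k T h"
    using assms unfolding trunc_cone_def by blast
  obtain \<sigma>0 \<sigma> where q: "q = \<sigma>0 + (\<Sum>j\<in>J. \<sigma> j * G j)" "\<sigma>0 \<in> SOS" "mdeg \<sigma>0 \<le> 2 * k"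
    "\<forall>j\<in>J. \<sigma> j \<in> SOS \<and> mdeg (\<sigma> j * G j) \<le> 2 * k"
    using u(2) unfolding Q_trunc_def by blast
  obtain \<psi> where r: "r = (\<Sum>t\<in>T. \<psi> t * h t)" "\<forall>t\<in>T. mdeg (\<psi> t * h t) \<le> 2 * k"
    using u(3) unfolding I_trunc_def by blast
  show ?thesis by (rule that[of \<sigma>0 \<sigma> \<psi>]) (use u q r in auto)
qed

lemma trunc_cone_mono:
  assumes "u \<in> trunc_cone k J G T h" "k \<le> l"
  shows "u \<in> trunc_cone l J G T h"
  using assms(1)
proof (rule trunc_coneE)
  fix \<sigma>0 \<sigma> \<psi>
  assume u: "u = \<sigma>0 + (\<Sum>j\<in>J. \<sigma> j * G j) + (\<Sum>t\<in>T. \<psi> t * h t)" "\<sigma>0 \<in> SOS" "\<And>j. j \<in> J \<Longrightarrow> \<sigma> j \<in> SOS"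
    "mdeg \<sigma>0 \<le> 2 * k" "\<And>j. j \<in> J \<Longrightarrow> mdeg (\<sigma> j * G j) \<le> 2 * k" "\<And>t. t \<in> T \<Longrightarrow> mdeg (\<psi> t * h t) \<le> 2 * k"
  have "2 * k \<le> 2 * l" using assms(2) by simp
  then show ?thesis unfolding u(1) by (intro trunc_coneI u(2,3)) (use u(4-6) le_trans in blast)+
qed

lemma trunc_cone_add:
  assumes "u \<in> trunc_cone k J G T h" "v \<in> trunc_cone k J G T h"
  shows "u + v \<in> trunc_cone k J G T h"
  using assms(1)
proof (rule trunc_coneE)
  fix \<sigma>0 \<sigma> \<psi>
  assume u: "u = \<sigma>0 + (\<Sum>j\<in>J. \<sigma> j * G j) + (\<Sum>t\<in>T. \<psi> t * h t)" "\<sigma>0 \<in> SOS" "\<And>j. j \<in> J \<Longrightarrow> \<sigma> j \<in> SOS"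
    "mdeg \<sigma>0 \<le> 2 * k" "\<And>j. j \<in> J \<Longrightarrow> mdeg (\<sigma> j * G j) \<le> 2 * k" "\<And>t. t \<in> T \<Longrightarrow> mdeg (\<psi> t * h t) \<le> 2 * k"
  show ?thesis using assms(2)
  proof (rule trunc_coneE)
    fix \<sigma>0' \<sigma>' \<psi>'
    assume v: "v = \<sigma>0' + (\<Sum>j\<in>J. \<sigma>' j * G j) + (\<Sum>t\<in>T. \<psi>' t * h t)" "\<sigma>0' \<in> SOS" "\<And>j. j \<in> J \<Longrightarrow> \<sigma>' j \<in> SOS"
      "mdeg \<sigma>0' \<le> 2 * k" "\<And>j. j \<in> J \<Longrightarrow> mdeg (\<sigma>' j * G j) \<le> 2 * k" "\<And>t. t \<in> T \<Longrightarrow> mdeg (\<psi>' t * h t) \<le> 2 * k"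
    have e: "u + v = (\<sigma>0 + \<sigma>0') + (\<Sum>j\<in>J. (\<sigma> j + \<sigma>' j) * G j) + (\<Sum>t\<in>T. (\<psi> t + \<psi>' t) * h t)"
      by (simp add: u(1) v(1) distrib_right sum.distrib)
    show ?thesis unfolding e
      by (intro trunc_coneI SOS_add u v) (simp_all add: distrib_right mdeg_add_le u v)
  qed
qed

lemma trunc_cone_scale:
  assumes "u \<in> trunc_cone k J G T h" "0 \<le> c"
  shows "mconst c * u \<in> trunc_cone k J G T h"
  using assms(1)
proof (rule trunc_coneE)
  fix \<sigma>0 \<sigma> \<psi>
  assume u: "u = \<sigma>0 + (\<Sum>j\<in>J. \<sigma> j * G j) + (\<Sum>t\<in>T. \<psi> t * h t)" "\<sigma>0 \<in> SOS" "\<And>j. j \<in> J \<Longrightarrow> \<sigma> j \<in> SOS"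
    "mdeg \<sigma>0 \<le> 2 * k" "\<And>j. j \<in> J \<Longrightarrow> mdeg (\<sigma> j * G j) \<le> 2 * k" "\<And>t. t \<in> T \<Longrightarrow> mdeg (\<psi> t * h t) \<le> 2 * k"
  have e: "mconst c * u = mconst c * \<sigma>0 + (\<Sum>j\<in>J. (mconst c * \<sigma> j) * G j) + (\<Sum>t\<in>T. (mconst c * \<psi> t) * h t)"
    by (simp add: u(1) distrib_left sum_distrib_left mult.assoc)
  show ?thesis unfolding e
    by (intro trunc_coneI SOS_mconst_mult u assms(2))
       (simp_all add: mult.assoc order_trans[OF mdeg_mconst_mult_le] u)
qed

lemma trunc_cone_SOS:
  assumes "s \<in> SOS" "mdeg s \<le> 2 * k"
  shows "s \<in> trunc_cone k J G T h"
proof -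
  have "s + (\<Sum>j\<in>J. 0 * G j) + (\<Sum>t\<in>T. 0 * h t) \<in> trunc_cone k J G T h"
    by (intro trunc_coneI) (use assms in simp_all)
  then show ?thesis by simp
qed

lemma trunc_cone_exists:
  assumes "finite J" "finite T" "u \<in> full_cone J G T h"
  shows "\<exists>k. u \<in> trunc_cone k J G T h"
proof -
  obtain \<sigma>0 \<sigma> \<psi> where u: "u = \<sigma>0 + (\<Sum>j\<in>J. \<sigma> j * G j) + (\<Sum>t\<in>T. \<psi> t * h t)" "\<sigma>0 \<in> SOS" "\<forall>j\<in>J. \<sigma> j \<in> SOS"
    using assms(3) unfolding full_cone_def by blast
  define k where "k = mdeg \<sigma>0 + (\<Sum>j\<in>J. mdeg (\<sigma> j * G j)) + (\<Sum>t\<in>T. mdeg (\<psi> t * h t))"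
  have "mdeg (\<sigma> j * G j) \<le> (\<Sum>j\<in>J. mdeg (\<sigma> j * G j))" if "j \<in> J" for j
    using assms(1) that by (intro member_le_sum) auto
  moreover have "mdeg (\<psi> t * h t) \<le> (\<Sum>t\<in>T. mdeg (\<psi> t * h t))" if "t \<in> T" for t
    using assms(2) that by (intro member_le_sum) auto
  ultimately have b: "mdeg \<sigma>0 \<le> 2 * k" "\<And>j. j \<in> J \<Longrightarrow> mdeg (\<sigma> j * G j) \<le> 2 * k"
    "\<And>t. t \<in> T \<Longrightarrow> mdeg (\<psi> t * h t) \<le> 2 * k" unfolding k_def by (simp, force+)
  have "u \<in> trunc_cone k J G T h"
    unfolding u(1) by (rule trunc_coneI[OF u(2) _ b]) (use u(3) in blast)
  then show ?thesis by blast
qed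

section \<open>The cone without degree bounds and its stabilizer\<close>

lemma full_coneI:
  assumes "\<sigma>0 \<in> SOS" "\<And>j. j \<in> J \<Longrightarrow> \<sigma> j \<in> SOS"
  shows "\<sigma>0 + (\<Sum>j\<in>J. \<sigma> j * G j) + (\<Sum>t\<in>T. \<psi> t * h t) \<in> full_cone J G T h"
  unfolding full_cone_def using assms by blast

lemma full_coneE:
  assumes "u \<in> full_cone J G T h"
  obtains \<sigma>0 \<sigma> \<psi> where "u = \<sigma>0 + (\<Sum>j\<in>J. \<sigma> j * G j) + (\<Sum>t\<in>T. \<psi> t * h t)"
    "\<sigma>0 \<in> SOS" "\<And>j. j \<in> J \<Longrightarrow> \<sigma> j \<in> SOS"
  using assms unfolding full_cone_def by blast

lemma full_cone_add:
  assumes "u \<in> full_cone J G T h" "v \<in> full_cone J G T h"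
  shows "u + v \<in> full_cone J G T h"
  using assms(1)
proof (rule full_coneE)
  fix \<sigma>0 \<sigma> \<psi>
  assume u: "u = \<sigma>0 + (\<Sum>j\<in>J. \<sigma> j * G j) + (\<Sum>t\<in>T. \<psi> t * h t)" "\<sigma>0 \<in> SOS" "\<And>j. j \<in> J \<Longrightarrow> \<sigma> j \<in> SOS"
  show ?thesis using assms(2)
  proof (rule full_coneE)
    fix \<sigma>0' \<sigma>' \<psi>'
    assume v: "v = \<sigma>0' + (\<Sum>j\<in>J. \<sigma>' j * G j) + (\<Sum>t\<in>T. \<psi>' t * h t)" "\<sigma>0' \<in> SOS" "\<And>j. j \<in> J \<Longrightarrow> \<sigma>' j \<in> SOS"
    have e: "u + v = (\<sigma>0 + \<sigma>0') + (\<Sum>j\<in>J. (\<sigma> j + \<sigma>' j) * G j) + (\<Sum>t\<in>T. (\<psi> t + \<psi>' t) * h t)"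
      by (simp add: u(1) v(1) distrib_right sum.distrib)
    show ?thesis unfolding e by (intro full_coneI SOS_add u v)
  qed
qed

lemma full_cone_sum:
  assumes "\<And>i. i \<in> A \<Longrightarrow> F i \<in> full_cone J G T h"
  shows "sum F A \<in> full_cone J G T h"
proof -
  have "0 + (\<Sum>j\<in>J. 0 * G j) + (\<Sum>t\<in>T. 0 * h t) \<in> full_cone J G T h" by (intro full_coneI) auto
  then have z: "0 \<in> full_cone J G T h" by simp
  show ?thesis using assms
    by (induction A rule: infinite_finite_induct) (simp_all add: z full_cone_add)
qed

lemma full_cone_square_mult:
  assumes "u \<in> full_cone J G T h"
  shows "s * s * u \<in> full_cone J G T h"
  using assms
proof (rule full_coneE)
  fix \<sigma>0 \<sigma> \<psi>
  assume u: "u = \<sigma>0 + (\<Sum>j\<in>J. \<sigma> j * G j) + (\<Sum>t\<in>T. \<psi> t * h t)" "\<sigma>0 \<in> SOS" "\<And>j. j \<in> J \<Longrightarrow> \<sigma> j \<in> SOS"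
  have e: "s * s * u = s * s * \<sigma>0 + (\<Sum>j\<in>J. (s * s * \<sigma> j) * G j) + (\<Sum>t\<in>T. (s * s * \<psi> t) * h t)"
    by (simp add: u(1) distrib_left sum_distrib_left mult.assoc)
  show ?thesis unfolding e by (intro full_coneI SOS_square_mult u)
qed

lemma full_cone_SOS: "s \<in> SOS \<Longrightarrow> s \<in> full_cone J G T h"
  using full_coneI[of s J "\<lambda>_. 0" G "\<lambda>_. 0" h T] by simp

lemma full_cone_generator:
  assumes "finite J" "j \<in> J" "s \<in> SOS"
  shows "s * G j \<in> full_cone J G T h"
proof -
  have "0 + (\<Sum>i\<in>J. (if i = j then s else 0) * G i) + (\<Sum>t\<in>T. 0 * h t) \<in> full_cone J G T h"
    by (intro full_coneI) (use assms in auto)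
  moreover have "(\<Sum>i\<in>J. (if i = j then s else 0) * G i) = s * G j"
    using assms by (simp add: if_distrib[of "\<lambda>x. x * _"] cong: if_cong)
  ultimately show ?thesis by simp
qed

lemma full_cone_ideal:
  assumes "finite T" "t \<in> T"
  shows "p * h t \<in> full_cone J G T h"
proof -
  have "0 + (\<Sum>i\<in>J. 0 * G i) + (\<Sum>i\<in>T. (if i = t then p else 0) * h i) \<in> full_cone J G T h"
    by (intro full_coneI) auto
  moreover have "(\<Sum>i\<in>T. (if i = t then p else 0) * h i) = p * h t"
    using assms by (simp add: if_distrib[of "\<lambda>x. x * _"] cong: if_cong)
  ultimately show ?thesis by simp
qed

text \<open>The largest set of multipliers over which \<open>M\<close> is a module. For the cones
  here it contains the squares, and for the cone of all products of the constraints also the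
  constraints themselves.\<close>

definition stabilizer :: "'a::comm_ring_1 set \<Rightarrow> 'a set" where
  "stabilizer M = {s. \<forall>a\<in>M. s * a \<in> M}"

lemma stabilizer_full_cone:
  "preordering (stabilizer (full_cone J G T h))" "cone_module (stabilizer (full_cone J G T h)) (full_cone J G T h)"
proof -
  let ?M = "full_cone J G T h"
  show "preordering (stabilizer ?M)" unfolding preordering_def stabilizer_def
  proof (intro conjI ballI allI)
    fix a b assume "a \<in> {s. \<forall>a\<in>?M. s * a \<in> ?M}" "b \<in> {s. \<forall>a\<in>?M. s * a \<in> ?M}"
    then show "a + b \<in> {s. \<forall>a\<in>?M. s * a \<in> ?M}" "a * b \<in> {s. \<forall>a\<in>?M. s * a \<in> ?M}"
      by (simp_all add: distrib_right full_cone_add mult.assoc)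
  next
    fix a
    show "a * a \<in> {s. \<forall>a\<in>?M. s * a \<in> ?M}" by (simp add: full_cone_square_mult)
  qed
  show "cone_module (stabilizer ?M) ?M" unfolding cone_module_def
    using full_cone_SOS[OF SOS_square[of 1]] by (simp add: stabilizer_def full_cone_add)
qed

text \<open>The order of the quantifiers is the point: one k for every \<epsilon> makes the supremum
  at that k reach the value, without u itself lying in a truncated cone.\<close>

definition trunc_limit :: "'s set \<Rightarrow> ('s \<Rightarrow> 'v mpoly) \<Rightarrow> 'l set \<Rightarrow> ('l \<Rightarrow> 'v mpoly) \<Rightarrow> 'v mpoly \<Rightarrow> bool" where
  "trunc_limit J G T h u \<longleftrightarrow> (\<exists>k. \<forall>\<epsilon>>0. u + mconst \<epsilon> \<in> trunc_cone k J G T h)"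

lemma trunc_limit_full_cone:
  assumes "finite J" "finite T" "u \<in> full_cone J G T h"
  shows "trunc_limit J G T h u"
proof -
  obtain k where k: "u \<in> trunc_cone k J G T h" using trunc_cone_exists[OF assms] by blast
  have "u + mconst \<epsilon> \<in> trunc_cone k J G T h" if "0 < \<epsilon>" for \<epsilon>
    using that by (intro trunc_cone_add k trunc_cone_SOS SOS_mconst) auto
  then show ?thesis unfolding trunc_limit_def by blast
qed

text \<open>\<open>u + 2 \<delta> = \<delta> (1 + u / (2 \<delta>))\<^sup>2 + (4 \<delta>\<^sup>2 - u\<^sup>2) / (4 \<delta>)\<close>, where the degrees do not depend on \<open>\<delta>\<close>.\<close>

lemma trunc_limit_of_neg_square:
  fixes u :: "'v mpoly"
  assumes "trunc_limit J G T h (- (u * u))"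
  shows "trunc_limit J G T h u"
proof -
  obtain k where k: "\<And>\<epsilon>. 0 < \<epsilon> \<Longrightarrow> - (u * u) + mconst \<epsilon> \<in> trunc_cone k J G T h"
    using assms unfolding trunc_limit_def by blast
  define l where "l = max k (mdeg u)"
  have "u + mconst \<epsilon> \<in> trunc_cone l J G T h" if e: "0 < \<epsilon>" for \<epsilon>
  proof -
    define \<delta> where "\<delta> = \<epsilon> / 2"
    have \<delta>: "0 < \<delta>" using e by (simp add: \<delta>_def)
    define v where "v = 1 + mconst (1 / (2 * \<delta>)) * u"
    have "mdeg v \<le> l" unfolding v_def
      by (intro mdeg_add_le order_trans[OF mdeg_mconst_mult_le]) (simp_all add: l_def)
    then have "mdeg (v * v) \<le> 2 * l" using mdeg_mult_le[of v v] by simp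
    then have "mdeg (mconst \<delta> * (v * v)) \<le> 2 * l" using mdeg_mconst_mult_le order_trans by blast
    then have 1: "mconst \<delta> * (v * v) \<in> trunc_cone l J G T h"
      using \<delta> by (intro trunc_cone_SOS SOS_mconst_mult SOS_square) auto
    have "- (u * u) + mconst (4 * \<delta> * \<delta>) \<in> trunc_cone l J G T h"
      by (rule trunc_cone_mono[OF k]) (use \<delta> in \<open>auto simp: l_def\<close>)
    then have 2: "mconst (1 / (4 * \<delta>)) * (- (u * u) + mconst (4 * \<delta> * \<delta>)) \<in> trunc_cone l J G T h"
      using \<delta> by (intro trunc_cone_scale) auto
    have e2: "mconst \<epsilon> = (mconst \<delta> + mconst \<delta> :: 'v mpoly)" by (simp add: \<delta>_def flip: mconst_add)
    have "mconst \<delta> * (v * v) = mconst \<delta> + mconst (\<delta> * (1 / (2 * \<delta>)) + \<delta> * (1 / (2 * \<delta>))) * u + mconst (\<delta> * (1 / (2 * \<delta>)) * (1 / (2 * \<delta>))) * (u * u)"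
      unfolding v_def mconst_mult mconst_add by (simp only: distrib_left distrib_right mult_1_left mult_1_right ac_simps)
    then have "mconst \<delta> * (v * v) = mconst \<delta> + u + mconst (1 / (4 * \<delta>)) * (u * u)" using \<delta> by simp
    moreover have "mconst (1 / (4 * \<delta>)) * (- (u * u) + mconst (4 * \<delta> * \<delta>)) = mconst \<delta> - mconst (1 / (4 * \<delta>)) * (u * u)"
    proof -
      have "mconst (1 / (4 * \<delta>)) * mconst (4 * \<delta> * \<delta>) = (mconst \<delta> :: 'v mpoly)"
        using \<delta> by (simp flip: mconst_mult)
      then show ?thesis by (simp add: right_diff_distrib)
    qed
    ultimately have "u + mconst \<epsilon> = mconst \<delta> * (v * v) + mconst (1 / (4 * \<delta>)) * (- (u * u) + mconst (4 * \<delta> * \<delta>))"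
      using e2 by simp
    then show ?thesis using trunc_cone_add[OF 1 2] by simp
  qed
  then show ?thesis unfolding trunc_limit_def by blast
qed

text \<open>Halving the exponent repeatedly: each step enlarges the order by an amount independent
  of \<epsilon>.\<close>

lemma trunc_limit_of_power:
  assumes "trunc_limit J G T h (- (u ^ (2 ^ Suc n)))"
  shows "trunc_limit J G T h u"
  using assms
proof (induction n)
  case 0
  then show ?case using trunc_limit_of_neg_square[of J G T h u] by (simp add: power2_eq_square)
next
  case (Suc n)
  let ?w = "- (u ^ (2 ^ Suc n))"
  have "(2 :: nat) ^ Suc (Suc n) = 2 ^ Suc n + 2 ^ Suc n" by simp
  then have "- (u ^ (2 ^ Suc (Suc n))) = - (?w * ?w)" by (simp only: power_add minus_mult_minus)
  then have "trunc_limit J G T h (- (?w * ?w))" using Suc.prems by simp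
  then show ?case by (rule Suc.IH[OF trunc_limit_of_neg_square])
qed

lemma poly_interpolation:
  fixes v :: "real \<Rightarrow> real"
  assumes "finite C"
  shows "\<exists>s. \<forall>c\<in>C. poly s c = v c"
  using assms
proof (induction C rule: finite_induct)
  case (insert c C)
  then obtain s where s: "\<forall>c\<in>C. poly s c = v c" by blast
  define P where "P = (\<Prod>d\<in>C. [:- d, 1:])"
  have P0: "poly P d = 0" if "d \<in> C" for d
    unfolding P_def poly_prod using insert.hyps(1) that by (intro prod_zero) auto
  have Pc: "poly P c \<noteq> 0" unfolding P_def poly_prod using insert.hyps by auto
  show ?case
    by (intro exI[of _ "s + smult ((v c - poly s c) / poly P c) P"]) (use s P0 Pc in auto)
qed simp

text \<open>If \<open>w = \<Prod>(t - c\<^sub>i)\<close> with all \<open>c\<^sub>i \<ge> a\<close>, then \<open>t - a - s\<^sup>2\<close> has all roots of \<open>w\<close> for a polynomial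
  \<open>s\<close> interpolating \<open>\<surd>(c - a)\<close>, so \<open>w\<close> divides a power of it.\<close>

lemma trunc_limit_finite_values:
  assumes fin: "finite J" "finite T" and cs: "\<And>c. c \<in> set cs \<Longrightarrow> a \<le> c"
    and w: "w = prod_list (map (\<lambda>c. F - mconst c) cs)" "- (w * w) \<in> full_cone J G T h"
  shows "trunc_limit J G T h (F - mconst a)"
proof -
  let ?E = "\<lambda>p. real_poly_at p F"
  note E = ring_mapD[OF ring_map_real_poly_at[of F]]
  obtain s where s: "\<forall>c\<in>set cs. poly s c = sqrt (c - a)" using poly_interpolation[of "set cs" "\<lambda>c. sqrt (c - a)"] by auto
  define q where "q = [:- a, 1:] - s * s"
  have root: "poly q c = 0" if "c \<in> set cs" for c
    using s that cs[OF that] by (simp add: q_def)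
  have "prod_list (map (\<lambda>c. [:- c, 1:]) ds) dvd q ^ length ds" if "set ds \<subseteq> set cs" for ds
    using that
  proof (induction ds)
    case (Cons d ds)
    then have "[:- d, 1:] dvd q" using root by (simp add: poly_eq_0_iff_dvd)
    moreover have "prod_list (map (\<lambda>c. [:- c, 1:]) ds) dvd q ^ length ds" using Cons by simp
    ultimately have "[:- d, 1:] * prod_list (map (\<lambda>c. [:- c, 1:]) ds) dvd q * q ^ length ds"
      by (rule mult_dvd_mono)
    then show ?case by (simp only: list.map prod_list.Cons length_Cons power_Suc)
  qed simp
  then have "prod_list (map (\<lambda>c. [:- c, 1:]) cs) dvd q ^ length cs" by blast
  then obtain v where v: "q ^ length cs = prod_list (map (\<lambda>c. [:- c, 1:]) cs) * v" by (auto simp: dvd_def)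
  have lin: "?E [:- c, 1:] = F - mconst c" for c
  proof -
    have "[:- c, 1:] = [:0, 1:] - [:c:]" by simp
    then show ?thesis by (simp only: E(6) real_poly_at_simps)
  qed
  have "?E (prod_list (map (\<lambda>c. [:- c, 1:]) ds)) = prod_list (map (\<lambda>c. F - mconst c) ds)" for ds
    by (induction ds) (simp_all only: list.map prod_list.Nil prod_list.Cons E lin)
  then have "?E (q ^ length cs) = w * ?E v" unfolding v E(4) w(1) by simp
  then have u: "?E q ^ length cs = w * ?E v" by (simp only: E(7))
  define n where "n = length cs"
  \<comment> \<open>The exponent is padded to a power of two, as the halving argument requires; the
    extra factors go into the multiplier of w.\<close>
  have "n \<le> 2 ^ n" by (simp add: less_imp_le)
  then have "?E q ^ (2 ^ n) = ?E q ^ n * ?E q ^ (2 ^ n - n)" by (simp flip: power_add)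
  then have "?E q ^ (2 ^ n) = w * (?E v * ?E q ^ (2 ^ n - n))" using u by (simp add: n_def mult.assoc)
  then obtain y where y: "?E q ^ (2 ^ n) = w * y" by blast
  have "(2 :: nat) ^ Suc n = 2 ^ n + 2 ^ n" by simp
  then have "- (?E q ^ (2 ^ Suc n)) = - ((w * y) * (w * y))"
    unfolding y[symmetric] by (simp only: power_add)
  also have "\<dots> = y * y * (- (w * w))" by (simp add: algebra_simps)
  also have "\<dots> \<in> full_cone J G T h" by (rule full_cone_square_mult[OF w(2)])
  finally have "trunc_limit J G T h (?E q)"
    by (intro trunc_limit_of_power[OF trunc_limit_full_cone] fin)
  then obtain k where k: "\<And>\<epsilon>. 0 < \<epsilon> \<Longrightarrow> ?E q + mconst \<epsilon> \<in> trunc_cone k J G T h"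
    unfolding trunc_limit_def by blast
  \<comment> \<open>\<open>F - a\<close> differs from \<open>q(F)\<close> by the square of
    \<open>s(F)\<close>, whose degree is fixed; so the limit carries over.\<close>
  have qe: "?E q = (F - mconst a) - ?E s * ?E s" by (simp only: q_def E lin)
  define l where "l = max k (mdeg (?E s))"
  have "mdeg (?E s * ?E s) \<le> 2 * l" using mdeg_mult_le[of "?E s" "?E s"] by (simp add: l_def)
  then have 1: "?E s * ?E s \<in> trunc_cone l J G T h" by (intro trunc_cone_SOS SOS_square)
  have "(F - mconst a) + mconst \<epsilon> \<in> trunc_cone l J G T h" if "0 < \<epsilon>" for \<epsilon>
  proof -
    have "?E q + mconst \<epsilon> \<in> trunc_cone l J G T h"
      by (rule trunc_cone_mono[OF k[OF that]]) (simp add: l_def)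
    from trunc_cone_add[OF 1 this] show ?thesis unfolding qe by (simp add: algebra_simps)
  qed
  then show ?thesis unfolding trunc_limit_def by blast
qed

text \<open>Weak duality at one point: evaluated at \<zeta>, the ideal part of a certificate
  vanishes and the rest is nonnegative.\<close>

lemma rho_le:
  assumes G: "\<And>j. j \<in> J \<Longrightarrow> 0 \<le> meval \<zeta> (G j)" and h: "\<And>t. t \<in> T \<Longrightarrow> meval \<zeta> (h t) = 0"
  shows "rho k F J G T h \<le> ereal (meval \<zeta> F)"
  unfolding rho_def
proof (rule SUP_least)
  fix \<xi> assume "\<xi> \<in> {\<xi>. \<exists>q\<in>Q_trunc k J G. \<exists>r\<in>I_trunc k T h. F - mconst \<xi> = q + r}"
  then have "F - mconst \<xi> \<in> trunc_cone k J G T h" unfolding trunc_cone_def by blast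
  then have "0 \<le> meval \<zeta> (F - mconst \<xi>)"
  proof (rule trunc_coneE)
    fix \<sigma>0 \<sigma> \<psi>
    assume u: "F - mconst \<xi> = \<sigma>0 + (\<Sum>j\<in>J. \<sigma> j * G j) + (\<Sum>t\<in>T. \<psi> t * h t)" "\<sigma>0 \<in> SOS" "\<And>j. j \<in> J \<Longrightarrow> \<sigma> j \<in> SOS"
    have "0 \<le> meval \<zeta> \<sigma>0 + (\<Sum>j\<in>J. meval \<zeta> (\<sigma> j) * meval \<zeta> (G j))"
      by (intro add_nonneg_nonneg sum_nonneg mult_nonneg_nonneg SOS_meval u G)
    moreover have "(\<Sum>t\<in>T. meval \<zeta> (\<psi> t) * meval \<zeta> (h t)) = 0" by (simp add: h)
    ultimately show ?thesis unfolding u(1) by simp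
  qed
  then show "ereal \<xi> \<le> ereal (meval \<zeta> F)" by simp
qed

lemma rho_ge:
  assumes "trunc_limit J G T h (F - mconst a)"
  shows "\<exists>k. ereal a \<le> rho k F J G T h"
proof -
  obtain k where k: "\<And>\<epsilon>. 0 < \<epsilon> \<Longrightarrow> F - mconst a + mconst \<epsilon> \<in> trunc_cone k J G T h"
    using assms unfolding trunc_limit_def by blast
  have "ereal a \<le> rho k F J G T h"
  proof (rule ereal_le_epsilon2)
      fix \<epsilon> :: real assume e: "0 < \<epsilon>"
      have "F - mconst (a - \<epsilon>) = F - mconst a + mconst \<epsilon>" by (simp add: mconst_diff)
      then have "F - mconst (a - \<epsilon>) \<in> trunc_cone k J G T h" using k[OF e] by (simp only:)
      then have "ereal (a - \<epsilon>) \<le> rho k F J G T h"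
        unfolding rho_def trunc_cone_def by (intro SUP_upper) blast
      then show "ereal a \<le> rho k F J G T h + ereal \<epsilon>"
        by (metis add_right_mono diff_add_cancel plus_ereal.simps(1))
  qed
  then show ?thesis by blast
qed

text \<open>Apply \<open>prime_support_exists\<close> to the multiplicative set of all products of polynomials \<open>F - c\<close> with
  \<open>c \<ge> a\<close>: by hypothesis no such \<open>Q\<close> exists, so \<open>- w\<^sup>2\<close> lies in the cone for one of these products.\<close>

lemma trunc_limit_of_supports:
  fixes F :: "'v mpoly"
  assumes fin: "finite J" "finite T"
    and S: "S = stabilizer (full_cone J G T h)"
    and val: "\<And>Q. cone_module S Q \<Longrightarrow> full_cone J G T h \<subseteq> Q \<Longrightarrow> (\<forall>a. a \<in> Q \<or> - a \<in> Q) \<Longrightarrow>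
      prime_ideal_set (cone_support Q) \<Longrightarrow> real_over (cone_support Q) S \<Longrightarrow>
      \<exists>c\<ge>a. F - mconst c \<in> cone_support Q"
  shows "trunc_limit J G T h (F - mconst a)"
proof -
  let ?M = "full_cone J G T h"
  define W where "W = {prod_list (map (\<lambda>c. F - mconst c) cs) | cs. \<forall>c\<in>set cs. a \<le> c}"
  have WI: "prod_list (map (\<lambda>c. F - mconst c) cs) \<in> W" if "\<forall>c\<in>set cs. a \<le> c" for cs
    using that unfolding W_def by blast
  have "\<exists>w\<in>W. - (w * w) \<in> ?M"
  proof (rule ccontr)
    assume "\<not> ?thesis"
    then have nW: "\<forall>w\<in>W. - (w * w) \<notin> ?M" by blast
    have pS: "preordering S" "cone_module S ?M" unfolding S by (rule stabilizer_full_cone)+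
    have half: "mconst (1/2) + mconst (1/2) = (1 :: 'v mpoly)" by (simp flip: mconst_add)
    have W1: "1 \<in> W" using WI[of "[]"] by simp
    have Wm: "\<forall>v\<in>W. \<forall>w\<in>W. v * w \<in> W"
    proof (intro ballI)
      fix v w assume v: "v \<in> W" and w: "w \<in> W"
      obtain cs ds where "v = prod_list (map (\<lambda>c. F - mconst c) cs)" "\<forall>c\<in>set cs. a \<le> c"
        "w = prod_list (map (\<lambda>c. F - mconst c) ds)" "\<forall>c\<in>set ds. a \<le> c"
        using v w unfolding W_def by blast
      then show "v * w \<in> W" using WI[of "cs @ ds"] by auto
    qed
    from prime_support_exists[OF pS half W1 Wm nW]
    obtain Q where Q: "cone_module S Q" "?M \<subseteq> Q" "\<forall>a. a \<in> Q \<or> - a \<in> Q" "prime_ideal_set (cone_support Q)"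
      "real_over (cone_support Q) S" "cone_support Q \<inter> W = {}" by (elim exE conjE)
    obtain c where c: "a \<le> c" "F - mconst c \<in> cone_support Q" using val[OF Q(1-5)] by blast
    have "F - mconst c \<in> W" using WI[of "[c]"] c(1) by simp
    then show False using c(2) Q(6) by blast
  qed
  then obtain cs where cs: "\<forall>c\<in>set cs. a \<le> c"
    "- (prod_list (map (\<lambda>c. F - mconst c) cs) * prod_list (map (\<lambda>c. F - mconst c) cs)) \<in> ?M"
    unfolding W_def by blast
  show ?thesis by (rule trunc_limit_finite_values[OF fin _ refl cs(2)]) (use cs(1) in blast)
qed

text \<open>Every \<open>a\<close> is infinitely close, in the ordering defined by \<open>Q\<close>, to a unique real number; this gives a ring
  homomorphism into the reals, hence a point.\<close>

lemma archimedean_total_module_point: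
  fixes Q :: "'v mpoly set"
  assumes S: "preordering S" and Q: "cone_module S Q" and total: "\<And>a. a \<in> Q \<or> - a \<in> Q"
    and prime: "prime_ideal_set (cone_support Q)"
    and arch: "\<And>i. \<exists>r. mconst r - mvar i * mvar i \<in> Q"
  shows "\<exists>\<zeta>. \<forall>p\<in>Q. 0 \<le> meval \<zeta> p"
proof -
  note D = cone_moduleD[OF S Q]
  have sq: "b * b * a \<in> Q" if "a \<in> Q" for a b using D(2)[OF preorderingD(3)[OF S] that] .
  have scale: "mconst c * a \<in> Q" if "0 \<le> c" "a \<in> Q" for c a
    using sq[OF that(2), of "mconst (sqrt c)"] that(1) by (simp flip: mconst_mult)
  have pos: "mconst c \<in> Q" if "0 \<le> c" for c using scale[OF that D(3)] by simp
  have nonneg: "0 \<le> c" if "mconst c \<in> Q" for c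
  proof (rule ccontr)
    assume c: "\<not> 0 \<le> c"
    have "mconst (- inverse c) * mconst c \<in> Q" using c by (intro scale that) simp
    moreover have "mconst (- inverse c) * mconst c = (- 1 :: 'v mpoly)"
      using c by (simp add: mconst_minus flip: mconst_mult)
    ultimately have "1 \<in> cone_support Q" using D(3) by (simp add: cone_support_def)
    then show False using prime_ideal_setD(5)[OF prime] by simp
  qed
  define near where "near a r \<longleftrightarrow> (\<forall>\<epsilon>>0. a - mconst (r - \<epsilon>) \<in> Q \<and> mconst (r + \<epsilon>) - a \<in> Q)" for a r
  define bnd where "bnd a \<longleftrightarrow> (\<exists>n>0. mconst n - a \<in> Q \<and> mconst n + a \<in> Q)" for a
  \<comment> \<open>The product (n - a)(n + a) may not be formed in \<open>Q\<close>. Instead (n -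
    a)^2 (n + a) + (n + a)^2 (n - a) = 2 n (n^2 - a^2) uses only multiplication by squares.\<close>
  have sq_bound: "mconst (n * n) - a * a \<in> Q" if n: "0 < n" and a: "mconst n - a \<in> Q" "mconst n + a \<in> Q" for n a
  proof -
    let ?N = "mconst n :: 'v mpoly"
    have "(?N - a) * (?N - a) * (?N + a) + (?N + a) * (?N + a) * (?N - a) \<in> Q" by (intro D(1) sq a)
    moreover have "(?N - a) * (?N - a) * (?N + a) + (?N + a) * (?N + a) * (?N - a) = (?N + ?N) * (?N * ?N - a * a)"
      by (simp add: algebra_simps)
    ultimately have "mconst (1 / (2 * n)) * ((?N + ?N) * (?N * ?N - a * a)) \<in> Q" using n by (intro scale) simp_all
    moreover have "mconst (1 / (2 * n)) * (?N + ?N) = 1" using n by (simp flip: mconst_mult mconst_add)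
    ultimately show ?thesis by (simp add: mult.assoc[symmetric] mconst_mult)
  qed
  have quarter: "mconst (1/4) * (a + a + a + a) = a" for a :: "'v mpoly"
  proof -
    have "mconst (1/4) * (a + a + a + a) = (mconst (1/4) + mconst (1/4) + mconst (1/4) + mconst (1/4)) * a"
      by (simp only: distrib_left distrib_right)
    also have "mconst (1/4) + mconst (1/4) + mconst (1/4) + mconst (1/4) = (1 :: 'v mpoly)"
      by (simp flip: mconst_add)
    finally show ?thesis by simp
  qed
  have bnd_add: "bnd (a + b)" if ab: "bnd a" "bnd b" for a b
  proof -
    obtain m n where "0 < m" "mconst m - a \<in> Q" "mconst m + a \<in> Q" "0 < n" "mconst n - b \<in> Q" "mconst n + b \<in> Q"
      using ab unfolding bnd_def by blast
    moreover then have "(mconst m - a) + (mconst n - b) \<in> Q" "(mconst m + a) + (mconst n + b) \<in> Q"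
      by (simp_all only: D(1))
    moreover have "(mconst m - a) + (mconst n - b) = mconst (m + n) - (a + b)"
      "(mconst m + a) + (mconst n + b) = mconst (m + n) + (a + b)" by (simp_all add: mconst_add algebra_simps)
    ultimately show ?thesis unfolding bnd_def by (intro exI[of _ "m + n"]) simp
  qed
  have bnd_neg: "bnd (- a)" if "bnd a" for a using that unfolding bnd_def by auto
  \<comment> \<open>From 4ab = (a + b)^2 - (a - b)^2: the first square is bounded, the second one
    belongs to \<open>Q\<close>. The other sign comes from replacing b by - b.\<close>
  have bnd_half_mult: "\<exists>m. 0 \<le> m \<and> mconst m - a * b \<in> Q" if ab: "bnd a" "bnd b" for a b
  proof -
    obtain n where n: "0 < n" "mconst n - (a + b) \<in> Q" "mconst n + (a + b) \<in> Q"
      using bnd_add[OF ab] unfolding bnd_def by blast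
    have "mconst (n * n) - (a + b) * (a + b) + (a - b) * (a - b) \<in> Q" by (intro D(1) sq_bound n D(6))
    then have "mconst (1/4) * (mconst (n * n) - (a + b) * (a + b) + (a - b) * (a - b)) \<in> Q" by (intro scale) simp_all
    moreover have "mconst (n * n) - (a + b) * (a + b) + (a - b) * (a - b) = mconst (n * n) - (a * b + a * b + a * b + a * b)"
      by (simp add: algebra_simps)
    ultimately have "mconst (1/4) * mconst (n * n) - a * b \<in> Q" by (simp only: right_diff_distrib quarter)
    then show ?thesis by (intro exI[of _ "1/4 * (n * n)"]) (simp add: mconst_mult flip: times_divide_eq_left)
  qed
  have bnd_mult: "bnd (a * b)" if ab: "bnd a" "bnd b" for a b
  proof -
    obtain m where m: "0 \<le> m" "mconst m - a * b \<in> Q" using bnd_half_mult[OF ab] by blast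
    obtain n where n: "0 \<le> n" "mconst n - a * (- b) \<in> Q" using bnd_half_mult[OF ab(1) bnd_neg[OF ab(2)]] by blast
    have "mconst (n + 1) + (mconst m - a * b) \<in> Q" "mconst (m + 1) + (mconst n - a * (- b)) \<in> Q"
      by (intro D(1) pos m n; use m n in simp)+
    moreover have "mconst (n + 1) + (mconst m - a * b) = mconst (m + n + 1) - a * b"
      "mconst (m + 1) + (mconst n - a * (- b)) = mconst (m + n + 1) + a * b"
      by (simp_all add: mconst_add algebra_simps)
    ultimately have "mconst (m + n + 1) - a * b \<in> Q" "mconst (m + n + 1) + a * b \<in> Q" by (simp_all only:)
    then show ?thesis unfolding bnd_def using m n by (intro exI[of _ "m + n + 1"]) simp
  qed
  have bnd: "bnd a" for a
  proof (induction a rule: mpoly_induct)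
    case (const c)
    have "mconst (\<bar>c\<bar> + 1 - c) \<in> Q" "mconst (\<bar>c\<bar> + 1 + c) \<in> Q" by (intro pos; simp)+
    then show ?case unfolding bnd_def by (intro exI[of _ "\<bar>c\<bar> + 1"]) (simp add: mconst_diff mconst_add)
  next
    case (var i)
    let ?x = "mvar i :: 'v mpoly"
    obtain r where r: "mconst r - ?x * ?x \<in> Q" using arch by blast
    define n where "n = \<bar>r\<bar> + 1"
    let ?h = "mconst (1/2) :: 'v mpoly"
    have hh: "?h * y + ?h * y = y" for y
    proof -
      have "?h * y + ?h * y = (?h + ?h) * y" by (simp only: distrib_right)
      also have "?h + ?h = 1" by (simp flip: mconst_add)
      finally show ?thesis by simp
    qed
    \<comment> \<open>A bound on y^2 bounds y because (y - 1)^2 is nonnegative; n is chosen so that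
      the leftover constant is nonnegative.\<close>
    have e: "mconst n - y = ?h * (mconst r - y * y) + ?h * ((y - 1) * (y - 1)) + mconst (n - (1/2 * r + 1/2))" for y :: "'v mpoly"
    proof -
      have "?h * (mconst r - y * y) + ?h * ((y - 1) * (y - 1)) + mconst (n - (1/2 * r + 1/2)) = mconst n - (?h * y + ?h * y)"
        unfolding mconst_diff mconst_add mconst_mult by (simp add: algebra_simps)
      then show ?thesis by (simp only: hh)
    qed
    have c: "0 \<le> n - (1/2 * r + 1/2)" by (simp add: n_def abs_if)
    have "mconst n - y \<in> Q" if "mconst r - y * y \<in> Q" for y
      unfolding e by (intro D(1) scale pos D(6) that c) simp_all
    from this[of ?x] this[of "- ?x"] show ?case unfolding bnd_def using r by (intro exI[of _ n]) (simp add: n_def)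
  qed (auto intro: bnd_add bnd_mult)
  have near_ex: "\<exists>r. near a r" for a
  proof -
    obtain n where n: "mconst n - a \<in> Q" "mconst n + a \<in> Q" using bnd[of a] unfolding bnd_def by blast
    \<comment> \<open>The lower Dedekind cut of a; totality of \<open>Q\<close> turns a failed lower
      bound into an upper bound.\<close>
    define R where "R = {r. a - mconst r \<in> Q}"
    have "- n \<in> R" using n by (simp add: R_def mconst_minus add.commute)
    have up: "r \<le> n" if "r \<in> R" for r
    proof -
      have "(mconst n - a) + (a - mconst r) \<in> Q" using that by (intro D(1) n) (simp add: R_def)
      then have "mconst (n - r) \<in> Q" by (simp add: mconst_diff)
      then show ?thesis using nonneg by fastforce
    qed
    then have bdd: "bdd_above R" by (auto simp: bdd_above_def)
    have "near a (Sup R)" unfolding near_def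
    proof (intro allI impI conjI)
      fix \<epsilon> :: real assume e: "0 < \<epsilon>"
      obtain r where r: "r \<in> R" "Sup R - \<epsilon> < r" using less_cSupD[of R "Sup R - \<epsilon>"] \<open>- n \<in> R\<close> e by auto
      have "(a - mconst r) + mconst (r - (Sup R - \<epsilon>)) \<in> Q" by (intro D(1) pos) (use r in \<open>simp_all add: R_def\<close>)
      moreover have "(a - mconst r) + mconst (r - (Sup R - \<epsilon>)) = a - mconst (Sup R - \<epsilon>)"
        unfolding mconst_diff[of r] by simp
      ultimately show "a - mconst (Sup R - \<epsilon>) \<in> Q" by (simp only:)
      have "Sup R + \<epsilon> \<notin> R" using cSup_upper[OF _ bdd, of "Sup R + \<epsilon>"] e by auto
      then have "- (a - mconst (Sup R + \<epsilon>)) \<in> Q" using total[of "a - mconst (Sup R + \<epsilon>)"] by (simp add: R_def)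
      then show "mconst (Sup R + \<epsilon>) - a \<in> Q" by simp
    qed
    then show ?thesis by blast
  qed
  have near_le: "r \<le> s" if "near a r" "near a s" for a r s
  proof (rule ccontr)
    assume "\<not> r \<le> s"
    define \<epsilon> where "\<epsilon> = (r - s) / 4"
    have e: "0 < \<epsilon>" using \<open>\<not> r \<le> s\<close> unfolding \<epsilon>_def by argo
    have "(a - mconst (r - \<epsilon>)) + (mconst (s + \<epsilon>) - a) \<in> Q" using that e unfolding near_def by (intro D(1)) auto
    moreover have "(a - mconst (r - \<epsilon>)) + (mconst (s + \<epsilon>) - a) = mconst ((s + \<epsilon>) - (r - \<epsilon>))"
      unfolding mconst_diff[of "s + \<epsilon>"] by simp
    ultimately have "mconst ((s + \<epsilon>) - (r - \<epsilon>)) \<in> Q" by (simp only:)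
    then have "0 \<le> (s + \<epsilon>) - (r - \<epsilon>)" by (rule nonneg)
    then show False using \<open>\<not> r \<le> s\<close> unfolding \<epsilon>_def by argo
  qed
  have near_const: "near (mconst c) c" for c unfolding near_def
    by (auto simp: simp flip: mconst_diff intro!: pos)
  have near_add: "near (a + b) (r + s)" if ab: "near a r" "near b s" for a b r s
    unfolding near_def
  proof (intro allI impI)
    fix \<epsilon> :: real assume "0 < \<epsilon>"
    then have e: "0 < \<epsilon> / 2" by simp
    have 1: "(a - mconst (r - \<epsilon>/2)) + (b - mconst (s - \<epsilon>/2)) \<in> Q"
      "(mconst (r + \<epsilon>/2) - a) + (mconst (s + \<epsilon>/2) - b) \<in> Q"
      using ab e unfolding near_def by (auto intro!: D(1))
    have 2: "(r - \<epsilon>/2) + (s - \<epsilon>/2) = r + s - \<epsilon>" "(r + \<epsilon>/2) + (s + \<epsilon>/2) = r + s + \<epsilon>" by simp_all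
    have "(a - mconst (r - \<epsilon>/2)) + (b - mconst (s - \<epsilon>/2)) = a + b - mconst ((r - \<epsilon>/2) + (s - \<epsilon>/2))"
      "(mconst (r + \<epsilon>/2) - a) + (mconst (s + \<epsilon>/2) - b) = mconst ((r + \<epsilon>/2) + (s + \<epsilon>/2)) - (a + b)"
      unfolding mconst_add by (simp_all only: add_diff_add)
    then show "a + b - mconst (r + s - \<epsilon>) \<in> Q \<and> mconst (r + s + \<epsilon>) - (a + b) \<in> Q" using 1 by (simp only: 2)
  qed
  have near_scale: "near (mconst c * a) (c * r)" if a: "near a r" for c a r
  proof -
    have p: "near (mconst c * a) (c * r)" if "0 < c" and a: "near a r" for c a r
      unfolding near_def
    proof (intro allI impI)
      fix \<epsilon> :: real assume "0 < \<epsilon>"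
      then have e: "0 < \<epsilon> / c" using \<open>0 < c\<close> by simp
      have "a - mconst (r - \<epsilon>/c) \<in> Q" "mconst (r + \<epsilon>/c) - a \<in> Q" using a e unfolding near_def by blast+
      then have "mconst c * (a - mconst (r - \<epsilon>/c)) \<in> Q" "mconst c * (mconst (r + \<epsilon>/c) - a) \<in> Q"
        using \<open>0 < c\<close> by (simp_all only: scale less_imp_le)
      moreover have c: "c * (r - \<epsilon>/c) = c * r - \<epsilon>" "c * (r + \<epsilon>/c) = c * r + \<epsilon>"
        using \<open>0 < c\<close> by (simp_all add: distrib_left right_diff_distrib)
      have "mconst c * (a - mconst (r - \<epsilon>/c)) = mconst c * a - mconst (c * r - \<epsilon>)"
        "mconst c * (mconst (r + \<epsilon>/c) - a) = mconst (c * r + \<epsilon>) - mconst c * a"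
        unfolding right_diff_distrib[of "mconst c"] c[symmetric] mconst_mult[of c] by (rule refl)+
      ultimately show "mconst c * a - mconst (c * r - \<epsilon>) \<in> Q \<and> mconst (c * r + \<epsilon>) - mconst c * a \<in> Q"
        by (simp only: simp_thms)
    qed
    have n: "near (- b) (- s)" if "near b s" for b s
      unfolding near_def
    proof (intro allI impI)
      fix \<epsilon> :: real assume "0 < \<epsilon>"
      then have "b - mconst (s - \<epsilon>) \<in> Q" "mconst (s + \<epsilon>) - b \<in> Q" using that by (auto simp: near_def)
      moreover have "- b - mconst (- s - \<epsilon>) = mconst (s + \<epsilon>) - b" "mconst (- s + \<epsilon>) - - b = b - mconst (s - \<epsilon>)"
        by (simp_all add: mconst_diff mconst_add mconst_minus)
      ultimately show "- b - mconst (- s - \<epsilon>) \<in> Q \<and> mconst (- s + \<epsilon>) - - b \<in> Q" by (simp only: simp_thms)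
    qed
    consider "c = 0" | "0 < c" | "0 < - c" by linarith
    then show ?thesis
    proof cases
      case 1
      then show ?thesis using near_const[of 0] by simp
    next
      case 2
      then show ?thesis using p a by blast
    next
      case 3
      then show ?thesis using n[OF p[OF 3 a]] by (simp add: mconst_minus)
    qed
  qed
  have near_sq: "near (a * a) (r * r)" if a: "near a r" for a r
  proof -
    define b where "b = a + mconst (- r)"
    have b: "near b 0" using near_add[OF a near_const[of "- r"]] by (simp add: b_def)
    have "near (b * b) 0" unfolding near_def
    proof (intro allI impI conjI)
      fix \<epsilon> :: real assume "0 < \<epsilon>"
      then have e: "0 < sqrt \<epsilon>" "sqrt \<epsilon> * sqrt \<epsilon> = \<epsilon>" by simp_all
      have b1: "b - mconst (0 - sqrt \<epsilon>) \<in> Q" "mconst (0 + sqrt \<epsilon>) - b \<in> Q" using b e(1) unfolding near_def by blast+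
      have "mconst (sqrt \<epsilon> * sqrt \<epsilon>) - b * b \<in> Q"
        using b1 by (intro sq_bound e(1)) (simp_all add: mconst_minus add.commute)
      then show "mconst (0 + \<epsilon>) - b * b \<in> Q" using \<open>0 < \<epsilon>\<close> by (simp add: e(2))
      have "b * b + mconst \<epsilon> \<in> Q" using \<open>0 < \<epsilon>\<close> by (intro D(1) D(6) pos) simp
      then show "b * b - mconst (0 - \<epsilon>) \<in> Q" by (simp add: mconst_minus)
    qed
    moreover have "a = b + mconst r" by (simp add: b_def mconst_minus)
    then have "a * a = b * b + (mconst (2 * r) * b + mconst (r * r))"
    proof -
      have "mconst (2 * r) = (mconst r + mconst r :: 'v mpoly)" by (simp flip: mconst_add)
      then show ?thesis unfolding \<open>a = b + mconst r\<close> mconst_mult[of r r] by (simp add: algebra_simps)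
    qed
    ultimately show ?thesis using near_add[OF _ near_add[OF near_scale[OF b] near_const]] by fastforce
  qed
  \<comment> \<open>Polarization reduces products to squares, since \<open>Q\<close> need not be
    closed under multiplication.\<close>
  have near_mult: "near (a * b) (r * s)" if a: "near a r" and b: "near b s" for a b r s
  proof -
    have "near (a + mconst (- 1) * b) (r + (- 1) * s)" by (intro near_add near_scale a b)
    from near_add[OF near_scale[OF near_sq[OF near_add[OF a b]], of "1/4"] near_scale[OF near_sq[OF this], of "- 1/4"]]
    have "near (mconst (1/4) * ((a + b) * (a + b)) + mconst (- 1/4) * ((a + mconst (- 1) * b) * (a + mconst (- 1) * b)))
      (1/4 * ((r + s) * (r + s)) + - 1/4 * ((r + (- 1) * s) * (r + (- 1) * s)))" .
    moreover have "1/4 * ((r + s) * (r + s)) + - 1/4 * ((r + (- 1) * s) * (r + (- 1) * s)) = r * s"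
      by (simp add: algebra_simps)
    moreover have "mconst (1/4) * ((a + b) * (a + b)) + mconst (- 1/4) * ((a + mconst (- 1) * b) * (a + mconst (- 1) * b)) = a * b"
    proof -
      have m: "mconst (- 1) = (- 1 :: 'v mpoly)" "mconst (- 1/4) = (- mconst (1/4) :: 'v mpoly)"
        using mconst_minus[of 1] mconst_minus[of "1/4"] by simp_all
      have "mconst (1/4) * ((a + b) * (a + b)) + mconst (- 1/4) * ((a + mconst (- 1) * b) * (a + mconst (- 1) * b))
        = mconst (1/4) * (a * b + a * b + a * b + a * b)" unfolding m by (simp add: algebra_simps)
      then show ?thesis by (simp only: quarter)
    qed
    ultimately show ?thesis by simp
  qed
  have uniq: "r = s" if "near a r" "near a s" for a r s using near_le that by (intro antisym) blast+
  obtain \<phi> where \<phi>: "\<And>a. near a (\<phi> a)" using choice[of near] near_ex by blast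
  have "ring_map \<phi>" unfolding ring_map_def
    using uniq[OF \<phi>] near_const[of 1] near_add[OF \<phi> \<phi>] near_mult[OF \<phi> \<phi>] by simp
  moreover have "\<phi> (mconst c) = c" for c using uniq[OF \<phi> near_const] .
  ultimately have ev: "\<phi> p = meval (\<lambda>i. \<phi> (mvar i)) p" for p using ring_map_eq_msubst[of \<phi> p] by simp
  have "0 \<le> \<phi> p" if p: "p \<in> Q" for p
  proof (rule ccontr)
    assume n: "\<not> 0 \<le> \<phi> p"
    then have "0 < - \<phi> p / 2" by simp
    then have "mconst (\<phi> p + (- \<phi> p / 2)) - p \<in> Q" using \<phi>[of p] unfolding near_def by blast
    from D(1)[OF this p] have "mconst (\<phi> p + (- \<phi> p / 2)) \<in> Q" by (simp only: diff_add_cancel)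
    then have "0 \<le> \<phi> p + (- \<phi> p / 2)" by (rule nonneg)
    then show False using n by simp
  qed
  then show ?thesis using ev by metis
qed

subsection \<open>Exactness of the relaxation\<close>

lemma finite_prod_index: "finite (prod_index :: ('m::finite \<Rightarrow> nat) set)"
proof -
  have "(prod_index :: ('m \<Rightarrow> nat) set) \<subseteq> PiE UNIV (\<lambda>_. {0, 1})" by (force simp: prod_index_def)
  then show ?thesis by (rule finite_subset) (intro finite_PiE; simp)
qed

lemma prod_tuple_remove: "prod_tuple \<gamma> \<alpha> = \<gamma> j ^ \<alpha> j * (\<Prod>i\<in>UNIV - {j}. \<gamma> i ^ \<alpha> i)"
  unfolding prod_tuple_def by (rule prod.remove) simp_all

text \<open>Multiplication by \<gamma>_j switches the exponent \<alpha>_j: from 0 to 1 directly, and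
  from 1 to 0 with \<open>\<gamma>\<^sub>j\<^sup>2\<close> absorbed by the sum of squares.\<close>

lemma generator_in_stabilizer:
  fixes \<gamma> :: "'m::finite \<Rightarrow> 'v mpoly"
  assumes "finite T"
  shows "\<gamma> j \<in> stabilizer (full_cone prod_index (prod_tuple \<gamma>) T h)"
proof -
  let ?M = "full_cone prod_index (prod_tuple \<gamma>) T h"
  have base: "s * prod_tuple \<gamma> \<alpha> \<in> ?M" if "s \<in> SOS" "\<forall>i. \<alpha> i \<in> {0, 1}" for s \<alpha>
  proof (cases "\<alpha> = (\<lambda>_. 0)")
    case True
    then show ?thesis using full_cone_SOS[OF that(1)] by (simp add: prod_tuple_def)
  next
    case False
    then have "\<alpha> \<in> prod_index" using that(2) by (simp add: prod_index_def)
    then show ?thesis by (rule full_cone_generator[OF finite_prod_index _ that(1)])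
  qed
  have step: "\<gamma> j * (s * prod_tuple \<gamma> \<alpha>) \<in> ?M" if s: "s \<in> SOS" and \<alpha>: "\<forall>i. \<alpha> i \<in> {0, 1}" for s \<alpha>
  proof (cases "\<alpha> j = 0")
    case True
    have "\<gamma> j * (s * prod_tuple \<gamma> \<alpha>) = s * prod_tuple \<gamma> (\<alpha>(j := 1))"
      unfolding prod_tuple_remove[of _ _ j] using True by (simp add: ac_simps)
    then show ?thesis using base[OF s, of "\<alpha>(j := 1)"] \<alpha> by simp
  next
    case False
    then have a: "\<alpha> j = 1" using \<alpha> by (meson empty_iff insert_iff)
    have "\<gamma> j * (s * prod_tuple \<gamma> \<alpha>) = (\<gamma> j * \<gamma> j * s) * prod_tuple \<gamma> (\<alpha>(j := 0))"
      unfolding prod_tuple_remove[of _ _ j] using a by (simp add: ac_simps)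
    then show ?thesis using base[OF SOS_square_mult[OF s], of "\<alpha>(j := 0)"] \<alpha> by simp
  qed
  have "\<gamma> j * a \<in> ?M" if "a \<in> ?M" for a
    using that
  proof (rule full_coneE)
    fix \<sigma>0 \<sigma> \<psi>
    assume u: "a = \<sigma>0 + (\<Sum>\<alpha>\<in>prod_index. \<sigma> \<alpha> * prod_tuple \<gamma> \<alpha>) + (\<Sum>t\<in>T. \<psi> t * h t)" "\<sigma>0 \<in> SOS"
      "\<And>\<alpha>. \<alpha> \<in> prod_index \<Longrightarrow> \<sigma> \<alpha> \<in> SOS"
    have e: "\<gamma> j * a = \<gamma> j * (\<sigma>0 * prod_tuple \<gamma> (\<lambda>_. 0)) + (\<Sum>\<alpha>\<in>prod_index. \<gamma> j * (\<sigma> \<alpha> * prod_tuple \<gamma> \<alpha>)) +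
      (\<Sum>t\<in>T. (\<gamma> j * \<psi> t) * h t)"
      by (simp add: u(1) distrib_left sum_distrib_left mult.assoc prod_tuple_def)
    show ?thesis unfolding e
      by (intro full_cone_add full_cone_sum full_cone_ideal step u(2,3) assms) (auto simp: prod_index_def)
  qed
  then show ?thesis by (simp add: stabilizer_def)
qed

lemma in_z_SOS: "p \<in> SOS \<Longrightarrow> in_z p \<in> SOS"
proof -
  note R = ring_mapD[OF ring_map_in_z]
  assume "p \<in> SOS"
  then obtain ps where p: "p = (\<Sum>r\<leftarrow>ps. r ^ 2)" by (auto simp: SOS_def)
  have "in_z (\<Sum>r\<leftarrow>rs. r ^ 2) = (\<Sum>r\<leftarrow>map in_z rs. r ^ 2)" for rs
    by (induction rs) (simp_all add: R)
  then show ?thesis unfolding SOS_def p by blast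
qed

text \<open>The condition \<open>nonzero\<close> secures the Slater point: if some
  \<open>g j\<close> were 0, then \<lambda>_j = 1 with all other multipliers 0 would complete every
  x to a zero of the system with \<lambda>_0 = 0.\<close>

theorem corollary2:
  fixes f :: "'n::finite mpoly" and g :: "'m::finite \<Rightarrow> 'n mpoly"
  assumes minimizer: "has_global_minimizer f g"
    and concave: "\<And>j. concave_on UNIV (peval (g j))"
    and interior: "interior (feasible g) \<noteq> {}"
    and nonzero: "\<And>j. g j \<noteq> 0"
  shows "convex (feasible g)
    \<and> (\<exists>k. rho k (in_z f :: ('n, 'm) zvar mpoly)
              prod_index (prod_tuple (\<lambda>j. in_z (g j))) UNIV (h_FJ_plus f g) = opt_val f g)
    \<and> (archimedean g \<longrightarrow>
         (\<exists>k. rho k (in_z f :: ('n, 'm) zvar mpoly)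
                UNIV (\<lambda>j. in_z (g j)) UNIV (h_FJ_plus f g) = opt_val f g))"
proof -
  let ?F = "in_z f :: ('n, 'm) zvar mpoly"
  let ?G = "\<lambda>j. in_z (g j) :: ('n, 'm) zvar mpoly"
  let ?h = "h_FJ_plus f g"
  obtain x where x: "x \<in> feasible g" and min: "\<And>y. y \<in> feasible g \<Longrightarrow> peval f x \<le> peval f y"
    using minimizer unfolding has_global_minimizer_def by blast
  define v where "v = peval f x"
  have opt: "opt_val f g = ereal v"
    unfolding opt_val_def v_def
    by (intro antisym INF_lower2[OF x] INF_greatest) (simp_all add: min)
  obtain a where a: "a \<in> interior (feasible g)" using interior by blast
  have slater: "0 < peval (g j) a" for j
  proof (rule concave_positive_interior[OF concave nonzero open_interior a])
    fix y assume "y \<in> interior (feasible g)"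
    then have "y \<in> feasible g" using interior_subset by blast
    then show "0 \<le> peval (g j) y" by (simp add: feasible_def)
  qed
  obtain \<zeta>0 :: "('n, 'm) zvar \<Rightarrow> real" where \<zeta>0: "\<And>i. \<zeta>0 (Inl i) = x $ i" "\<And>t. meval \<zeta>0 (?h t) = 0"
    using Fritz_John_necessary[of x g f] x min by blast
  have x0: "(\<chi> i. \<zeta>0 (Inl i)) = x" by (simp add: \<zeta>0 vec_eq_iff)
  have G0: "0 \<le> meval \<zeta>0 (?G j)" for j using x by (simp add: meval_in_z x0 feasible_def)
  have F0: "meval \<zeta>0 ?F = v" by (simp add: meval_in_z x0 v_def)
  have exact: "\<exists>k. rho k ?F J \<Gamma> UNIV ?h = opt_val f g"
    if le: "\<And>j. j \<in> J \<Longrightarrow> 0 \<le> meval \<zeta>0 (\<Gamma> j)" and lim: "trunc_limit J \<Gamma> UNIV ?h (?F - mconst v)"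
    for J :: "'s set" and \<Gamma> :: "'s \<Rightarrow> ('n, 'm) zvar mpoly"
  proof -
    obtain k where "ereal v \<le> rho k ?F J \<Gamma> UNIV ?h" using rho_ge[OF lim] by blast
    moreover have "rho k ?F J \<Gamma> UNIV ?h \<le> ereal (meval \<zeta>0 ?F)" using le \<zeta>0(2) by (intro rho_le) auto
    ultimately show ?thesis unfolding opt F0 by (intro exI[of _ k]) (rule antisym)
  qed
  \<comment> \<open>The ideal part of the cone is symmetric, so it lies in the support of every
    module above the cone.\<close>
  have h_supp: "?h t \<in> cone_support Q" if "full_cone J \<Gamma> UNIV ?h \<subseteq> Q"
    for t Q and J :: "'s set" and \<Gamma> :: "'s \<Rightarrow> ('n, 'm) zvar mpoly"
    using full_cone_ideal[of UNIV t 1 ?h J \<Gamma>] full_cone_ideal[of UNIV t "- 1" ?h J \<Gamma>] that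
    by (auto simp: cone_support_def)
  have value_ge: "v \<le> c" if "\<And>j. 0 \<le> meval \<zeta> (?G j)" "meval \<zeta> (?F - mconst c) = 0" for \<zeta> c
  proof -
    have "(\<chi> i. \<zeta> (Inl i)) \<in> feasible g" using that(1) by (simp add: feasible_def meval_in_z)
    from min[OF this] show ?thesis using that(2) by (simp add: v_def meval_in_z)
  qed
  have "\<exists>k. rho k ?F prod_index (prod_tuple ?G) UNIV ?h = opt_val f g"
  proof (rule exact)
    show "0 \<le> meval \<zeta>0 (prod_tuple ?G \<alpha>)" for \<alpha>
      unfolding prod_tuple_def meval_simps using G0 by (intro prod_nonneg) simp
    let ?M = "full_cone prod_index (prod_tuple ?G) UNIV ?h"
    let ?S = "stabilizer ?M"
    have pS: "preordering ?S" by (rule stabilizer_full_cone)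
    show "trunc_limit prod_index (prod_tuple ?G) UNIV ?h (?F - mconst v)"
    proof (rule trunc_limit_of_supports[OF finite_prod_index finite refl])
      fix Q assume Q: "cone_module ?S Q" "?M \<subseteq> Q" and "\<forall>a. a \<in> Q \<or> - a \<in> Q"
        and Q34: "prime_ideal_set (cone_support Q)" "real_over (cone_support Q) ?S"
      note Q = Q Q34
      let ?I = "cone_support Q"
      have h: "?h t \<in> ?I" for t by (rule h_supp[OF Q(2)])
      have one: "1 \<notin> ?I" by (rule prime_ideal_setD(5)[OF Q(3)])
      note pts = real_prime_well_behaved(1)[OF Q(3) pS Q(4), unfolded has_points_def, THEN spec, THEN spec, THEN spec,
        THEN mp, THEN mp, THEN mp, THEN mp, THEN mp]
      have "lam None \<notin> ?I"
      proof
        assume "lam None \<in> ?I"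
        \<comment> \<open>A real zero of the system with \<lambda>_0 = 0 is requested, without sign
          conditions and with \<open>d = 1\<close>; it contradicts the Slater point.\<close>
        then have "insert (lam None) (range ?h) \<subseteq> ?I" using h by blast
        from pts[OF finite.emptyI empty_subsetI _ this one]
        obtain \<zeta> where \<zeta>: "\<forall>p\<in>insert (lam None) (range ?h). meval \<zeta> p = 0" by auto
        then have "\<zeta> (Inr None) = 0" by (simp add: lam_def)
        then show False using FJ_multiplier_nonzero[where g = g, OF concave slater, of \<zeta> f] \<zeta> by simp
      qed
      from FJ_constant[OF Q(3) pS Q(4) h this] obtain c where c: "?F - mconst c \<in> ?I" by blast
      \<comment> \<open>A second point, now with the constraints as sign conditions: it is feasible
        and f takes the value c there, so c is at least the minimum.\<close>
      have "range ?G \<subseteq> ?S" by (auto intro: generator_in_stabilizer[OF finite])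
      moreover have "{?F - mconst c} \<subseteq> ?I" using c by simp
      ultimately obtain \<zeta> where "\<forall>p\<in>range ?G. 0 \<le> meval \<zeta> p" "\<forall>p\<in>{?F - mconst c}. meval \<zeta> p = 0"
        using pts[of "range ?G" "{?F - mconst c}" 1] one by auto
      then have "v \<le> c" by (intro value_ge[of \<zeta>]) auto
      then show "\<exists>c\<ge>v. ?F - mconst c \<in> ?I" using c by blast
    qed
  qed
  moreover have "\<exists>k. rho k ?F UNIV ?G UNIV ?h = opt_val f g" if arch: "archimedean g"
  proof (rule exact)
    show "0 \<le> meval \<zeta>0 (?G j)" for j by (rule G0)
    let ?M = "full_cone UNIV ?G UNIV ?h"
    let ?S = "stabilizer ?M"
    have pS: "preordering ?S" by (rule stabilizer_full_cone)
    obtain R \<sigma>0 \<sigma> where R: "\<sigma>0 \<in> SOS" "\<And>j. \<sigma> j \<in> SOS"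
      "mconst R - (\<Sum>i\<in>UNIV. mvar i ^ 2) = \<sigma>0 + (\<Sum>j\<in>UNIV. g j * \<sigma> j)"
      using arch unfolding archimedean_def by blast
    note RZ = ring_mapD[OF ring_map_in_z[where 'a = 'n and 'b = 'm]]
    have "in_z (mconst R - (\<Sum>i\<in>UNIV. mvar i ^ 2)) = in_z \<sigma>0 + (\<Sum>j\<in>UNIV. in_z (\<sigma> j) * ?G j) + (\<Sum>t\<in>UNIV. 0 * ?h t)"
      unfolding R(3) by (simp add: RZ ring_map_sum[OF ring_map_in_z] mult.commute)
    moreover have "\<dots> \<in> ?M" by (intro full_coneI in_z_SOS R)
    ultimately have xM: "mconst R - (\<Sum>i\<in>UNIV. mvar (Inl i) * mvar (Inl i)) \<in> ?M"
      by (simp add: RZ ring_map_sum[OF ring_map_in_z] in_z_mconst in_z_mvar power2_eq_square)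
    \<comment> \<open>The Archimedean condition bounds only x; the multipliers are bounded by the
      normalization equation.\<close>
    have lM: "mconst 1 - (\<Sum>k\<in>UNIV. mvar (Inr k) * mvar (Inr k)) \<in> ?M"
      using full_cone_ideal[of UNIV "Inr None" 1 ?h UNIV ?G] by (simp add: lam_def power2_eq_square)
    show "trunc_limit UNIV ?G UNIV ?h (?F - mconst v)"
    proof (rule trunc_limit_of_supports[OF finite finite refl])
      fix Q assume Q: "cone_module ?S Q" "?M \<subseteq> Q" "\<forall>a. a \<in> Q \<or> - a \<in> Q"
        "prime_ideal_set (cone_support Q)" "real_over (cone_support Q) ?S"
      let ?I = "cone_support Q"
      note D = cone_moduleD[OF pS Q(1)]
      have h: "?h t \<in> ?I" for t by (rule h_supp[OF Q(2)])
      \<comment> \<open>Adding back the squares of the other variables isolates the bound for one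
        variable.\<close>
      have single: "mconst r - mvar (\<iota> i) * mvar (\<iota> i) \<in> Q"
        if "mconst r - (\<Sum>i\<in>UNIV. mvar (\<iota> i) * mvar (\<iota> i)) \<in> ?M" for r i and \<iota> :: "'k::finite \<Rightarrow> ('n, 'm) zvar"
      proof -
        have "(\<Sum>j\<in>A. mvar (\<iota> j) * mvar (\<iota> j)) \<in> Q" for A
          by (induction A rule: infinite_finite_induct) (simp_all add: D)
        then have "(mconst r - (\<Sum>i\<in>UNIV. mvar (\<iota> i) * mvar (\<iota> i))) + (\<Sum>j\<in>UNIV - {i}. mvar (\<iota> j) * mvar (\<iota> j)) \<in> Q"
          using that Q(2) by (intro D(1)) auto
        moreover have "(\<Sum>i\<in>UNIV. mvar (\<iota> i) * mvar (\<iota> i)) =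
          mvar (\<iota> i) * mvar (\<iota> i) + (\<Sum>j\<in>UNIV - {i}. mvar (\<iota> j) * mvar (\<iota> j) :: ('n, 'm) zvar mpoly)"
          by (rule sum.remove) simp_all
        ultimately show ?thesis by simp
      qed
      have "\<exists>r. mconst r - mvar i * mvar i \<in> Q" for i
        using single[OF xM] single[OF lM] by (cases i) blast+
      \<comment> \<open>A single point at which all of \<open>Q\<close> is nonnegative replaces the
        transfer argument: it annihilates the support and is feasible because each constraint
        belongs to the cone.\<close>
      from archimedean_total_module_point[OF pS Q(1) _ Q(4) this] Q(3)
      obtain \<zeta> where \<zeta>: "\<And>p. p \<in> Q \<Longrightarrow> 0 \<le> meval \<zeta> p" by blast
      have zero: "meval \<zeta> p = 0" if "p \<in> ?I" for p
        using \<zeta>[of p] \<zeta>[of "- p"] that by (simp add: cone_support_def)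
      have "lam None \<notin> ?I"
      proof
        assume "lam None \<in> ?I"
        then have "\<zeta> (Inr None) = 0" using zero[of "lam None"] by (simp add: lam_def)
        then show False using FJ_multiplier_nonzero[where g = g, OF concave slater, of \<zeta> f] zero[OF h] by blast
      qed
      from FJ_constant[OF Q(4) pS Q(5) h this] obtain c where c: "?F - mconst c \<in> ?I" by blast
      have "1 * ?G j \<in> ?M" for j by (rule full_cone_generator) (use SOS_square[of 1] in simp_all)
      then have "0 \<le> meval \<zeta> (?G j)" for j using \<zeta> Q(2) by auto
      then have "v \<le> c" using zero[OF c] by (rule value_ge)
      then show "\<exists>c\<ge>v. ?F - mconst c \<in> ?I" using c by blast
    qed
  qed
  ultimately show ?thesis using convex_feasible[of g, OF concave] by blast
qed

end
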